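(* Let $K_0\in\mathcal K$ and let $K^*$ be an optimal policy, i.e. a minimizer of $J$ over $\mathcal K$. For every $K\in\mathcal K_0$, $J$ satisfies the gradient domination condition $$J(K)-J(K^* )\le\mu\|\nabla J(K)\|_F^2,$$ where $\mu>0$ is given by $$\mu=\frac{4J(K_0)}{\lambda_1(R)\lambda_1(Q)\lambda_1(\Sigma_0)^2}\left(\|A\|+\frac{\|B\|^2J(K_0)}{\lambda_1(R)\lambda_1(\Sigma_0)}\right)^2.$$
   Context: Data: $A,C\in\mathbb R^{n\times n}$, $B,D\in\mathbb R^{n\times m}$; $Q\in\mathbb R^{n\times n}$ and $R\in\mathbb R^{m\times m}$ symmetric positive definite. On a complete filtered probability space carrying a standard one-dimensional Brownian motion $B(t)$ and an independent $\sigma$-algebra $\mathcal F_0$, the initial state $X(0)$ is an $\mathcal F_0$-measurable $\mathbb R^n$-valued random variable, and $\Sigma_0:=\mathbb E[X(0)X(0)^\top]$ is assumed positive definite. For $K\in\mathbb R^{m\times n}$ (linear feedback $u=KX$) the state satisfies $$dX(t)=(A+BK)X(t)\,dt+(C+DK)X(t)\,dB(t).$$ $K$ is a mean-square stabilizer if $\lim_{t\to\infty}\mathbb E[X(t)^\top X(t)]=0$ for every initial state; $\mathcal K\subset\mathbb R^{m\times n}$ is the set of mean-square stabilizers, assumed nonempty (the system $[A,C;B,D]$ is mean-square stabilizable). The cost is $$J(K)=\mathbb E\int_0^{+\infty}X(t)^\top(Q+K^\top RK)X(t)\,dt,$$ which is finite exactly for $K\in\mathcal K$; for $K\in\mathcal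 K$ one has $J(K)=\mathrm{Tr}(P_K\Sigma_0)$, where $P_K$ is the unique (positive definite) solution of $$(A+BK)^\top P_K+P_K(A+BK)+(C+DK)^\top P_K(C+DK)+Q+K^\top RK=0.$$ $\nabla J$ is the gradient with respect to the inner product $\langle U,V\rangle=\mathrm{Tr}(U^\top V)$. For $K_0\in\mathcal K$, $\mathcal K_0:=\{K: J(K)\le J(K_0)\}$. $\|\cdot\|$ is the spectral norm, $\|\cdot\|_F$ the Frobenius norm; $\lambda_1(\cdot)$ denotes the minimal eigenvalue of a symmetric matrix. *)

theory Defs
  imports "HOL-Probability.Probability"
begin

section \<open>Matrices\<close>

definition positive_definite :: "real^'n^'n \<Rightarrow> bool" where
  "positive_definite S \<longleftrightarrow> transpose S = S \<and> (\<forall>x. x \<noteq> 0 \<longrightarrow> 0 < x \<bullet> (S *v x))"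

definition min_eigenvalue :: "real^'n^'n \<Rightarrow> real" where
  "min_eigenvalue S = (LEAST l. \<exists>v. v \<noteq> 0 \<and> S *v v = l *\<^sub>R v)"

text \<open>The operator norm with respect to the Euclidean norms.  (The type-class
  \<^const>\<open>norm\<close> and \<^const>\<open>inner\<close> on matrices are the Frobenius ones, see below.)\<close>

definition spectral_norm :: "real^'n^'m \<Rightarrow> real" where
  "spectral_norm A = onorm ((*v) A)"

lemma inner_matrix_eq_trace:
  fixes U V :: "real^'n^'m"
  shows "U \<bullet> V = trace (transpose U ** V)"
  unfolding trace_def inner_vec_def matrix_matrix_mult_def transpose_def
  by (simp, rule sum.swap)

lemma norm_matrix_eq_Frobenius:
  fixes U :: "real^'n^'m"
  shows "norm U = sqrt (\<Sum>i\<in>UNIV. \<Sum>j\<in>UNIV. (U $ i $ j)\<^sup>2)"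
  by (simp add: norm_eq_sqrt_inner inner_vec_def power2_eq_square)


section \<open>Brownian motion\<close>

text \<open>Time is the half-line \<open>0 \<le> t\<close>; the values of filtrations and processes at
  negative times are irrelevant.  \<open>F 0\<close> is the initial \<open>\<sigma>\<close>-algebra; it is
  independent of \<open>W\<close> because the increments of \<open>W\<close> after \<open>s\<close> are independent of \<open>F s\<close>.\<close>

locale brownian_basis = prob_space M + complete_measure M + filtration "space M" F
  for M :: "'w measure" and F :: "real \<Rightarrow> 'w measure" +
  fixes W :: "real \<Rightarrow> 'w \<Rightarrow> real"
  assumes sub_F: "0 \<le> t \<Longrightarrow> sets (F t) \<subseteq> sets M"
    and null_F: "null_sets M \<subseteq> sets (F 0)"
    and adapted_W: "0 \<le> t \<Longrightarrow> W t \<in> borel_measurable (F t)"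
    and start_W: "AE \<omega> in M. W 0 \<omega> = 0"
    and normal_increments_W: "\<lbrakk>0 \<le> s; s < t\<rbrakk> \<Longrightarrow>
      distributed M lborel (\<lambda>\<omega>. W t \<omega> - W s \<omega>) (normal_density 0 (sqrt (t - s)))"
    and indep_increments_W: "\<lbrakk>0 \<le> s; s < t\<rbrakk> \<Longrightarrow>
      indep_set (sets (F s)) (sets (vimage_algebra (space M) (\<lambda>\<omega>. W t \<omega> - W s \<omega>) borel))"
    and continuous_W: "AE \<omega> in M. continuous_on {0..} (\<lambda>t. W t \<omega>)"


section \<open>The Ito integral\<close>

text \<open>The triple \<open>(N, \<tau>, \<xi>)\<close> encodes the simple process
  \<open>\<Sum>i<N. \<xi>\<^sub>i 1\<^bsub>(\<tau> i, \<tau> (i+1)]\<^esub>\<close>.\<close>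

definition simple_integrand ::
  "(real \<Rightarrow> 'w measure) \<Rightarrow> nat \<Rightarrow> (nat \<Rightarrow> real) \<Rightarrow> (nat \<Rightarrow> 'w \<Rightarrow> 'a::euclidean_space) \<Rightarrow> bool" where
  "simple_integrand F N \<tau> \<xi> \<longleftrightarrow>
     0 \<le> \<tau> 0 \<and> (\<forall>i<N. \<tau> i \<le> \<tau> (Suc i)) \<and>
     (\<forall>i<N. \<xi> i \<in> borel_measurable (F (\<tau> i)) \<and>
            (\<exists>c. \<forall>\<omega>\<in>space (F (\<tau> i)). norm (\<xi> i \<omega>) \<le> c))"

definition simple_process ::
  "nat \<Rightarrow> (nat \<Rightarrow> real) \<Rightarrow> (nat \<Rightarrow> 'w \<Rightarrow> 'a::euclidean_space) \<Rightarrow> real \<Rightarrow> 'w \<Rightarrow> 'a" where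
  "simple_process N \<tau> \<xi> t \<omega> = (\<Sum>i<N. indicator {\<tau> i<..\<tau> (Suc i)} t *\<^sub>R \<xi> i \<omega>)"

definition simple_integral ::
  "(real \<Rightarrow> 'w \<Rightarrow> real) \<Rightarrow> nat \<Rightarrow> (nat \<Rightarrow> real) \<Rightarrow> (nat \<Rightarrow> 'w \<Rightarrow> 'a::euclidean_space) \<Rightarrow> real \<Rightarrow> 'w \<Rightarrow> 'a" where
  "simple_integral W N \<tau> \<xi> T \<omega> =
     (\<Sum>i<N. (W (min T (\<tau> (Suc i))) \<omega> - W (min T (\<tau> i)) \<omega>) *\<^sub>R \<xi> i \<omega>)"

text \<open>\<open>I\<close> is (a version of) the integral of \<open>H\<close> over \<open>[0,T]\<close>: the mean-square limit of
  the integrals of simple processes approximating \<open>H\<close> in \<open>L\<^sup>2([0,T] \<times> \<Omega>)\<close>.  It is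
  determined up to null sets, hence a relation.\<close>

definition has_ito_integral ::
  "'w measure \<Rightarrow> (real \<Rightarrow> 'w measure) \<Rightarrow> (real \<Rightarrow> 'w \<Rightarrow> real) \<Rightarrow>
   (real \<Rightarrow> 'w \<Rightarrow> 'a::euclidean_space) \<Rightarrow> real \<Rightarrow> ('w \<Rightarrow> 'a) \<Rightarrow> bool" where
  "has_ito_integral M F W H T I \<longleftrightarrow>
     I \<in> borel_measurable M \<and>
     (\<exists>N \<tau> \<xi>. (\<forall>k. simple_integrand F (N k) (\<tau> k) (\<xi> k)) \<and>
       (\<lambda>k. \<integral>\<^sup>+\<omega>. (\<integral>\<^sup>+t\<in>{0..T}.
            ennreal ((norm (H t \<omega> - simple_process (N k) (\<tau> k) (\<xi> k) t \<omega>))\<^sup>2) \<partial>lborel) \<partial>M)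
         \<longlonglongrightarrow> 0 \<and>
       (\<lambda>k. \<integral>\<^sup>+\<omega>. ennreal ((norm (I \<omega> - simple_integral W (N k) (\<tau> k) (\<xi> k) T \<omega>))\<^sup>2) \<partial>M)
         \<longlonglongrightarrow> 0)"


section \<open>Linear stochastic differential equations\<close>

definition progressively_measurable ::
  "(real \<Rightarrow> 'w measure) \<Rightarrow> (real \<Rightarrow> 'w \<Rightarrow> 'a::euclidean_space) \<Rightarrow> bool" where
  "progressively_measurable F X \<longleftrightarrow>
     (\<forall>T\<ge>0. (\<lambda>(t, \<omega>). X t \<omega>) \<in> borel_measurable (restrict_space borel {0..T} \<Otimes>\<^sub>M F T))"

text \<open>Square-integrable solutions of \<open>dX = G X dt + H X dW\<close>.  Progressive measurability at
  time \<open>0\<close> says that the initial state \<open>X 0\<close> is \<open>F 0\<close>-measurable.\<close>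

definition linear_sde_solution ::
  "'w measure \<Rightarrow> (real \<Rightarrow> 'w measure) \<Rightarrow> (real \<Rightarrow> 'w \<Rightarrow> real) \<Rightarrow>
   real^'n^'n \<Rightarrow> real^'n^'n \<Rightarrow> (real \<Rightarrow> 'w \<Rightarrow> real^'n) \<Rightarrow> bool" where
  "linear_sde_solution M F W G H X \<longleftrightarrow>
     progressively_measurable F X \<and>
     (AE \<omega> in M. continuous_on {0..} (\<lambda>t. X t \<omega>)) \<and>
     (\<integral>\<^sup>+\<omega>. ennreal ((norm (X 0 \<omega>))\<^sup>2) \<partial>M) < \<infinity> \<and>
     (\<forall>T\<ge>0. (\<integral>\<^sup>+\<omega>. (\<integral>\<^sup>+t\<in>{0..T}. ennreal ((norm (X t \<omega>))\<^sup>2) \<partial>lborel) \<partial>M) < \<infinity>) \<and>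
     (\<forall>T\<ge>0. has_ito_integral M F W (\<lambda>t \<omega>. H *v X t \<omega>) T
        (\<lambda>\<omega>. X T \<omega> - X 0 \<omega> - (LINT t:{0..T}|lborel. G *v X t \<omega>)))"


section \<open>The linear-quadratic problem\<close>

definition closed_loop_state ::
  "'w measure \<Rightarrow> (real \<Rightarrow> 'w measure) \<Rightarrow> (real \<Rightarrow> 'w \<Rightarrow> real) \<Rightarrow>
   real^'n^'n \<Rightarrow> real^'m^'n \<Rightarrow> real^'n^'n \<Rightarrow> real^'m^'n \<Rightarrow>
   real^'n^'m \<Rightarrow> (real \<Rightarrow> 'w \<Rightarrow> real^'n) \<Rightarrow> bool" where
  "closed_loop_state M F W A B C D K X \<longleftrightarrow>
     linear_sde_solution M F W (A + B ** K) (C + D ** K) X"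

definition ms_stabilizers ::
  "'w measure \<Rightarrow> (real \<Rightarrow> 'w measure) \<Rightarrow> (real \<Rightarrow> 'w \<Rightarrow> real) \<Rightarrow>
   real^'n^'n \<Rightarrow> real^'m^'n \<Rightarrow> real^'n^'n \<Rightarrow> real^'m^'n \<Rightarrow> (real^'n^'m) set" where
  "ms_stabilizers M F W A B C D =
     {K. \<forall>X. closed_loop_state M F W A B C D K X \<longrightarrow>
        ((\<lambda>t. \<integral>\<^sup>+\<omega>. ennreal (X t \<omega> \<bullet> X t \<omega>) \<partial>M) \<longlongrightarrow> 0) at_top}"

definition second_moment :: "'w measure \<Rightarrow> ('w \<Rightarrow> real^'n) \<Rightarrow> real^'n^'n" where
  "second_moment M \<zeta> = (\<chi> i j. \<integral>\<omega>. \<zeta> \<omega> $ i * \<zeta> \<omega> $ j \<partial>M)"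

text \<open>\<open>X K\<close> is the state process under the feedback \<open>K\<close>.  The cost is extended-valued, as it
  is infinite for a feedback that is not stabilizing.\<close>

definition lq_cost ::
  "'w measure \<Rightarrow> real^'n^'n \<Rightarrow> real^'m^'m \<Rightarrow> (real^'n^'m \<Rightarrow> real \<Rightarrow> 'w \<Rightarrow> real^'n) \<Rightarrow>
   real^'n^'m \<Rightarrow> ennreal" where
  "lq_cost M Q R X K =
     (\<integral>\<^sup>+\<omega>. (\<integral>\<^sup>+t\<in>{0..}.
        ennreal (X K t \<omega> \<bullet> ((Q + transpose K ** R ** K) *v X K t \<omega>)) \<partial>lborel) \<partial>M)"

definition gradient_domination_const ::
  "real^'n^'n \<Rightarrow> real^'m^'n \<Rightarrow> real^'n^'n \<Rightarrow> real^'m^'m \<Rightarrow> real^'n^'n \<Rightarrow> real \<Rightarrow> real" where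
  "gradient_domination_const A B Q R \<Sigma>0 J0 =
     4 * J0 / (min_eigenvalue R * min_eigenvalue Q * (min_eigenvalue \<Sigma>0)\<^sup>2) *
     (spectral_norm A + (spectral_norm B)\<^sup>2 * J0 / (min_eigenvalue R * min_eigenvalue \<Sigma>0))\<^sup>2"

end

theory Submission
  imports Defs
begin

text \<open>The second moments \<open>S t = E[X t X t\<^sup>T]\<close> of the closed loop satisfy
  \<open>S T - S 0 = lyap (\<integral>\<^sub>0\<^sup>T S)\<close> for the generalized Lyapunov operator
  \<open>lyap Z = a Z + Z a\<^sup>T + c Z c\<^sup>T\<close>, where \<open>a = A + B K\<close> and \<open>c = C + D K\<close>.  This follows from the
  Ito isometry and the martingale property alone: writing \<open>v \<bullet> X\<close> as initial value, Lebesgue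
  integral and Ito integral, all cross terms of its square can be computed by Fubini.

  If \<open>lyap Y < 0\<close> for some positive semidefinite \<open>Y\<close> then \<open>lyap\<close> is inverse-positive, as for
  M-matrices.  So finite cost means \<open>J(K) = \<langle>Q + K\<^sup>T R K, Y\<^sub>K\<rangle>\<close> with \<open>lyap Y\<^sub>K = - \<Sigma>0\<close>, and the dual
  equation has a positive semidefinite solution \<open>P\<close>, which is a Lyapunov function for all \<open>L\<close> near
  \<open>K\<close>.  With \<open>E = R K + B\<^sup>T P + D\<^sup>T P (C + D K)\<close> and \<open>\<Delta> = L - K\<close>, duality gives the exact identity
  \<open>J(L) - J(K) = \<langle>\<Delta>, 2 E Y\<^sub>L + (R + D\<^sup>T P D) \<Delta> Y\<^sub>L\<rangle>\<close>.  Continuity of \<open>Y\<^sub>L\<close> at \<open>K\<close> yields the gradient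
  \<open>2 E Y\<^sub>K\<close>, and completing the square yields \<open>J(K) - J(L) \<le> \<parallel>E\<parallel>\<^sup>2 tr Y\<^sub>L / \<lambda>\<^sub>1(R)\<close>.  It remains to bound
  \<open>tr Y\<^sub>L\<close> by the cost and \<open>\<lambda>\<^sub>1(Y\<^sub>K)\<close> from below, by testing \<open>lyap Y\<^sub>K = - \<Sigma>0\<close> with an eigenvector.\<close>

section \<open>Matrices and quadratic forms\<close>

text \<open>Everything stochastic serves to establish \<open>moment_flow\<close>; all that follows
  it is finite-dimensional. The equation is kept in integral form, so no derivative of
  \<open>S\<close> is ever taken. The Ito integral is only a relation fixed by mean-square limits at
  each single time; its measurability in time is read off from the state, because the Ito part up to
  \<open>r\<close> is the state minus its initial value and its drift part.

  The delicate point of the constant is a circularity. The lower bound for \<lambda>1(Y_K) involves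
  the norm of \<open>K\<close>, and the bound on that norm by the cost involves \<lambda>1(Y_K).
  With \<alpha> = |A| + |B| |K| the two combine to a quadratic inequality, from which \<alpha> is at
  most twice the bracket in \<mu>.\<close>

declare transpose_matrix_vector [simp del]

lemma inner_matrix_mult_left:
  fixes U :: "real^'n^'m" and V :: "real^'p^'n" and Z :: "real^'p^'m"
  shows "(U ** V) \<bullet> Z = V \<bullet> (transpose U ** Z)"
proof -
  have "(U ** V) \<bullet> Z = (\<Sum>i\<in>UNIV. \<Sum>j\<in>UNIV. \<Sum>k\<in>UNIV. U$i$k * V$k$j * Z$i$j)"
    by (simp add: inner_vec_def matrix_matrix_mult_def sum_distrib_right)
  also have "\<dots> = (\<Sum>k\<in>UNIV. \<Sum>j\<in>UNIV. \<Sum>i\<in>UNIV. U$i$k * V$k$j * Z$i$j)"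
    by (subst sum.swap, subst (2) sum.swap, subst sum.swap) (rule refl)
  also have "\<dots> = V \<bullet> (transpose U ** Z)"
    by (simp add: inner_vec_def matrix_matrix_mult_def transpose_def sum_distrib_left mult_ac)
  finally show ?thesis .
qed

lemma inner_transpose:
  fixes U V :: "real^'n^'m"
  shows "transpose U \<bullet> transpose V = U \<bullet> V"
  by (simp add: inner_vec_def transpose_def) (rule sum.swap)

lemma inner_matrix_mult_right:
  fixes U :: "real^'n^'m" and V :: "real^'p^'n" and Z :: "real^'p^'m"
  shows "(U ** V) \<bullet> Z = U \<bullet> (Z ** transpose V)"
proof -
  have "(U ** V) \<bullet> Z = (transpose V ** transpose U) \<bullet> transpose Z"
    by (metis inner_transpose matrix_transpose_mul)
  also have "\<dots> = transpose U \<bullet> transpose (Z ** transpose V)"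
    by (simp add: inner_matrix_mult_left matrix_transpose_mul)
  finally show ?thesis by (simp add: inner_transpose)
qed

lemma linear_transpose: "linear (transpose :: real^'n^'m \<Rightarrow> real^'m^'n)"
  by (rule linearI) (simp_all add: transpose_def vec_eq_iff)

lemmas transpose_add = linear_add[OF linear_transpose]
lemmas transpose_diff = linear_diff[OF linear_transpose]
lemmas transpose_scaleR = linear_scale[OF linear_transpose]
lemmas transpose_neg = linear_neg[OF linear_transpose]
lemmas transpose_zero = linear_0[OF linear_transpose]

lemma bounded_bilinear_matrix_mult:
  "bounded_bilinear ((**) :: real^'n^'m \<Rightarrow> real^'p^'n \<Rightarrow> real^'p^'m)"
proof -
  have "bilinear ((**) :: real^'n^'m \<Rightarrow> real^'p^'n \<Rightarrow> real^'p^'m)"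
    unfolding bilinear_def
    by (auto intro!: linearI simp: matrix_matrix_mult_def vec_eq_iff sum_distrib_left mult_ac sum.distrib algebra_simps)
  then show ?thesis by (simp add: bilinear_conv_bounded_bilinear)
qed

interpretation mm: bounded_bilinear "(**) :: real^'n^'m \<Rightarrow> real^'p^'n \<Rightarrow> real^'p^'m"
  by (rule bounded_bilinear_matrix_mult)

lemma bounded_bilinear_matrix_vector_mult:
  "bounded_bilinear ((*v) :: real^'n^'m \<Rightarrow> real^'n \<Rightarrow> real^'m)"
proof -
  have "bilinear ((*v) :: real^'n^'m \<Rightarrow> real^'n \<Rightarrow> real^'m)"
    unfolding bilinear_def
    by (auto intro!: linearI simp: matrix_vector_mult_def vec_eq_iff sum_distrib_left mult_ac
        sum.distrib algebra_simps)
  then show ?thesis by (simp add: bilinear_conv_bounded_bilinear)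
qed

interpretation mv: bounded_bilinear "(*v) :: real^'n^'m \<Rightarrow> real^'n \<Rightarrow> real^'m"
  by (rule bounded_bilinear_matrix_vector_mult)

lemma inner_mv_transpose:
  fixes A :: "real^'n^'m"
  shows "(A *v x) \<bullet> y = x \<bullet> (transpose A *v y)"
  by (metis dot_lmul_matrix inner_commute transpose_matrix_vector)

section \<open>Rank-one and positive semidefinite matrices\<close>

text \<open>Pairing with \<open>outer w\<close> evaluates a quadratic form at \<open>w\<close>.
  Positive semidefinite matrices are sums of such matrices and second moments are integrals of them,
  so both are handled by linearity.\<close>

definition outer :: "real^'n \<Rightarrow> real^'n^'n" where
  "outer w = (\<chi> i j. w $ i * w $ j)"

lemma inner_outer: "N \<bullet> outer w = w \<bullet> (N *v w)"
  by (simp add: outer_def inner_vec_def matrix_vector_mult_def sum_distrib_left mult_ac)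

lemma outer_mult_vec: "outer w *v x = (w \<bullet> x) *\<^sub>R w"
  by (simp add: outer_def vec_eq_iff inner_vec_def matrix_vector_mult_def sum_distrib_left
      sum_distrib_right mult_ac)

lemma transpose_outer: "transpose (outer w) = outer w"
  by (simp add: outer_def transpose_def vec_eq_iff mult_ac)

definition psd :: "real^'n^'n \<Rightarrow> bool" where
  "psd S \<longleftrightarrow> transpose S = S \<and> (\<forall>x. 0 \<le> x \<bullet> (S *v x))"

lemma psd_sym: "psd S \<Longrightarrow> transpose S = S"
  and psd_nonneg: "psd S \<Longrightarrow> 0 \<le> x \<bullet> (S *v x)"
  by (auto simp: psd_def)

lemma positive_definite_psd: "positive_definite S \<Longrightarrow> psd S"
  unfolding positive_definite_def psd_def by (metis inner_zero_left less_imp_le order_refl)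

lemma symmetric_inner_swap: 
  fixes S :: "real^'n^'n"
  assumes "transpose S = S" shows "x \<bullet> (S *v y) = y \<bullet> (S *v x)"
  by (metis assms inner_commute inner_mv_transpose)

text \<open>A zero of a nonnegative form is a minimum: a small step from \<open>v\<close> against
  \<open>S *v v\<close> would make the form negative unless \<open>S *v v = 0\<close>.\<close>

lemma psd_null:
  assumes S: "psd S" and v: "v \<bullet> (S *v v) = 0"
  shows "S *v v = 0"
proof (rule ccontr)
  assume nz: "S *v v \<noteq> 0"
  define w where "w = S *v v"
  define \<alpha> where "\<alpha> = w \<bullet> w"
  define \<beta> where "\<beta> = w \<bullet> (S *v w)"
  \<comment> \<open>Small enough for \<open>t * \<beta> \<le> \<alpha>\<close>, whereas
    nonnegativity demands \<open>2 * \<alpha> \<le> t * \<beta>\<close>; the \<open>+ 1\<close>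
    covers \<open>\<beta> = 0\<close>.\<close>
  define t where "t = \<alpha> / (\<beta> + 1)"
  have \<alpha>: "\<alpha> > 0" using nz by (simp add: \<alpha>_def w_def)
  have \<beta>: "\<beta> \<ge> 0" using S by (simp add: \<beta>_def psd_nonneg)
  have t: "t > 0" using \<alpha> \<beta> by (simp add: t_def)
  have vw: "v \<bullet> (S *v w) = \<alpha>"
    using symmetric_inner_swap[OF psd_sym[OF S], of v w] by (simp add: \<alpha>_def w_def)
  have "0 \<le> (v - t *\<^sub>R w) \<bullet> (S *v (v - t *\<^sub>R w))" using S by (rule psd_nonneg)
  also have "\<dots> = - 2 * t * \<alpha> + t * t * \<beta>"
    using v vw by (simp add: mv.diff_right mv.scaleR_right inner_diff_left inner_diff_right
        \<alpha>_def[symmetric] \<beta>_def[symmetric] w_def[symmetric] algebra_simps)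
  also have "\<dots> = t * (t * \<beta> - 2 * \<alpha>)" by (simp add: algebra_simps)
  finally have "2 * \<alpha> \<le> t * \<beta>" using t by (simp add: zero_le_mult_iff)
  moreover have "t * \<beta> \<le> \<alpha>" using \<alpha> \<beta> by (simp add: t_def field_simps)
  ultimately show False using \<alpha> by simp
qed

text \<open>Gaussian elimination (Cholesky): peeling off one column at a time.\<close>

lemma psd_induct [consumes 1, case_names zero add]:
  assumes S: "psd S"
    and zero: "P 0"
    and add: "\<And>Z w. P Z \<Longrightarrow> P (Z + outer w)"
  shows "P S"
  using S
\<comment> \<open>Counting nonzero diagonal entries suffices, because a zero diagonal entry of a
  positive semidefinite matrix forces a zero column.\<close>
proof (induction "card {i. S $ i $ i \<noteq> 0}" arbitrary: S rule: less_induct)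
  case (less S)
  have diag: "S $ i $ i = axis i 1 \<bullet> (S *v axis i 1)" for i
    by (simp add: inner_axis' matrix_vector_mult_basis column_def)
  have col: "S $ k $ i = 0" if "S $ i $ i = 0" for i k
  proof -
    have "S *v axis i 1 = 0" using psd_null[OF less.prems] diag that by metis
    then have "(S *v axis i 1) $ k = 0" by simp
    then show ?thesis by (simp add: matrix_vector_mult_basis column_def)
  qed
  show ?case
  proof (cases "\<exists>i. S $ i $ i \<noteq> 0")
    case False
    then have "S = 0" using col by (simp add: vec_eq_iff)
    then show ?thesis using zero by simp
  next
    case True
    then obtain i where i: "S $ i $ i \<noteq> 0" by auto
    have "S $ i $ i \<ge> 0" using less.prems diag psd_nonneg by metis
    with i have pos: "S $ i $ i > 0" by simp
    define e where "e = (axis i 1 :: real^'a)"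
    define u where "u = S *v e"
    define d where "d = S $ i $ i"
    define w where "w = (1 / sqrt d) *\<^sub>R u"
    define T where "T = S - outer w"
    have ed: "e \<bullet> u = d" by (simp add: e_def u_def d_def diag)
    have d: "d > 0" using pos by (simp add: d_def)
    have Tx: "T *v x = S *v x - ((u \<bullet> x) / d) *\<^sub>R u" for x
      using d by (simp add: T_def w_def mv.diff_left outer_mult_vec)
    have Te: "T *v e = 0" using ed d by (simp add: Tx u_def[symmetric] inner_commute)
    have trT: "transpose T = T"
      using psd_sym[OF less.prems] by (simp add: T_def transpose_diff transpose_outer)
    have psdT: "psd T"
      unfolding psd_def
    proof (intro conjI allI)
      show "transpose T = T" by (rule trT)
      fix x
      \<comment> \<open>\<open>T\<close> kills \<open>e\<close>, so subtracting a multiple of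
        \<open>e\<close> does not change its form; this multiple makes \<open>y\<close> orthogonal
        to \<open>u\<close>, where \<open>T\<close> and \<open>S\<close> agree.\<close>
      define y where "y = x - ((u \<bullet> x) / d) *\<^sub>R e"
      have "T *v y = T *v x" by (simp add: y_def mv.diff_right mv.scaleR_right Te)
      moreover have "e \<bullet> (T *v x) = 0" using symmetric_inner_swap[OF trT, of e x] Te by simp
      ultimately have "x \<bullet> (T *v x) = y \<bullet> (T *v y)" by (simp add: y_def inner_diff_left)
      also have uy: "u \<bullet> y = 0" using ed d by (simp add: y_def inner_diff_right inner_commute)
      have "y \<bullet> (T *v y) = y \<bullet> (S *v y)" using uy by (simp add: Tx)
      finally show "0 \<le> x \<bullet> (T *v x)" using psd_nonneg[OF less.prems] by simp
    qed
    \<comment> \<open>Elimination creates no new nonzero diagonal entry, since a zero column of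
      \<open>S\<close> gives a zero entry of \<open>w\<close>, and it clears position
      \<open>i\<close>.\<close>
    have "{k. T $ k $ k \<noteq> 0} \<subset> {k. S $ k $ k \<noteq> 0}"
    proof
      show "{k. T $ k $ k \<noteq> 0} \<subseteq> {k. S $ k $ k \<noteq> 0}"
      proof (clarsimp)
        fix k assume nz: "T $ k $ k \<noteq> 0" and z: "S $ k $ k = 0"
        have "u $ k = S $ k $ i" by (simp add: u_def e_def matrix_vector_mult_basis column_def)
        also have "\<dots> = transpose S $ k $ i" by (simp add: psd_sym[OF less.prems])
        also have "\<dots> = 0" using col[OF z] by (simp add: transpose_def)
        finally have "w $ k = 0" by (simp add: w_def)
        then show False using nz z by (simp add: T_def outer_def)
      qed
      have "T $ i $ i = (T *v e) $ i" by (simp add: e_def matrix_vector_mult_basis column_def)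
      then have "T $ i $ i = 0" by (simp add: Te)
      then show "{k. T $ k $ k \<noteq> 0} \<noteq> {k. S $ k $ k \<noteq> 0}" using i by auto
    qed
    then have "card {k. T $ k $ k \<noteq> 0} < card {k. S $ k $ k \<noteq> 0}"
      by (simp add: psubset_card_mono)
    then have "P T" using less.hyps psdT by blast
    then have "P (T + outer w)" by (rule add)
    then show ?thesis by (simp add: T_def)
  qed
qed

text \<open>Each rank-one summand of \<open>Y\<close> contributes a value of the form of
  \<open>N\<close>, so only that form matters and \<open>N\<close> may be nonsymmetric. This is the
  bridge from quadratic forms to Frobenius products.\<close>

lemma psd_inner_nonneg:
  assumes "psd Y" "\<And>x. 0 \<le> x \<bullet> (N *v x)"
  shows "0 \<le> N \<bullet> Y"
  using assms(1) by (induction rule: psd_induct) (simp_all add: inner_add_right inner_outer assms(2))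

lemma inner_mat1: "mat 1 \<bullet> Y = trace (Y :: real^'n^'n)"
  by (simp add: inner_matrix_eq_trace transpose_mat)

lemma psd_inner_mono:
  assumes "psd Y" "\<And>x. x \<bullet> (N *v x) \<le> x \<bullet> (N' *v x)"
  shows "N \<bullet> Y \<le> N' \<bullet> Y"
  using psd_inner_nonneg[OF assms(1), of "N' - N"] assms(2)
  by (simp add: mv.diff_left inner_diff_left inner_diff_right)

lemma psd_inner_ge_trace:
  assumes "psd Y" "\<And>x. c * (x \<bullet> x) \<le> x \<bullet> (N *v x)"
  shows "c * trace Y \<le> N \<bullet> Y"
  using psd_inner_mono[OF assms(1), of "c *\<^sub>R mat 1" N] assms(2)
  by (simp add: mv.scaleR_left inner_mat1)

lemma psd_inner_le_trace:
  assumes "psd Y" "\<And>x. x \<bullet> (N *v x) \<le> c * (x \<bullet> x)"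
  shows "N \<bullet> Y \<le> c * trace Y"
  using psd_inner_mono[OF assms(1), of N "c *\<^sub>R mat 1"] assms(2)
  by (simp add: mv.scaleR_left inner_mat1)

lemma psd_trace_nonneg: "psd Y \<Longrightarrow> 0 \<le> trace Y"
  using psd_inner_nonneg[of Y "mat 1"] by (simp add: inner_mat1)

lemma norm_matrix_vector_le:
  fixes A :: "real^'n^'m"
  shows "norm (A *v x) \<le> norm A * norm x"
proof (rule power2_le_imp_le)
  have "(norm (A *v x))\<^sup>2 = (\<Sum>i\<in>UNIV. (A$i \<bullet> x)\<^sup>2)"
    by (simp only: power2_norm_eq_inner) (simp add: inner_vec_def matrix_vector_mult_def power2_eq_square)
  also have "\<dots> \<le> (\<Sum>i\<in>UNIV. (A$i \<bullet> A$i) * (x \<bullet> x))"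
    by (intro sum_mono Cauchy_Schwarz_ineq)
  also have "\<dots> = (norm A)\<^sup>2 * (norm x)\<^sup>2"
    by (simp add: power2_norm_eq_inner inner_vec_def[of A A] sum_distrib_right)
  finally show "(norm (A *v x))\<^sup>2 \<le> (norm A * norm x)\<^sup>2" by (simp add: power_mult_distrib)
qed simp

lemma quad_le_norm: "x \<bullet> (S *v x) \<le> norm S * (x \<bullet> x)" for S :: "real^'n^'n"
proof -
  have "x \<bullet> (S *v x) \<le> norm x * norm (S *v x)" by (rule norm_cauchy_schwarz)
  also have "\<dots> \<le> norm x * (norm S * norm x)" by (intro mult_left_mono norm_matrix_vector_le) simp
  finally show ?thesis by (simp add: power2_norm_eq_inner[symmetric] power2_eq_square mult_ac)
qed

text \<open>Testing the trace bound with \<open>Y\<close> itself gives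
  \<open>Y \<bullet> Y \<le> norm Y * trace Y\<close>, and one factor cancels.\<close>

lemma psd_norm_le_trace: "psd Y \<Longrightarrow> norm Y \<le> trace Y"
proof -
  assume Y: "psd Y"
  have "Y \<bullet> Y \<le> norm Y * trace Y" by (rule psd_inner_le_trace[OF Y quad_le_norm])
  then have "norm Y * norm Y \<le> norm Y * trace Y"
    by (simp add: power2_norm_eq_inner[symmetric] power2_eq_square)
  then show ?thesis using psd_trace_nonneg[OF Y] by (cases "norm Y = 0") auto
qed

section \<open>Minimal eigenvalues\<close>

text \<open>The generalized Rayleigh quotient is homogeneous of degree 0 and attains its minimum on
  the compact unit sphere. With \<open>Y = mat 1\<close> this yields eigenvectors; with a stability
  certificate as \<open>Y\<close> it drives the M-matrix argument.\<close>

lemma ratio_attains_inf: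
  fixes Z Y :: "real^'n^'n"
  assumes Y: "positive_definite Y"
  obtains v l where "v \<noteq> 0" "v \<bullet> (Z *v v) = l * (v \<bullet> (Y *v v))" "\<And>x. l * (x \<bullet> (Y *v x)) \<le> x \<bullet> (Z *v x)"
proof -
  define f where "f x = (x \<bullet> (Z *v x)) / (x \<bullet> (Y *v x))" for x
  have Yp: "x \<bullet> (Y *v x) > 0" if "x \<noteq> 0" for x using Y that by (simp add: positive_definite_def)
  have "continuous_on (sphere 0 1) f"
    unfolding f_def by (intro continuous_intros mv.continuous_on ballI less_imp_neq[OF Yp, symmetric]) auto
  moreover have "sphere (0::real^'n) 1 \<noteq> {}" by simp
  ultimately obtain v where v: "v \<in> sphere 0 1" "\<And>y. y \<in> sphere 0 1 \<Longrightarrow> f v \<le> f y"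
    using continuous_attains_inf[OF compact_sphere] by metis
  have v0: "v \<noteq> 0" using v(1) by auto
  show ?thesis
  proof (rule that[OF v0])
    show "v \<bullet> (Z *v v) = f v * (v \<bullet> (Y *v v))" using Yp[OF v0] by (simp add: f_def)
    fix x
    show "f v * (x \<bullet> (Y *v x)) \<le> x \<bullet> (Z *v x)"
    proof (cases "x = 0")
      case False
      define y where "y = x /\<^sub>R norm x"
      have "f v \<le> f y" using False by (intro v(2)) (simp add: y_def)
      also have "f y = f x" using False by (simp add: f_def y_def mv.scaleR_right)
      finally show ?thesis using Yp[OF False] by (simp add: f_def field_simps)
    qed simp
  qed
qed

lemma positive_definite_mat1: "positive_definite (mat 1)"
  by (simp add: positive_definite_def transpose_mat)

text \<open>The minimizer \<open>v\<close> of the Rayleigh quotient is a null vector of the positive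
  semidefinite matrix S - l I, so \<open>psd_null\<close> makes it an eigenvector.\<close>

lemma sym_min_eigen:
  fixes S :: "real^'n^'n"
  assumes S: "transpose S = S"
  obtains v l where "v \<noteq> 0" "S *v v = l *\<^sub>R v" "\<And>x. l * (x \<bullet> x) \<le> x \<bullet> (S *v x)"
proof -
  obtain v l where v: "v \<noteq> 0" "v \<bullet> (S *v v) = l * (v \<bullet> v)" "\<And>x. l * (x \<bullet> x) \<le> x \<bullet> (S *v x)"
    using ratio_attains_inf[OF positive_definite_mat1, of S] by auto
  have "psd (S - l *\<^sub>R mat 1)"
    using v(3) by (simp add: psd_def transpose_diff transpose_scaleR S transpose_mat mv.diff_left
        mv.scaleR_left inner_diff_right)
  then have "(S - l *\<^sub>R mat 1) *v v = 0"
    by (rule psd_null) (simp add: mv.diff_left mv.scaleR_left inner_diff_right v(2))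
  then have "S *v v = l *\<^sub>R v" by (simp add: mv.diff_left mv.scaleR_left)
  then show ?thesis using that v by blast
qed

text \<open>A \<open>LEAST\<close> over the reals needs a witness: the minimal Rayleigh quotient is
  an eigenvalue and bounds every other eigenvalue from below.\<close>

lemma min_eigenvalue_le:
  fixes S :: "real^'n^'n"
  assumes S: "transpose S = S"
  shows "min_eigenvalue S * (x \<bullet> x) \<le> x \<bullet> (S *v x)"
    and "\<exists>v. v \<noteq> 0 \<and> S *v v = min_eigenvalue S *\<^sub>R v"
proof -
  obtain v l where v: "v \<noteq> 0" "S *v v = l *\<^sub>R v" "\<And>x. l * (x \<bullet> x) \<le> x \<bullet> (S *v x)"
    using sym_min_eigen[OF S] by blast
  have eq: "min_eigenvalue S = l"
    unfolding min_eigenvalue_def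
  proof (rule Least_equality)
    show "\<exists>v. v \<noteq> 0 \<and> S *v v = l *\<^sub>R v" using v by blast
    fix k assume "\<exists>v. v \<noteq> 0 \<and> S *v v = k *\<^sub>R v"
    then obtain w where w: "w \<noteq> 0" "S *v w = k *\<^sub>R w" by blast
    then show "l \<le> k" using v(3)[of w] by simp
  qed
  show "min_eigenvalue S * (x \<bullet> x) \<le> x \<bullet> (S *v x)" using v eq by simp
  show "\<exists>v. v \<noteq> 0 \<and> S *v v = min_eigenvalue S *\<^sub>R v" using v eq by blast
qed

lemma min_eigenvalue_pos: "positive_definite S \<Longrightarrow> 0 < min_eigenvalue S"
proof -
  assume S: "positive_definite S"
  then obtain v where v: "v \<noteq> 0" "S *v v = min_eigenvalue S *\<^sub>R v"
    using min_eigenvalue_le(2) by (auto simp: positive_definite_def)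
  have "0 < v \<bullet> (S *v v)" using S v(1) by (simp add: positive_definite_def)
  then have "0 < min_eigenvalue S * (v \<bullet> v)" by (simp add: v(2))
  moreover have "0 < v \<bullet> v" using v(1) by simp
  ultimately show ?thesis by (rule zero_less_mult_pos2)
qed

section \<open>Generalized Lyapunov operators\<close>

definition lyap :: "real^'n^'n \<Rightarrow> real^'n^'n \<Rightarrow> real^'n^'n \<Rightarrow> real^'n^'n" where
  "lyap a c Z = a ** Z + Z ** transpose a + c ** Z ** transpose c"

lemma linear_lyap: "linear (lyap a c)"
  by (rule linearI)
    (simp_all add: lyap_def mm.add_left mm.add_right mm.scaleR_left mm.scaleR_right scaleR_add_right)

text \<open>The adjoint has the same shape with both matrices transposed, so the equation for P_K is
  itself a \<open>lyap\<close> equation and the lemmas on \<open>lyap\<close> serve both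
  sides.\<close>

lemma lyap_adjoint: "lyap a c Z \<bullet> P = Z \<bullet> lyap (transpose a) (transpose c) P"
proof -
  have "(c ** Z ** transpose c) \<bullet> P = Z \<bullet> (transpose c ** (P ** c))"
    by (metis inner_matrix_mult_left inner_matrix_mult_right transpose_transpose)
  moreover have "(Z ** transpose a) \<bullet> P = Z \<bullet> (P ** a)"
    by (metis inner_matrix_mult_right transpose_transpose)
  ultimately show ?thesis
    by (simp add: lyap_def inner_add_left inner_add_right inner_matrix_mult_left[of a]
        matrix_mul_assoc transpose_transpose)
qed

lemma lyap_sym: "transpose Z = Z \<Longrightarrow> transpose (lyap a c Z) = lyap a c Z"
  by (simp add: lyap_def transpose_add matrix_transpose_mul transpose_transpose matrix_mul_assoc)

lemma lyap_quad:
  assumes Z: "transpose Z = Z"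
  shows "v \<bullet> (lyap a c Z *v v)
    = 2 * ((transpose a *v v) \<bullet> (Z *v v)) + (transpose c *v v) \<bullet> (Z *v (transpose c *v v))"
proof -
  have 1: "v \<bullet> (a *v (Z *v v)) = (transpose a *v v) \<bullet> (Z *v v)"
    by (simp add: inner_mv_transpose transpose_transpose)
  have 2: "v \<bullet> (Z *v (transpose a *v v)) = (transpose a *v v) \<bullet> (Z *v v)"
    using symmetric_inner_swap[OF Z] by blast
  have 3: "v \<bullet> (c *v (Z *v (transpose c *v v))) = (transpose c *v v) \<bullet> (Z *v (transpose c *v v))"
    by (simp add: inner_mv_transpose transpose_transpose)
  show ?thesis
    using 1 2 3 by (simp add: lyap_def mv.add_left inner_add_right matrix_vector_mul_assoc[symmetric])
qed

text \<open>Since \<open>psd_null\<close> gives \<open>Z *v v = 0\<close>, the drift terms vanish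
  and only the form of \<open>Z\<close> at \<open>transpose c *v v\<close> is left. In the M-matrix
  analogy this is the sign condition on off-diagonal entries.\<close>

lemma lyap_null:
  assumes Z: "psd Z" and v: "v \<bullet> (Z *v v) = 0"
  shows "0 \<le> v \<bullet> (lyap a c Z *v v)"
  using psd_null[OF Z v] Z by (simp add: lyap_quad psd_sym psd_nonneg)

text \<open>A strict certificate stands in for spectral or dynamical stability. Both finite cost and
  decaying moments deliver one directly, as an integral of second moments.\<close>

definition stable_pair :: "real^'n^'n \<Rightarrow> real^'n^'n \<Rightarrow> bool" where
  "stable_pair a c \<longleftrightarrow> (\<exists>Y. psd Y \<and> (\<forall>v. v \<noteq> 0 \<longrightarrow> v \<bullet> (lyap a c Y *v v) < 0))"

text \<open>An M-matrix argument: if \<open>Z\<close> were not positive semidefinite, let \<open>l < 0\<close> be the minimal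
  ratio of the quadratic forms of \<open>Z\<close> and \<open>Y\<close>.  Then \<open>Z - l Y\<close> is positive semidefinite with a null
  vector, where the form of \<open>lyap a c (Z - l Y)\<close> is both nonnegative and negative.\<close>

lemma stable_inverse_positive:
  assumes st: "stable_pair a c" and Z: "transpose Z = Z"
    and le: "\<And>v. v \<bullet> (lyap a c Z *v v) \<le> 0"
  shows "psd Z"
proof -
  obtain Y where Y: "psd Y" and neg: "\<And>v. v \<noteq> 0 \<Longrightarrow> v \<bullet> (lyap a c Y *v v) < 0"
    using st by (auto simp: stable_pair_def)
  \<comment> \<open>At a null vector of \<open>Y\<close> the form of \<open>lyap a c Y\<close> would
    be nonnegative by \<open>lyap_null\<close>; hence \<open>Y\<close> is definite and ratios to its
    form make sense.\<close>
  have "v \<bullet> (Y *v v) > 0" if "v \<noteq> 0" for v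
    using lyap_null[OF Y, of v a c] neg[OF that] psd_nonneg[OF Y, of v] by fastforce
  then have Yp: "positive_definite Y" using Y by (simp add: positive_definite_def psd_sym)
  obtain v l where v: "v \<noteq> 0" "v \<bullet> (Z *v v) = l * (v \<bullet> (Y *v v))"
    "\<And>x. l * (x \<bullet> (Y *v x)) \<le> x \<bullet> (Z *v x)"
    using ratio_attains_inf[OF Yp] by blast
  have "0 \<le> l"
  proof (rule ccontr)
    assume "\<not> 0 \<le> l"
    then have l: "l < 0" by simp
    let ?U = "Z - l *\<^sub>R Y"
    have U: "psd ?U" using v(3) Z psd_sym[OF Y]
      by (simp add: psd_def transpose_diff transpose_scaleR mv.diff_left mv.scaleR_left inner_diff_right)
    have "0 \<le> v \<bullet> (lyap a c ?U *v v)"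
      by (rule lyap_null[OF U]) (simp add: mv.diff_left mv.scaleR_left inner_diff_right v(2))
    also have "\<dots> = v \<bullet> (lyap a c Z *v v) - l * (v \<bullet> (lyap a c Y *v v))"
      by (simp add: linear_diff[OF linear_lyap] linear_scale[OF linear_lyap] mv.diff_left
          mv.scaleR_left inner_diff_right)
    also have "\<dots> < 0" using le[of v] mult_neg_neg[OF l neg[OF v(1)]] by simp
    finally show False by simp
  qed
  then have "0 \<le> x \<bullet> (Z *v x)" for x
    using v(3)[of x] psd_nonneg[OF Y, of x] by (meson mult_nonneg_nonneg order_trans)
  then show ?thesis using Z by (simp add: psd_def)
qed

text \<open>Inverse positivity applies to both \<open>Z\<close> and \<open>- Z\<close>, so the
  quadratic form of \<open>Z\<close> vanishes.\<close>

lemma stable_inj: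
  assumes st: "stable_pair a c" and Z: "transpose Z = Z" and 0: "lyap a c Z = 0"
  shows "Z = 0"
proof -
  have p: "psd Z" by (rule stable_inverse_positive[OF st Z]) (simp add: 0)
  have n: "psd (- Z)"
    by (rule stable_inverse_positive[OF st])
      (simp_all add: 0 Z transpose_neg linear_neg[OF linear_lyap])
  have "Z *v x = 0" for x
  proof (rule psd_null[OF p])
    show "x \<bullet> (Z *v x) = 0" using psd_nonneg[OF p, of x] psd_nonneg[OF n, of x]
      by (simp add: mv.minus_left)
  qed
  then show ?thesis by (simp add: matrix_eq)
qed

definition sym_part :: "real^'n^'n \<Rightarrow> real^'n^'n" where
  "sym_part Z = (1/2) *\<^sub>R (Z + transpose Z)"

lemma transpose_sym_part: "transpose (sym_part Z) = sym_part Z"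
  by (simp add: sym_part_def transpose_scaleR transpose_add transpose_transpose add.commute)

lemma sym_part_sym: "transpose Z = Z \<Longrightarrow> sym_part Z = Z"
  by (simp add: sym_part_def scaleR_2[symmetric])

lemma linear_sym_part: "linear sym_part"
  by (rule linearI) (simp_all add: sym_part_def transpose_scaleR transpose_add algebra_simps)

lemma inner_sym_part:
  assumes "transpose Z = Z" shows "Z \<bullet> sym_part P = Z \<bullet> P"
proof -
  have "Z \<bullet> transpose P = Z \<bullet> P" by (metis assms inner_transpose)
  then show ?thesis by (simp add: sym_part_def inner_add_right)
qed

text \<open>\<open>lyap a c\<close> is injective on symmetric matrices only; \<open>T\<close> extends it by the identity on
  antisymmetric matrices.\<close>

lemma stable_extension:
  assumes st: "stable_pair a c"
  obtains T where "linear T" "inj T" "\<And>Z. transpose Z = Z \<Longrightarrow> T Z = lyap a c Z"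
    "\<And>Z. transpose (T Z) = T Z \<Longrightarrow> transpose Z = Z"
proof -
  define T where "T Z = lyap a c (sym_part Z) + (Z - sym_part Z)" for Z
  have lin: "linear T"
    unfolding T_def
    by (intro linear_compose_add linear_compose_sub linear_sym_part linear_ident
        linear_compose[OF linear_sym_part linear_lyap, unfolded comp_def])
  \<comment> \<open>\<open>lyap\<close> preserves symmetry, so the antisymmetric part of
    \<open>T Z\<close> is that of \<open>Z\<close>.\<close>
  have tr: "transpose Z = Z" if "transpose (T Z) = T Z" for Z
  proof -
    have "transpose (Z - sym_part Z) = Z - sym_part Z"
      using that by (simp add: T_def transpose_add lyap_sym transpose_sym_part)
    then show ?thesis by (simp add: transpose_diff transpose_sym_part)
  qed
  have eq: "T Z = lyap a c Z" if "transpose Z = Z" for Z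
    using that by (simp add: T_def sym_part_sym)
  have "inj T"
    unfolding linear_injective_0[OF lin]
    using tr eq stable_inj[OF st] by (metis transpose_zero)
  then show ?thesis using that lin eq tr by blast
qed

lemma stable_solve:
  assumes st: "stable_pair a c" and N: "transpose N = N"
  obtains Z where "transpose Z = Z" "lyap a c Z = N"
proof -
  obtain T where T: "linear T" "inj T" "\<And>Z. transpose Z = Z \<Longrightarrow> T Z = lyap a c Z"
    "\<And>Z. transpose (T Z) = T Z \<Longrightarrow> transpose Z = Z"
    by (rule stable_extension[OF st], rule that)
  obtain Z where "T Z = N"
    using linear_injective_imp_surjective[OF T(1,2)] by (metis surj_def)
  then show ?thesis using that T(3,4) N by metis
qed

text \<open>No certificate for the dual operator is at hand; solvability comes from the adjoint of
  the injective \<open>T\<close>, which is onto. Its preimage solves the equation only against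
  symmetric test matrices. The residue \<open>?E\<close> left by the symmetric part is itself
  symmetric, hence orthogonal to itself.\<close>

lemma stable_dual_solve:
  assumes st: "stable_pair a c" and N: "transpose N = N"
  obtains P where "transpose P = P" "lyap (transpose a) (transpose c) P = - N"
proof -
  obtain T where T: "linear T" "inj T" "\<And>Z. transpose Z = Z \<Longrightarrow> T Z = lyap a c Z"
    by (rule stable_extension[OF st], rule that)
  obtain P where P: "adjoint T P = - N"
    using surj_adjoint_iff_inj[OF T(1)] T(2) by (metis surj_def)
  let ?E = "lyap (transpose a) (transpose c) (sym_part P) + N"
  have Z: "Z \<bullet> ?E = 0" if Z: "transpose Z = Z" for Z
  proof -
    have "Z \<bullet> lyap (transpose a) (transpose c) (sym_part P) = lyap a c Z \<bullet> P"
      by (simp add: lyap_adjoint[symmetric] inner_sym_part lyap_sym Z)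
    also have "\<dots> = Z \<bullet> adjoint T P" by (simp add: T(3)[OF Z, symmetric] adjoint_works[OF T(1)])
    finally show ?thesis by (simp add: P inner_add_right)
  qed
  have "?E \<bullet> ?E = 0" by (rule Z) (simp add: transpose_add lyap_sym transpose_sym_part N)
  then have "lyap (transpose a) (transpose c) (sym_part P) = - N" by (simp add: eq_neg_iff_add_eq_0)
  then show ?thesis using that transpose_sym_part by blast
qed

text \<open>Inverse positivity passes to the adjoint by duality: the value of the form of
  \<open>P\<close> at \<open>x\<close> is \<open>N \<bullet> Z\<close>, where \<open>Z\<close>
  solves \<open>lyap a c Z = - outer x\<close> and is positive semidefinite.\<close>

lemma stable_dual_psd:
  fixes a c N P :: "real^'n^'n"
  assumes st: "stable_pair a c" and N: "\<And>x. 0 \<le> x \<bullet> (N *v x)"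
    and P: "transpose P = P" "lyap (transpose a) (transpose c) P = - N"
  shows "psd P"
  unfolding psd_def
proof (intro conjI allI P(1))
  fix x :: "real^'n"
  have "transpose (- outer x) = - outer x" by (simp add: transpose_neg transpose_outer)
  then obtain Z where Z: "transpose Z = Z" "lyap a c Z = - outer x"
    using stable_solve[OF st] by metis
  have "psd Z"
    by (rule stable_inverse_positive[OF st Z(1)])
      (simp add: Z(2) mv.minus_left outer_mult_vec inner_commute[of x])
  then have "0 \<le> N \<bullet> Z" using N by (rule psd_inner_nonneg)
  also have "N \<bullet> Z = - (Z \<bullet> lyap (transpose a) (transpose c) P)"
    by (simp add: P(2) inner_commute)
  also have "\<dots> = P \<bullet> outer x" by (simp add: lyap_adjoint[symmetric] Z(2) inner_commute)
  finally show "0 \<le> x \<bullet> (P *v x)" by (simp add: inner_outer)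
qed

section \<open>Moment flows and their total integral\<close>

text \<open>The integrated form of dS/dt = lyap S, and the interface between the stochastic and the
  algebraic part. The indicator discards negative times, where the values of \<open>S\<close> are
  arbitrary.\<close>

definition moment_flow :: "real^'n^'n \<Rightarrow> real^'n^'n \<Rightarrow> (real \<Rightarrow> real^'n^'n) \<Rightarrow> bool" where
  "moment_flow a c S \<longleftrightarrow>
     (\<lambda>t. indicator {0..} t *\<^sub>R S t) \<in> borel_measurable lborel \<and>
     (\<forall>t\<ge>0. psd (S t)) \<and>
     (\<forall>T\<ge>0. set_integrable lborel {0..T} S \<and> lyap a c (LINT t:{0..T}|lborel. S t) = S T - S 0)"

text \<open>Extended-valued, since its finiteness is usually what has to be shown.\<close>

abbreviation total_trace :: "(real \<Rightarrow> real^'n^'n) \<Rightarrow> ennreal" where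
  "total_trace S \<equiv> (\<integral>\<^sup>+t\<in>{0..}. ennreal (trace (S t)) \<partial>lborel)"

lemma set_integral_inner:
  fixes S :: "real \<Rightarrow> 'a::euclidean_space"
  assumes "set_integrable lborel I S"
  shows "N \<bullet> (LINT t:I|lborel. S t) = (LINT t:I|lborel. N \<bullet> S t)"
    and "set_integrable lborel I (\<lambda>t. N \<bullet> S t)"
proof -
  have eq: "(\<lambda>t. indicator I t *\<^sub>R (N \<bullet> S t)) = (\<lambda>t. N \<bullet> (indicator I t *\<^sub>R S t))" by simp
  show "N \<bullet> (LINT t:I|lborel. S t) = (LINT t:I|lborel. N \<bullet> S t)"
    using assms unfolding set_lebesgue_integral_def eq set_integrable_def
    by (subst integral_inner_right) auto
  show "set_integrable lborel I (\<lambda>t. N \<bullet> S t)"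
    using assms unfolding set_integrable_def eq by (rule integrable_inner_right)
qed

lemma psd_set_integral:
  fixes S :: "real \<Rightarrow> real^'n^'n"
  assumes int: "set_integrable lborel I S" and S: "\<And>t. t \<in> I \<Longrightarrow> psd (S t)"
  shows "psd (LINT t:I|lborel. S t)"
  unfolding psd_def
proof (intro conjI allI)
  have "transpose (LINT t:I|lborel. S t) = (LINT t:I|lborel. transpose (S t))"
    using integral_bounded_linear[OF linear_conv_bounded_linear[THEN iffD1, OF linear_transpose]
      int[unfolded set_integrable_def]]
    by (simp add: set_lebesgue_integral_def transpose_scaleR)
  also have "\<dots> = (LINT t:I|lborel. S t)"
    unfolding set_lebesgue_integral_def
    by (rule Bochner_Integration.integral_cong) (auto simp: indicator_def psd_sym[OF S])
  finally show "transpose (LINT t:I|lborel. S t) = (LINT t:I|lborel. S t)" .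
  fix x
  have "x \<bullet> ((LINT t:I|lborel. S t) *v x) = (LINT t:I|lborel. outer x \<bullet> S t)"
    unfolding set_integral_inner(1)[OF int, symmetric] by (simp add: inner_outer inner_commute[of "outer x"])
  also have "\<dots> \<ge> 0"
    unfolding set_lebesgue_integral_def
    by (rule Bochner_Integration.integral_nonneg)
      (auto simp: indicator_def inner_commute[of "outer x"] inner_outer psd_nonneg[OF S])
  finally show "0 \<le> x \<bullet> ((LINT t:I|lborel. S t) *v x)" .
qed

lemma set_nn_integral_inner:
  fixes S :: "real \<Rightarrow> 'a::euclidean_space"
  assumes int: "set_integrable lborel I S" and pos: "\<And>t. t \<in> I \<Longrightarrow> 0 \<le> N \<bullet> S t"
  shows "(\<integral>\<^sup>+t\<in>I. ennreal (N \<bullet> S t) \<partial>lborel) = ennreal (N \<bullet> (LINT t:I|lborel. S t))"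
proof -
  have "(\<integral>\<^sup>+t\<in>I. ennreal (N \<bullet> S t) \<partial>lborel) = (\<integral>\<^sup>+t. ennreal (indicator I t *\<^sub>R (N \<bullet> S t)) \<partial>lborel)"
    by (rule nn_integral_cong) (simp add: indicator_def)
  also have "\<dots> = ennreal (LINT t:I|lborel. N \<bullet> S t)"
    unfolding set_lebesgue_integral_def
    using set_integral_inner(2)[OF int] pos
    by (intro nn_integral_eq_integral) (auto simp: set_integrable_def indicator_def)
  finally show ?thesis by (simp add: set_integral_inner(1)[OF int])
qed

lemma emeasure_lborel_atLeast: "emeasure lborel {a::real..} = \<infinity>"
proof -
  have "(SUP n. of_nat n :: ennreal) \<le> emeasure lborel {a..}"
  proof (rule SUP_least)
    fix n :: nat
    have "of_nat n = emeasure lborel {a..a + real n}" by (simp add: ennreal_of_nat_eq_real_of_nat)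
    also have "\<dots> \<le> emeasure lborel {a..}" by (rule emeasure_mono) auto
    finally show "of_nat n \<le> emeasure lborel {a..}" .
  qed
  then show ?thesis by (simp add: ennreal_SUP_of_nat_eq_top top_unique)
qed

text \<open>A positive semidefinite matrix has norm at most its trace, so \<open>S\<close> is
  integrable and the integral equation makes \<open>S T\<close> converge. The limit has trace 0, as
  a positive limit would make the trace integral infinite; hence \<open>lyap a c Y = - S 0\<close>.
  Keeping \<open>N\<close> arbitrary lets one \<open>Y\<close> represent both the cost and the
  trace.\<close>

lemma flow_total:
  assumes flow: "moment_flow a c S"
    and fin: "total_trace S < \<infinity>"
  obtains Y where "psd Y" "lyap a c Y = - S 0"
    "\<forall>N. (\<forall>x. 0 \<le> x \<bullet> (N *v x)) \<longrightarrow> (\<integral>\<^sup>+t\<in>{0..}. ennreal (N \<bullet> S t) \<partial>lborel) = ennreal (N \<bullet> Y)"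
proof -
  have psd: "psd (S t)" if "t \<ge> 0" for t using flow that by (simp add: moment_flow_def)
  have int: "set_integrable lborel {0..} S"
    unfolding set_integrable_def
  proof (rule integrableI_bounded)
    show "(\<lambda>t. indicator {0..} t *\<^sub>R S t) \<in> borel_measurable lborel"
      using flow by (simp add: moment_flow_def)
    have "(\<integral>\<^sup>+t. ennreal (norm (indicator {0..} t *\<^sub>R S t)) \<partial>lborel)
        \<le> total_trace S"
      by (rule nn_integral_mono) (auto simp: indicator_def psd_norm_le_trace[OF psd] ennreal_leI)
    then show "(\<integral>\<^sup>+t. ennreal (norm (indicator {0..} t *\<^sub>R S t)) \<partial>lborel) < \<infinity>"
      using fin by (rule le_less_trans)
  qed
  define Y where "Y = (LINT t:{0..}|lborel. S t)"
  have "((\<lambda>T. LINT t:{0..T}|lborel. S t) \<longlongrightarrow> Y) at_top"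
    unfolding Y_def by (rule tendsto_set_lebesgue_integral_at_top) (use int in auto)
  then have "((\<lambda>T. lyap a c (LINT t:{0..T}|lborel. S t)) \<longlongrightarrow> lyap a c Y) at_top"
    by (rule bounded_linear.tendsto[OF linear_conv_bounded_linear[THEN iffD1, OF linear_lyap]])
  then have "((\<lambda>T. S 0 + lyap a c (LINT t:{0..T}|lborel. S t)) \<longlongrightarrow> S 0 + lyap a c Y) at_top"
    by (intro tendsto_intros)
  then have lim: "(S \<longlongrightarrow> S 0 + lyap a c Y) at_top"
  proof (rule Lim_transform_eventually)
    show "\<forall>\<^sub>F T in at_top. S 0 + lyap a c (LINT t:{0..T}|lborel. S t) = S T"
      using eventually_ge_at_top[of 0] by eventually_elim (use flow in \<open>simp add: moment_flow_def\<close>)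
  qed
  define Z where "Z = S 0 + lyap a c Y"
  have ltr: "((\<lambda>t. trace (S t)) \<longlongrightarrow> trace Z) at_top"
    unfolding inner_mat1[symmetric] Z_def by (intro tendsto_intros lim)
  have nonneg: "\<forall>\<^sub>F t in at_top. 0 \<le> trace (S t)"
    using eventually_ge_at_top[of 0] by eventually_elim (simp add: psd psd_trace_nonneg)
  have "trace Z = 0"
  proof (rule ccontr)
    assume "trace Z \<noteq> 0"
    moreover have "0 \<le> trace Z" using tendsto_lowerbound[OF ltr nonneg] by simp
    ultimately have tZ: "trace Z > 0" by simp
    have "\<forall>\<^sub>F t in at_top. trace Z / 2 < trace (S t)"
      using tZ by (intro order_tendstoD(1)[OF ltr]) simp
    then obtain T0 where T0: "\<And>t. t \<ge> T0 \<Longrightarrow> trace Z / 2 < trace (S t)"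
      by (auto simp: eventually_at_top_linorder)
    \<comment> \<open>From \<open>T0\<close> on the trace exceeds half its limit;
      \<open>max 0 T0\<close> keeps the half-line inside the range of integration.\<close>
    have "(\<integral>\<^sup>+t. ennreal (trace Z / 2) * indicator {max 0 T0..} t \<partial>lborel)
        \<le> total_trace S"
      by (rule nn_integral_mono) (auto simp: indicator_def intro!: ennreal_leI less_imp_le[OF T0])
    moreover have "(\<integral>\<^sup>+t. ennreal (trace Z / 2) * indicator {max 0 T0..} t \<partial>lborel) = \<infinity>"
      using tZ by (simp add: nn_integral_cmult_indicator emeasure_lborel_atLeast ennreal_mult_top)
    ultimately show False using fin by simp
  qed
  then have "((\<lambda>t. trace (S t)) \<longlongrightarrow> 0) at_top" using ltr by simp
  then have "(S \<longlongrightarrow> 0) at_top"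
    by (rule Lim_null_comparison[rotated])
      (use eventually_ge_at_top[of 0] in eventually_elim, simp add: psd psd_norm_le_trace)
  then have "S 0 + lyap a c Y = 0" using tendsto_unique[OF trivial_limit_at_top_linorder lim] by blast
  then have eq: "lyap a c Y = - S 0" by (metis add_eq_0_iff)
  show ?thesis
  proof (rule that[OF _ eq])
    show "psd Y" unfolding Y_def by (rule psd_set_integral[OF int]) (simp add: psd)
    show "\<forall>N. (\<forall>x. 0 \<le> x \<bullet> (N *v x)) \<longrightarrow> (\<integral>\<^sup>+t\<in>{0..}. ennreal (N \<bullet> S t) \<partial>lborel) = ennreal (N \<bullet> Y)"
      unfolding Y_def by (intro allI impI set_nn_integral_inner int psd_inner_nonneg psd) auto
  qed
qed

text \<open>\<open>P\<close> is a Lyapunov function: its pairing with \<open>S\<close> drops by at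
  least \<open>\<epsilon>\<close> times the accumulated trace and stays nonnegative. The resulting
  bound is independent of the horizon, so it survives monotone convergence.\<close>

lemma flow_bound:
  assumes flow: "moment_flow a c S" and P: "psd P" and \<epsilon>: "\<epsilon> > 0"
    and neg: "\<And>x. x \<bullet> (lyap (transpose a) (transpose c) P *v x) \<le> - \<epsilon> * (x \<bullet> x)"
  shows "total_trace S \<le> ennreal (P \<bullet> S 0 / \<epsilon>)"
proof -
  have psd: "psd (S t)" if "t \<ge> 0" for t using flow that by (simp add: moment_flow_def)
  have fin: "(\<integral>\<^sup>+t\<in>{0..real n}. ennreal (trace (S t)) \<partial>lborel) \<le> ennreal (P \<bullet> S 0 / \<epsilon>)" for n
  proof -
    define Y where "Y = (LINT t:{0..real n}|lborel. S t)"
    have int: "set_integrable lborel {0..real n} S" and eq: "lyap a c Y = S n - S 0"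
      using flow by (auto simp: moment_flow_def Y_def)
    have Y: "psd Y" unfolding Y_def by (rule psd_set_integral[OF int]) (simp add: psd)
    have "\<epsilon> * trace Y \<le> - lyap (transpose a) (transpose c) P \<bullet> Y"
      by (rule psd_inner_ge_trace[OF Y]) (use neg in \<open>simp add: mv.minus_left le_minus_iff\<close>)
    also have "\<dots> = P \<bullet> S 0 - P \<bullet> S n"
      by (simp add: inner_commute[of _ Y] lyap_adjoint[symmetric] eq inner_diff_left inner_diff_right inner_commute[of _ P])
    also have "\<dots> \<le> P \<bullet> S 0" using psd_inner_nonneg[OF psd, of n P] P by (simp add: psd_nonneg)
    finally have "trace Y \<le> P \<bullet> S 0 / \<epsilon>" using \<epsilon> by (simp add: field_simps)
    then have "ennreal (mat 1 \<bullet> Y) \<le> ennreal (P \<bullet> S 0 / \<epsilon>)" by (simp add: inner_mat1 ennreal_leI)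
    then show ?thesis
      unfolding Y_def inner_mat1[symmetric]
      by (subst set_nn_integral_inner[OF int]) (auto simp: inner_mat1 psd psd_trace_nonneg)
  qed
  have m: "(\<lambda>t. ennreal (trace (S t)) * indicator {0..} t) \<in> borel_measurable lborel"
  proof -
    have "(\<lambda>t. indicator {0..} t *\<^sub>R S t) \<in> borel_measurable lborel"
      using flow by (simp add: moment_flow_def)
    then have "(\<lambda>t. ennreal (mat 1 \<bullet> (indicator {0..} t *\<^sub>R S t))) \<in> borel_measurable lborel" by measurable
    also have "(\<lambda>t. ennreal (mat 1 \<bullet> (indicator {0..} t *\<^sub>R S t))) = (\<lambda>t. ennreal (trace (S t)) * indicator {0..} t)"
      by (auto simp: indicator_def inner_mat1)
    finally show ?thesis .
  qed
  have "total_trace S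
      = (\<integral>\<^sup>+t. (SUP n. (ennreal (trace (S t)) * indicator {0..} t) * indicator {..real n} t) \<partial>lborel)"
  proof (rule nn_integral_cong)
    fix t :: real
    obtain n where "t \<le> real n" using real_arch_simple by blast
    then show "ennreal (trace (S t)) * indicator {0..} t
        = (SUP n. (ennreal (trace (S t)) * indicator {0..} t) * indicator {..real n} t)"
      by (intro antisym SUP_upper2[of n] SUP_least) (auto simp: indicator_def)
  qed
  also have "\<dots> = (SUP n. \<integral>\<^sup>+t. (ennreal (trace (S t)) * indicator {0..} t) * indicator {..real n} t \<partial>lborel)"
    using m by (intro nn_integral_monotone_convergence_SUP)
      (auto simp: incseq_def le_fun_def indicator_def)
  also have "\<dots> = (SUP n. \<integral>\<^sup>+t\<in>{0..real n}. ennreal (trace (S t)) \<partial>lborel)"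
    by (intro SUP_cong nn_integral_cong refl) (auto simp: indicator_def)
  also have "\<dots> \<le> ennreal (P \<bullet> S 0 / \<epsilon>)" by (rule SUP_least) (rule fin)
  finally show ?thesis .
qed

text \<open>Integrating up to one time \<open>T\<close> where \<open>S T\<close> lies strictly below
  \<open>S 0\<close> already gives a certificate, as \<open>lyap a c Y = S T - S 0\<close> is
  negative definite. The trace bounds the form of \<open>S T\<close> from above, the minimal
  eigenvalue that of \<open>S 0\<close> from below.\<close>

lemma flow_decay_stable:
  assumes flow: "moment_flow a c S" and S0: "positive_definite (S 0)"
    and lim: "((\<lambda>t. trace (S t)) \<longlongrightarrow> 0) at_top"
  shows "stable_pair a c"
proof -
  have psd: "psd (S t)" if "t \<ge> 0" for t using flow that by (simp add: moment_flow_def)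
  have "\<forall>\<^sub>F t in at_top. trace (S t) < min_eigenvalue (S 0) \<and> t \<ge> 0"
    using order_tendstoD(2)[OF lim min_eigenvalue_pos[OF S0]] eventually_ge_at_top by (rule eventually_conj)
  then obtain T where T: "trace (S T) < min_eigenvalue (S 0)" "T \<ge> 0"
    using eventually_happens'[OF trivial_limit_at_top_linorder] by blast
  define Y where "Y = (LINT t:{0..T}|lborel. S t)"
  have int: "set_integrable lborel {0..T} S" and eq: "lyap a c Y = S T - S 0"
    using flow T by (auto simp: moment_flow_def Y_def)
  have Y: "psd Y" unfolding Y_def by (rule psd_set_integral[OF int]) (simp add: psd)
  have "v \<bullet> (lyap a c Y *v v) < 0" if "v \<noteq> 0" for v
  proof -
    have "v \<bullet> (S T *v v) \<le> norm (S T) * (v \<bullet> v)" by (rule quad_le_norm)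
    also have "\<dots> \<le> trace (S T) * (v \<bullet> v)"
      by (intro mult_right_mono psd_norm_le_trace psd T) simp
    also have "\<dots> < min_eigenvalue (S 0) * (v \<bullet> v)" using T that by simp
    also have "\<dots> \<le> v \<bullet> (S 0 *v v)" using S0 min_eigenvalue_le(1) by (auto simp: positive_definite_def)
    finally show ?thesis by (simp add: eq mv.diff_left inner_diff_right)
  qed
  then show ?thesis using Y by (auto simp: stable_pair_def)
qed

text \<open>The dual solution for the identity matrix is a Lyapunov function with rate
  \<open>\<epsilon> = 1\<close>.\<close>

lemma stable_flow_finite:
  assumes flow: "moment_flow a c S" and st: "stable_pair a c"
  shows "total_trace S < \<infinity>"
proof -
  obtain P where P: "transpose P = P" "lyap (transpose a) (transpose c) P = - mat 1"
    using stable_dual_solve[OF st, of "mat 1"] by (auto simp: transpose_mat)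
  have "psd P" by (rule stable_dual_psd[OF st _ P]) simp
  then have "total_trace S \<le> ennreal (P \<bullet> S 0 / 1)"
    by (intro flow_bound[OF flow]) (simp_all add: P(2) mv.minus_left)
  then show ?thesis by (rule le_less_trans) simp
qed

section \<open>Square-integrable functions\<close>

definition square_integrable :: "'a measure \<Rightarrow> ('a \<Rightarrow> real) \<Rightarrow> bool" where
  "square_integrable N f \<longleftrightarrow> f \<in> borel_measurable N \<and> integrable N (\<lambda>x. (f x)\<^sup>2)"

lemma square_integrable_measurable: "square_integrable N f \<Longrightarrow> f \<in> borel_measurable N"
  by (simp add: square_integrable_def)

lemma integrable_mult_square:
  assumes f: "square_integrable N f" and g: "square_integrable N g"
  shows "integrable N (\<lambda>x. f x * g x)"
proof (rule Bochner_Integration.integrable_bound)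
  show "integrable N (\<lambda>x. (f x)\<^sup>2 + (g x)\<^sup>2)"
    using f g by (auto simp: square_integrable_def)
  show "(\<lambda>x. f x * g x) \<in> borel_measurable N"
    using f g by (auto simp: square_integrable_def)
  have "\<bar>a * b\<bar> \<le> a\<^sup>2 + b\<^sup>2" for a b :: real
  proof -
    have "2 * (\<bar>a\<bar> * \<bar>b\<bar>) \<le> a\<^sup>2 + b\<^sup>2" using sum_squares_bound[of "\<bar>a\<bar>" "\<bar>b\<bar>"] by simp
    moreover have "0 \<le> \<bar>a\<bar> * \<bar>b\<bar>" by simp
    ultimately show ?thesis unfolding abs_mult by linarith
  qed
  then show "AE x in N. norm (f x * g x) \<le> norm ((f x)\<^sup>2 + (g x)\<^sup>2)" by auto
qed

lemma square_integrable_add: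
  assumes f: "square_integrable N f" and g: "square_integrable N g"
  shows "square_integrable N (\<lambda>x. f x + g x)"
proof -
  have "integrable N (\<lambda>x. (f x)\<^sup>2 + (g x)\<^sup>2 + 2 * (f x * g x))"
    using f g integrable_mult_square[OF f g] by (auto simp: square_integrable_def)
  then show ?thesis
    using f g by (auto simp: square_integrable_def power2_sum mult.assoc)
qed

lemma square_integrable_cmult:
  "square_integrable N f \<Longrightarrow> square_integrable N (\<lambda>x. c * f x)"
  by (auto simp: square_integrable_def power_mult_distrib)

lemma square_integrable_diff:
  assumes f: "square_integrable N f" and g: "square_integrable N g"
  shows "square_integrable N (\<lambda>x. f x - g x)"
  using square_integrable_add[OF f square_integrable_cmult[OF g, of "-1"]] by simp

lemma square_integrable_sum:
  "(\<And>i. i \<in> I \<Longrightarrow> square_integrable N (f i)) \<Longrightarrow> square_integrable N (\<lambda>x. \<Sum>i\<in>I. f i x)"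
  by (induction I rule: infinite_finite_induct)
    (auto intro: square_integrable_add simp: square_integrable_def[of _ "\<lambda>x. 0"])

lemma square_integrable_bounded:
  assumes "finite_measure N" "f \<in> borel_measurable N" "\<And>x. x \<in> space N \<Longrightarrow> \<bar>f x\<bar> \<le> c"
  shows "square_integrable N f"
  unfolding square_integrable_def
proof
  have "(f x)\<^sup>2 \<le> c\<^sup>2" if "x \<in> space N" for x
    using power_mono[OF assms(3)[OF that], of 2] by simp
  then show "integrable N (\<lambda>x. (f x)\<^sup>2)"
    using assms(2) by (intro finite_measure.integrable_const_bound[OF assms(1), where B="c\<^sup>2"]) auto
qed fact

lemma integral_diff_square:
  assumes f: "square_integrable N f" and g: "square_integrable N g"
  shows "(\<integral>x. (f x - g x)\<^sup>2 \<partial>N) = (\<integral>x. (f x)\<^sup>2 \<partial>N) - 2 * (\<integral>x. f x * g x \<partial>N) + (\<integral>x. (g x)\<^sup>2 \<partial>N)"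
  using f g integrable_mult_square[OF f g]
  by (simp add: power2_diff square_integrable_def mult.assoc)

lemma integral_Cauchy_Schwarz:
  assumes f: "square_integrable N f" and g: "square_integrable N g"
  shows "(\<integral>x. f x * g x \<partial>N)\<^sup>2 \<le> (\<integral>x. (f x)\<^sup>2 \<partial>N) * (\<integral>x. (g x)\<^sup>2 \<partial>N)"
proof -
  define a where "a = (\<integral>x. (f x)\<^sup>2 \<partial>N)"
  define b where "b = (\<integral>x. f x * g x \<partial>N)"
  define c where "c = (\<integral>x. (g x)\<^sup>2 \<partial>N)"
  have c0: "0 \<le> c" by (simp add: c_def)
  show ?thesis
  proof (cases "c = 0")
    case True
    then have "AE x in N. (g x)\<^sup>2 = 0"
      using g integral_nonneg_eq_0_iff_AE[of N "\<lambda>x. (g x)\<^sup>2"]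
      by (simp add: c_def square_integrable_def)
    then have "b = (\<integral>x. 0 \<partial>N)"
      unfolding b_def
      using integrable_mult_square[OF f g]
      by (intro integral_cong_AE) (auto elim!: eventually_mono)
    then show ?thesis using True by (simp add: b_def[symmetric] c_def[symmetric])
  next
    case False
    \<comment> \<open>The residual of projecting \<open>f\<close> on \<open>g\<close>, multiplied by
      \<open>c\<close> to avoid a division; its squared norm is
      \<open>c * (a * c - b\<^sup>2)\<close>.\<close>
    have "0 \<le> (\<integral>x. (c * f x - b * g x)\<^sup>2 \<partial>N)" by simp
    also have "\<dots> = (\<integral>x. (c * f x)\<^sup>2 \<partial>N) - 2 * (\<integral>x. (c * f x) * (b * g x) \<partial>N) + (\<integral>x. (b * g x)\<^sup>2 \<partial>N)"
      by (rule integral_diff_square) (intro square_integrable_cmult f g)+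
    also have "(\<integral>x. (c * f x)\<^sup>2 \<partial>N) = c\<^sup>2 * a" by (simp add: power_mult_distrib a_def)
    also have "(\<integral>x. (b * g x)\<^sup>2 \<partial>N) = b\<^sup>2 * c" by (simp add: power_mult_distrib c_def)
    also have "(\<lambda>x. (c * f x) * (b * g x)) = (\<lambda>x. (c * b) * (f x * g x))" by (simp add: mult_ac)
    also have "(\<integral>x. (c * b) * (f x * g x) \<partial>N) = c * b * b" by (simp add: b_def)
    finally have "0 \<le> c * (a * c - b\<^sup>2)" by (simp add: power2_eq_square algebra_simps)
    moreover have "0 < c" using False c0 by simp
    ultimately have "0 \<le> a * c - b\<^sup>2" by (auto simp: zero_le_mult_iff)
    then show ?thesis by (simp add: a_def b_def c_def)
  qed
qed

section \<open>Mean-square convergence\<close>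

definition L2_lim :: "'a measure \<Rightarrow> (nat \<Rightarrow> 'a \<Rightarrow> real) \<Rightarrow> ('a \<Rightarrow> real) \<Rightarrow> bool" where
  "L2_lim N f g \<longleftrightarrow> (\<forall>k. square_integrable N (f k)) \<and> square_integrable N g \<and>
     (\<lambda>k. \<integral>x. (f k x - g x)\<^sup>2 \<partial>N) \<longlonglongrightarrow> 0"

lemma L2_lim_const: "square_integrable N f \<Longrightarrow> L2_lim N (\<lambda>_. f) f"
  by (simp add: L2_lim_def)

text \<open>Expanding around the limits leaves three error terms, each containing a difference and
  hence small by Cauchy-Schwarz.\<close>

lemma L2_lim_inner:
  assumes f: "L2_lim N f f'" and g: "L2_lim N g g'"
  shows "(\<lambda>k. \<integral>x. f k x * g k x \<partial>N) \<longlonglongrightarrow> (\<integral>x. f' x * g' x \<partial>N)"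
proof -
  define a where "a = (\<lambda>k. \<integral>x. (f k x - f' x)\<^sup>2 \<partial>N)"
  define b where "b = (\<lambda>k. \<integral>x. (g k x - g' x)\<^sup>2 \<partial>N)"
  have sq: "square_integrable N (f k)" "square_integrable N (g k)" "square_integrable N f'"
    "square_integrable N g'" for k using f g by (auto simp: L2_lim_def)
  have df: "square_integrable N (\<lambda>x. f k x - f' x)" and dg: "square_integrable N (\<lambda>x. g k x - g' x)" for k
    by (intro square_integrable_diff sq)+
  let ?r = "\<lambda>k. sqrt (a k * b k) + sqrt (a k * (\<integral>x. (g' x)\<^sup>2 \<partial>N)) + sqrt ((\<integral>x. (f' x)\<^sup>2 \<partial>N) * b k)"
  have lim: "a \<longlonglongrightarrow> 0" "b \<longlonglongrightarrow> 0" using f g by (auto simp: L2_lim_def a_def b_def)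
  have CS: "\<bar>\<integral>x. u x * v x \<partial>N\<bar> \<le> sqrt ((\<integral>x. (u x)\<^sup>2 \<partial>N) * (\<integral>x. (v x)\<^sup>2 \<partial>N))"
    if "square_integrable N u" "square_integrable N v" for u v
    using integral_Cauchy_Schwarz[OF that] by (rule real_le_rsqrt[OF order_eq_refl[THEN order_trans], rotated]) simp
  have *: "norm ((\<integral>x. f k x * g k x \<partial>N) - (\<integral>x. f' x * g' x \<partial>N))
      \<le> ?r k" for k
  proof -
    have "(\<integral>x. f k x * g k x \<partial>N) - (\<integral>x. f' x * g' x \<partial>N) = (\<integral>x. f k x * g k x - f' x * g' x \<partial>N)"
      by (rule Bochner_Integration.integral_diff[symmetric]) (intro integrable_mult_square sq)+
    also have "\<dots> = (\<integral>x. (f k x - f' x) * (g k x - g' x) + (f k x - f' x) * g' x + f' x * (g k x - g' x) \<partial>N)"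
      by (simp add: algebra_simps)
    also have "\<dots> = (\<integral>x. (f k x - f' x) * (g k x - g' x) \<partial>N) + (\<integral>x. (f k x - f' x) * g' x \<partial>N)
        + (\<integral>x. f' x * (g k x - g' x) \<partial>N)"
      by (subst Bochner_Integration.integral_add Bochner_Integration.integral_add;
          (intro Bochner_Integration.integrable_add integrable_mult_square df dg sq)?)+ simp
    finally show ?thesis
      using CS[OF df[of k] dg[of k]] CS[OF df[of k] sq(4)] CS[OF sq(3) dg[of k]]
      unfolding a_def b_def real_norm_def by linarith
  qed
  have "?r
      \<longlonglongrightarrow> sqrt (0 * 0) + sqrt (0 * (\<integral>x. (g' x)\<^sup>2 \<partial>N)) + sqrt ((\<integral>x. (f' x)\<^sup>2 \<partial>N) * 0)"
    by (intro tendsto_intros lim)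
  then have "?r \<longlonglongrightarrow> 0"
    by simp
  then have "(\<lambda>k. (\<integral>x. f k x * g k x \<partial>N) - (\<integral>x. f' x * g' x \<partial>N)) \<longlonglongrightarrow> 0"
    by (rule Lim_null_comparison[OF always_eventually, rotated]) (use * in auto)
  then show ?thesis by (simp add: LIM_zero_iff)
qed

text \<open>Translates the extended-valued limits of \<open>has_ito_integral\<close>. The limit is
  square integrable because some \<open>f k\<close> lies at finite distance from it.\<close>

lemma L2_lim_nn:
  assumes f: "\<And>k. square_integrable N (f k)" and g: "g \<in> borel_measurable N"
    and lim: "(\<lambda>k. \<integral>\<^sup>+x. ennreal ((f k x - g x)\<^sup>2) \<partial>N) \<longlonglongrightarrow> 0"
  shows "L2_lim N f g"
proof -
  have "\<forall>\<^sub>F k in sequentially. (\<integral>\<^sup>+x. ennreal ((f k x - g x)\<^sup>2) \<partial>N) < 1"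
    using lim by (rule order_tendstoD) simp
  then obtain k where k: "(\<integral>\<^sup>+x. ennreal ((f k x - g x)\<^sup>2) \<partial>N) < 1"
    using eventually_happens'[OF sequentially_bot] by blast
  have "square_integrable N (\<lambda>x. f k x - g x)"
    unfolding square_integrable_def
  proof
    show m: "(\<lambda>x. f k x - g x) \<in> borel_measurable N"
      using f[of k] g by (auto simp: square_integrable_def)
    show "integrable N (\<lambda>x. (f k x - g x)\<^sup>2)"
      by (rule integrableI_nonneg) (use m k in \<open>auto intro: less_trans[OF _ ennreal_one_less_top]\<close>)
  qed
  then have "square_integrable N (\<lambda>x. f k x - (f k x - g x))"
    by (rule square_integrable_diff[OF f])
  then have g2: "square_integrable N g" by simp
  have "ennreal (\<integral>x. (f k x - g x)\<^sup>2 \<partial>N) = (\<integral>\<^sup>+x. ennreal ((f k x - g x)\<^sup>2) \<partial>N)" for k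
    using square_integrable_diff[OF f[of k] g2]
    by (intro nn_integral_eq_integral[symmetric]) (auto simp: square_integrable_def)
  then have "(\<lambda>k. ennreal (\<integral>x. (f k x - g x)\<^sup>2 \<partial>N)) \<longlonglongrightarrow> ennreal 0" using lim by simp
  then have "(\<lambda>k. \<integral>x. (f k x - g x)\<^sup>2 \<partial>N) \<longlonglongrightarrow> 0"
    by (subst (asm) tendsto_ennreal_iff) auto
  then show ?thesis using f g2 by (simp add: L2_lim_def)
qed

text \<open>Allows one approximating sequence to be exchanged for another at vanishing
  distance.\<close>

lemma L2_lim_trans:
  assumes f: "\<And>k. square_integrable N (f k)" and g: "L2_lim N g h"
    and lim: "(\<lambda>k. \<integral>x. (f k x - g k x)\<^sup>2 \<partial>N) \<longlonglongrightarrow> 0"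
  shows "L2_lim N f h"
proof -
  have sq: "square_integrable N (g k)" "square_integrable N h" for k using g by (auto simp: L2_lim_def)
  have le: "(\<integral>x. (f k x - h x)\<^sup>2 \<partial>N) \<le> 2 * (\<integral>x. (f k x - g k x)\<^sup>2 \<partial>N) + 2 * (\<integral>x. (g k x - h x)\<^sup>2 \<partial>N)" for k
  proof -
    have i: "integrable N (\<lambda>x. (f k x - g k x)\<^sup>2)" "integrable N (\<lambda>x. (g k x - h x)\<^sup>2)"
      "integrable N (\<lambda>x. (f k x - h x)\<^sup>2)"
      using square_integrable_diff[OF f sq(1), of k k] square_integrable_diff[OF sq, of k]
        square_integrable_diff[OF f sq(2), of k] by (auto simp: square_integrable_def)
    have 2: "(a + b)\<^sup>2 \<le> 2 * a\<^sup>2 + 2 * b\<^sup>2" for a b :: real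
      using sum_squares_bound[of a b] by (simp add: power2_sum)
    have "(f k x - h x)\<^sup>2 \<le> 2 * (f k x - g k x)\<^sup>2 + 2 * (g k x - h x)\<^sup>2" for x
      using 2[of "f k x - g k x" "g k x - h x"] by simp
    then
    have "(\<integral>x. (f k x - h x)\<^sup>2 \<partial>N) \<le> (\<integral>x. 2 * (f k x - g k x)\<^sup>2 + 2 * (g k x - h x)\<^sup>2 \<partial>N)"
      by (intro integral_mono i Bochner_Integration.integrable_add integrable_mult_right)
    then show ?thesis using i by simp
  qed
  have "(\<lambda>k. 2 * (\<integral>x. (f k x - g k x)\<^sup>2 \<partial>N) + 2 * (\<integral>x. (g k x - h x)\<^sup>2 \<partial>N)) \<longlonglongrightarrow> 2 * 0 + 2 * 0"
    using g by (intro tendsto_add tendsto_mult tendsto_const lim) (simp add: L2_lim_def)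
  then have "(\<lambda>k. 2 * (\<integral>x. (f k x - g k x)\<^sup>2 \<partial>N) + 2 * (\<integral>x. (g k x - h x)\<^sup>2 \<partial>N)) \<longlonglongrightarrow> 0"
    by simp
  then have "(\<lambda>k. \<integral>x. (f k x - h x)\<^sup>2 \<partial>N) \<longlonglongrightarrow> 0"
    by (rule Lim_null_comparison[OF always_eventually, rotated]) (use le in simp)
  then show ?thesis using f sq by (simp add: L2_lim_def)
qed

section \<open>Integration over a bounded time interval\<close>

abbreviation time_measure :: "real \<Rightarrow> real measure" where
  "time_measure T \<equiv> restrict_space lborel {0..T}"

lemma finite_time_measure: "finite_measure (time_measure T)"
  by (rule finite_measureI) (cases "0 \<le> T"; simp add: emeasure_restrict_space)

lemma square_integrable_0: "square_integrable N (\<lambda>x. 0)"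
  by (simp add: square_integrable_def)

lemma integral_sum_product:
  assumes f: "\<And>i. i \<in> I \<Longrightarrow> square_integrable N (f i)" and g: "\<And>j. j \<in> J \<Longrightarrow> square_integrable N (g j)"
  shows "(\<integral>x. (\<Sum>i\<in>I. f i x) * (\<Sum>j\<in>J. g j x) \<partial>N) = (\<Sum>i\<in>I. \<Sum>j\<in>J. \<integral>x. f i x * g j x \<partial>N)"
proof -
  have "(\<integral>x. (\<Sum>i\<in>I. \<Sum>j\<in>J. f i x * g j x) \<partial>N) = (\<Sum>i\<in>I. \<integral>x. (\<Sum>j\<in>J. f i x * g j x) \<partial>N)"
    by (intro Bochner_Integration.integral_sum Bochner_Integration.integrable_sum integrable_mult_square f g)
  also have "\<dots> = (\<Sum>i\<in>I. \<Sum>j\<in>J. \<integral>x. f i x * g j x \<partial>N)"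
    by (intro sum.cong refl Bochner_Integration.integral_sum integrable_mult_square f g)
  finally show ?thesis by (simp only: sum_product)
qed

text \<open>The square of an integral is an integral over a square, which the diagonal splits into
  two triangles of equal weight by Fubini. This plays the role of d(A^2) = 2 A dA for an integrand
  that is merely integrable.\<close>

lemma integral_square_triangle:
  fixes f :: "real \<Rightarrow> real"
  assumes f: "integrable (time_measure T) f"
  shows "(\<integral>t. f t \<partial>time_measure T)\<^sup>2
    = 2 * (\<integral>r. f r * (\<integral>s. f s * indicator {..r} s \<partial>time_measure T) \<partial>time_measure T)"
proof -
  let ?D = "time_measure T"
  interpret D: finite_measure ?D by (rule finite_time_measure)
  interpret P: pair_sigma_finite ?D ?D by unfold_locales
  have mf[measurable]: "f \<in> borel_measurable ?D" using f by auto
  have mid[measurable]: "(\<lambda>x. x) \<in> borel_measurable ?D" by (rule measurable_restrict_space1) simp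
  define u where "u r = (\<integral>s. f s * indicator {..r} s \<partial>?D)" for r
  define v where "v r = (\<integral>s. f s * indicator {r..} s \<partial>?D)" for r
  have i1: "integrable ?D (\<lambda>s. f s * indicator {..r} s)" for r
    by (rule Bochner_Integration.integrable_bound[OF f]) (auto simp: indicator_def)
  have i2: "integrable ?D (\<lambda>s. f s * indicator {r..} s)" for r
    by (rule Bochner_Integration.integrable_bound[OF f]) (auto simp: indicator_def)
  have ff: "integrable (?D \<Otimes>\<^sub>M ?D) (\<lambda>x. f (fst x) * f (snd x))"
    by (rule P.Fubini_integrable) (use f in \<open>auto simp: abs_mult\<close>)
  have ind[measurable]: "(\<lambda>x. indicator {..fst x} (snd x) :: real) \<in> borel_measurable (?D \<Otimes>\<^sub>M ?D)"
    unfolding indicator_def atMost_iff by measurable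
  have tri: "integrable (?D \<Otimes>\<^sub>M ?D) (\<lambda>(r, s). f r * (f s * indicator {..r} s))"
    by (rule Bochner_Integration.integrable_bound[OF ff])
      (auto simp: indicator_def case_prod_beta mult.assoc[symmetric] abs_mult intro!: borel_measurable_times)
  have uv: "(\<integral>t. f t \<partial>?D) = u r + v r" for r
  proof -
    have "u r + v r = (\<integral>s. f s * indicator {..r} s + f s * indicator {r..} s \<partial>?D)"
      unfolding u_def v_def using i1 i2 by simp
    also have "\<dots> = (\<integral>s. f s \<partial>?D)"
    proof (rule integral_cong_AE)
      \<comment> \<open>Only \<open>s = r\<close> is counted by both indicators, and it is a null
        set.\<close>
      have "AE s in ?D. s \<noteq> r"
        by (subst AE_restrict_space_iff) (auto intro: AE_mp[OF AE_lborel_singleton[of r]])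
      then show "AE s in ?D. f s * indicator {..r} s + f s * indicator {r..} s = f s"
        by eventually_elim (auto simp: indicator_def)
    qed (use i1 i2 in auto)
    finally show ?thesis by simp
  qed
  have iu: "integrable ?D (\<lambda>r. f r * u r)"
    using P.integrable_fst[OF tri] by (simp add: u_def)
  have sw: "(\<integral>s. (\<integral>r. f r * (f s * indicator {..r} s) \<partial>?D) \<partial>?D) = (\<integral>r. f r * u r \<partial>?D)"
    using P.Fubini_integral[OF tri] by (simp add: u_def)
  have v: "(\<lambda>s. \<integral>r. f r * (f s * indicator {..r} s) \<partial>?D) = (\<lambda>s. f s * v s)"
  proof
    fix s
    have "(\<lambda>r. f r * (f s * indicator {..r} s)) = (\<lambda>r. f s * (f r * indicator {s..} r))"
      by (auto simp: indicator_def)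
    then show "(\<integral>r. f r * (f s * indicator {..r} s) \<partial>?D) = f s * v s" by (simp add: v_def)
  qed
  have iv: "integrable ?D (\<lambda>r. f r * v r)"
    using P.integrable_snd[OF tri] unfolding v .
  have "(\<integral>t. f t \<partial>?D)\<^sup>2 = (\<integral>r. f r * (\<integral>t. f t \<partial>?D) \<partial>?D)" by (simp add: power2_eq_square)
  also have "\<dots> = (\<integral>r. f r * u r + f r * v r \<partial>?D)"
    by (intro Bochner_Integration.integral_cong refl) (subst uv, simp add: algebra_simps)
  also have "\<dots> = (\<integral>r. f r * u r \<partial>?D) + (\<integral>r. f r * v r \<partial>?D)"
    using iu iv by simp
  also have "(\<integral>r. f r * v r \<partial>?D) = (\<integral>r. f r * u r \<partial>?D)" using sw unfolding v .
  finally show ?thesis by (simp add: u_def)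
qed

section \<open>The Ito isometry\<close>

context brownian_basis
begin

section \<open>Brownian increments\<close>

lemma subalgebra_M: "0 \<le> t \<Longrightarrow> subalgebra M (F t)"
  by (simp add: subalgebra_def sub_F space_F)

lemma subalgebra_F: "s \<le> t \<Longrightarrow> subalgebra (F t) (F s)"
  by (simp add: subalgebra_def sets_F_mono space_F)

lemmas measurable_M = measurable_from_subalg[OF subalgebra_M]
lemmas measurable_F_mono = measurable_from_subalg[OF subalgebra_F]

lemma increment_moments:
  assumes s: "0 \<le> s" "s < t"
  shows "integrable M (\<lambda>\<omega>. W t \<omega> - W s \<omega>)" "expectation (\<lambda>\<omega>. W t \<omega> - W s \<omega>) = 0"
    "integrable M (\<lambda>\<omega>. (W t \<omega> - W s \<omega>)\<^sup>2)" "expectation (\<lambda>\<omega>. (W t \<omega> - W s \<omega>)\<^sup>2) = t - s"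
proof -
  have D: "distributed M lborel (\<lambda>\<omega>. W t \<omega> - W s \<omega>) (normal_density 0 (sqrt (t - s)))"
    using s by (rule normal_increments_W)
  have \<sigma>: "0 < sqrt (t - s)" using s by simp
  show "integrable M (\<lambda>\<omega>. W t \<omega> - W s \<omega>)"
    using distributed_integrable[OF D, of "\<lambda>x. x"] integrable_normal_moment[OF \<sigma>, of 0 1] by simp
  show "integrable M (\<lambda>\<omega>. (W t \<omega> - W s \<omega>)\<^sup>2)"
    using distributed_integrable[OF D, of "\<lambda>x. x\<^sup>2"] integrable_normal_moment[OF \<sigma>, of 0 2] by simp
  show E: "expectation (\<lambda>\<omega>. W t \<omega> - W s \<omega>) = 0"
    using normal_distributed_expectation[OF \<sigma> D] by simp
  show "expectation (\<lambda>\<omega>. (W t \<omega> - W s \<omega>)\<^sup>2) = t - s"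
    using normal_distributed_variance[OF \<sigma> D] s by (simp add: E)
qed

text \<open>The events described by \<open>\<xi>\<close> belong to \<open>F s\<close>, so
  independence is inherited from the increments of the basis.\<close>

lemma indep_var_increment:
  assumes s: "0 \<le> s" "s < t" and \<xi>: "\<xi> \<in> borel_measurable (F s)"
  shows "indep_var borel \<xi> borel (\<lambda>\<omega>. W t \<omega> - W s \<omega>)"
  unfolding indep_var_eq
proof (intro conjI)
  show "random_variable borel \<xi>" using measurable_M \<xi> s by auto
  show "random_variable borel (\<lambda>\<omega>. W t \<omega> - W s \<omega>)"
    using s by (intro borel_measurable_diff measurable_M[OF _ adapted_W]) auto
  have sub: "sigma_sets (space M) {\<xi> -` A \<inter> space M |A. A \<in> sets borel} \<subseteq> sets (F s)"
    by (rule sets.sigma_sets_subset[of _ "F s", unfolded space_F])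
      (auto intro: measurable_sets[OF \<xi>, unfolded space_F])
  show "indep_set (sigma_sets (space M) {\<xi> -` A \<inter> space M |A. A \<in> sets borel})
     (sigma_sets (space M) {(\<lambda>\<omega>. W t \<omega> - W s \<omega>) -` A \<inter> space M |A. A \<in> sets borel})"
    using indep_increments_W[OF s] sub unfolding indep_sets2_eq sets_vimage_algebra by blast
qed

lemma increment_expectation:
  assumes s: "0 \<le> s" "s \<le> t" and \<xi>: "\<xi> \<in> borel_measurable (F s)" "integrable M \<xi>"
  shows "integrable M (\<lambda>\<omega>. \<xi> \<omega> * (W t \<omega> - W s \<omega>))" (is ?i1)
    and "expectation (\<lambda>\<omega>. \<xi> \<omega> * (W t \<omega> - W s \<omega>)) = 0" (is ?e1)
    and "integrable M (\<lambda>\<omega>. \<xi> \<omega> * (W t \<omega> - W s \<omega>)\<^sup>2)" (is ?i2)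
    and "expectation (\<lambda>\<omega>. \<xi> \<omega> * (W t \<omega> - W s \<omega>)\<^sup>2) = (t - s) * expectation \<xi>" (is ?e2)
proof -
  have "?i1 \<and> ?e1 \<and> ?i2 \<and> ?e2"
  \<comment> \<open>The normal law is available for \<open>s < t\<close> only; a degenerate
    increment is 0.\<close>
  proof (cases "s = t")
    case False
    then have st: "s < t" using s by simp
    note ind = indep_var_increment[OF s(1) st \<xi>(1)]
    have ind2: "indep_var borel \<xi> borel (\<lambda>\<omega>. (W t \<omega> - W s \<omega>)\<^sup>2)"
      using indep_var_compose[OF ind, of "\<lambda>x. x" borel "\<lambda>x. x\<^sup>2" borel] by (simp add: comp_def)
    note mom = increment_moments[OF s(1) st]
    show ?thesis
      using indep_var_integrable[OF ind \<xi>(2) mom(1)] indep_var_lebesgue_integral[OF ind \<xi>(2) mom(1)]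
        indep_var_integrable[OF ind2 \<xi>(2) mom(3)] indep_var_lebesgue_integral[OF ind2 \<xi>(2) mom(3)]
      by (simp add: mom)
  qed simp
  then show ?i1 ?e1 ?i2 ?e2 by auto
qed

lemma square_integrable_increment:
  assumes s: "0 \<le> s" "s \<le> t" and \<xi>: "\<xi> \<in> borel_measurable (F s)" "\<And>\<omega>. \<omega> \<in> space M \<Longrightarrow> \<bar>\<xi> \<omega>\<bar> \<le> c"
  shows "square_integrable M (\<lambda>\<omega>. \<xi> \<omega> * (W t \<omega> - W s \<omega>))"
  unfolding square_integrable_def
proof
  have "square_integrable M \<xi>"
    using square_integrable_bounded[OF finite_measure_axioms measurable_M[OF s(1) \<xi>(1)] \<xi>(2)] by blast
  then have "integrable M (\<lambda>\<omega>. (\<xi> \<omega>)\<^sup>2)" by (simp add: square_integrable_def)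
  then show "integrable M (\<lambda>\<omega>. (\<xi> \<omega> * (W t \<omega> - W s \<omega>))\<^sup>2)"
    using increment_expectation(3)[OF s, of "\<lambda>\<omega>. (\<xi> \<omega>)\<^sup>2"] \<xi>(1) by (simp add: power_mult_distrib)
  show "random_variable borel (\<lambda>\<omega>. \<xi> \<omega> * (W t \<omega> - W s \<omega>))"
    using s measurable_M[OF s(1) \<xi>(1)]
    by (intro borel_measurable_times borel_measurable_diff measurable_M[OF _ adapted_W]) auto
qed

text \<open>After splitting both increments at the overlap of their intervals, every product of
  increments over disjoint intervals averages to 0, and the squared increment over the overlap
  contributes its length. The measure of the intersection also covers the disjoint case.\<close>

lemma increment_isometry:
  assumes "0 \<le> a" "a \<le> b" and \<xi>: "\<xi> \<in> borel_measurable (F a)" "\<And>\<omega>. \<omega> \<in> space M \<Longrightarrow> \<bar>\<xi> \<omega>\<bar> \<le> k"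
    and "0 \<le> c" "c \<le> d" and \<eta>: "\<eta> \<in> borel_measurable (F c)" "\<And>\<omega>. \<omega> \<in> space M \<Longrightarrow> \<bar>\<eta> \<omega>\<bar> \<le> l"
  shows "expectation (\<lambda>\<omega>. (\<xi> \<omega> * (W b \<omega> - W a \<omega>)) * (\<eta> \<omega> * (W d \<omega> - W c \<omega>)))
    = measure lborel ({a<..b} \<inter> {c<..d}) * expectation (\<lambda>\<omega>. \<xi> \<omega> * \<eta> \<omega>)"
proof -
  have wlog: "expectation (\<lambda>\<omega>. (\<xi> \<omega> * (W b \<omega> - W a \<omega>)) * (\<eta> \<omega> * (W d \<omega> - W c \<omega>)))
      = measure lborel ({a<..b} \<inter> {c<..d}) * expectation (\<lambda>\<omega>. \<xi> \<omega> * \<eta> \<omega>)"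
    if ab: "0 \<le> a" "a \<le> b" and \<xi>: "\<xi> \<in> borel_measurable (F a)" "\<And>\<omega>. \<omega> \<in> space M \<Longrightarrow> \<bar>\<xi> \<omega>\<bar> \<le> k"
      and cd: "a \<le> c" "c \<le> d" and \<eta>: "\<eta> \<in> borel_measurable (F c)" "\<And>\<omega>. \<omega> \<in> space M \<Longrightarrow> \<bar>\<eta> \<omega>\<bar> \<le> l"
    for a b c d k l \<xi> \<eta>
  proof -
    have c0: "0 \<le> c" using ab cd by simp
    have ad: "W r \<in> borel_measurable (F s)" if "0 \<le> r" "r \<le> s" for r s
      using measurable_F_mono[OF that(2) adapted_W[OF that(1)]] .
    have \<xi>': "\<xi> \<in> borel_measurable (F s)" if "a \<le> s" for s using measurable_F_mono[OF that \<xi>(1)] .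
    have \<eta>': "\<eta> \<in> borel_measurable (F s)" if "c \<le> s" for s using measurable_F_mono[OF that \<eta>(1)] .
    have sq\<eta>: "square_integrable M \<eta>"
      using square_integrable_bounded[OF finite_measure_axioms measurable_M[OF c0 \<eta>(1)] \<eta>(2)] by blast
    have bnd: "\<bar>\<xi> \<omega> * \<eta> \<omega>\<bar> \<le> k * l" if "\<omega> \<in> space M" for \<omega>
      unfolding abs_mult using \<xi>(2)[OF that] \<eta>(2)[OF that] by (intro mult_mono) auto
    have \<xi>\<eta>: "(\<lambda>\<omega>. \<xi> \<omega> * \<eta> \<omega>) \<in> borel_measurable (F c)" using \<xi>'[OF cd(1)] \<eta>(1) by simp
    have i\<xi>\<eta>: "integrable M (\<lambda>\<omega>. \<xi> \<omega> * \<eta> \<omega>)"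
      using bnd measurable_M[OF c0 \<xi>\<eta>] by (intro integrable_const_bound[where B="k * l"]) auto
    \<comment> \<open>Everything except \<open>W z - W y\<close> is known at time \<open>y\<close>,
      and that increment is centred.\<close>
    have early: "integrable M (\<lambda>\<omega>. (\<xi> \<omega> * \<eta> \<omega> * (W y \<omega> - W x \<omega>)) * (W z \<omega> - W y \<omega>))"
      "expectation (\<lambda>\<omega>. (\<xi> \<omega> * \<eta> \<omega> * (W y \<omega> - W x \<omega>)) * (W z \<omega> - W y \<omega>)) = 0"
      if xyz: "a \<le> x" "x \<le> y" "c \<le> y" "y \<le> z" for x y z
    proof -
      have y: "0 \<le> y" "0 \<le> x" using xyz ab by auto
      have "(\<lambda>\<omega>. \<xi> \<omega> * \<eta> \<omega> * (W y \<omega> - W x \<omega>)) \<in> borel_measurable (F y)"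
        using \<xi>'[of y] \<eta>'[of y] xyz y by (auto intro!: borel_measurable_times borel_measurable_diff ad)
      moreover have "integrable M (\<lambda>\<omega>. \<xi> \<omega> * \<eta> \<omega> * (W y \<omega> - W x \<omega>))"
        using integrable_mult_square[OF sq\<eta> square_integrable_increment[OF y(2) xyz(2) \<xi>'[OF xyz(1)] \<xi>(2)]]
        by (simp add: mult_ac)
      ultimately show "integrable M (\<lambda>\<omega>. (\<xi> \<omega> * \<eta> \<omega> * (W y \<omega> - W x \<omega>)) * (W z \<omega> - W y \<omega>))"
        "expectation (\<lambda>\<omega>. (\<xi> \<omega> * \<eta> \<omega> * (W y \<omega> - W x \<omega>)) * (W z \<omega> - W y \<omega>)) = 0"
        using increment_expectation(1,2)[OF y(1) xyz(4)] by blast+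
    qed
    have early': "integrable M (\<lambda>\<omega>. (\<xi> \<omega> * \<eta> \<omega> * (W z \<omega> - W y \<omega>)) * (W y \<omega> - W x \<omega>))"
      "expectation (\<lambda>\<omega>. (\<xi> \<omega> * \<eta> \<omega> * (W z \<omega> - W y \<omega>)) * (W y \<omega> - W x \<omega>)) = 0"
      if xyz: "a \<le> x" "x \<le> y" "c \<le> y" "y \<le> z" for x y z
      using early[OF that] by (simp_all add: mult_ac)
    show ?thesis
    proof (cases "b \<le> c")
      case True
      have m: "(\<lambda>\<omega>. \<xi> \<omega> * \<eta> \<omega> * (W b \<omega> - W a \<omega>)) \<in> borel_measurable (F c)"
        using \<xi>\<eta> ab cd True by (auto intro!: borel_measurable_times borel_measurable_diff ad)
      have i: "integrable M (\<lambda>\<omega>. \<xi> \<omega> * \<eta> \<omega> * (W b \<omega> - W a \<omega>))"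
        using integrable_mult_square[OF sq\<eta> square_integrable_increment[OF ab \<xi>]] by (simp add: mult_ac)
      have empty: "{a<..b} \<inter> {c<..d} = {}" using True by auto
      show ?thesis
        unfolding empty using increment_expectation(2)[OF c0 cd(2) m i] by (simp add: mult_ac)
    next
      case False
      \<comment> \<open>With \<open>e\<close> the right end of the overlap, one of the leftover
        pieces from \<open>e\<close> to \<open>b\<close> and from \<open>e\<close> to
        \<open>d\<close> is empty, so their product is absent from \<open>split\<close>.\<close>
      define e where "e = min b d"
      have e: "c \<le> e" "e \<le> b" "e \<le> d" "e = b \<or> e = d" using False cd by (auto simp: e_def)
      have "{a<..b} \<inter> {c<..d} = {c<..e}" using cd by (auto simp: e_def)
      then have meas: "measure lborel ({a<..b} \<inter> {c<..d}) = e - c" using e by simp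
      let ?z = "\<lambda>\<omega>. \<xi> \<omega> * \<eta> \<omega>"
      have split: "(\<xi> \<omega> * (W b \<omega> - W a \<omega>)) * (\<eta> \<omega> * (W d \<omega> - W c \<omega>))
        = (?z \<omega> * (W c \<omega> - W a \<omega>)) * (W d \<omega> - W c \<omega>)
          + (?z \<omega> * (W e \<omega> - W c \<omega>)) * (W d \<omega> - W e \<omega>)
          + (?z \<omega> * (W b \<omega> - W e \<omega>)) * (W e \<omega> - W c \<omega>)
          + ?z \<omega> * (W e \<omega> - W c \<omega>)\<^sup>2" for \<omega>
        using e(4) by (auto simp: algebra_simps power2_eq_square)
      note i1 = early[of a c d] and i2 = early[of c e d] and i3 = early'[of c e b]
        and i4 = increment_expectation(3,4)[OF c0 e(1) \<xi>\<eta> i\<xi>\<eta>]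
      show ?thesis
        unfolding split meas using i1 i2 i3 i4 e cd ab by simp
    qed
  qed
  show ?thesis
  proof (cases "a \<le> c")
    case True
    show ?thesis by (rule wlog[OF assms(1,2) \<xi> True \<open>c \<le> d\<close> \<eta>])
  next
    case False
    then have "c \<le> a" by simp
    from wlog[OF \<open>0 \<le> c\<close> \<open>c \<le> d\<close> \<eta> this assms(2) \<xi>] show ?thesis
      by (simp add: mult.commute Int_commute)
  qed
qed

section \<open>Isometry and martingale property of simple integrals\<close>

abbreviation time_space :: "real \<Rightarrow> (real \<times> 'w) measure" where
  "time_space T \<equiv> time_measure T \<Otimes>\<^sub>M M"

lemma pair_time: "pair_sigma_finite (time_measure T) M"
  using finite_time_measure finite_measure.axioms(1) sigma_finite_measure_axioms
  by (auto simp: pair_sigma_finite_def)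

lemma finite_pair_time: "finite_measure (time_space T)"
  by (rule finite_measure_pair_measure[OF finite_measure_axioms finite_time_measure])

lemma simple_integrandD:
  fixes \<xi> :: "nat \<Rightarrow> 'w \<Rightarrow> real"
  assumes s: "simple_integrand F N \<tau> \<xi>" and i: "i < N"
  shows "0 \<le> \<tau> i" "\<tau> i \<le> \<tau> (Suc i)" "\<xi> i \<in> borel_measurable (F (\<tau> i))"
    "\<exists>c. \<forall>\<omega>\<in>space M. \<bar>\<xi> i \<omega>\<bar> \<le> c"
proof -
  have "i < N \<Longrightarrow> 0 \<le> \<tau> i" for i
    using s by (induction i) (auto simp: simple_integrand_def intro: order_trans)
  then show "0 \<le> \<tau> i" using i by blast
  show "\<tau> i \<le> \<tau> (Suc i)" "\<xi> i \<in> borel_measurable (F (\<tau> i))"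
    "\<exists>c. \<forall>\<omega>\<in>space M. \<bar>\<xi> i \<omega>\<bar> \<le> c"
    using s i by (auto simp: simple_integrand_def space_F)
qed

lemma simple_term:
  fixes \<xi> :: "nat \<Rightarrow> 'w \<Rightarrow> real"
  assumes s: "simple_integrand F N \<tau> \<xi>" and i: "i < N" and T: "0 \<le> T"
  shows "square_integrable M (\<lambda>\<omega>. \<xi> i \<omega> * (W (min T (\<tau> (Suc i))) \<omega> - W (min T (\<tau> i)) \<omega>))"
    and "square_integrable (time_space T) (\<lambda>(t, \<omega>). indicator {\<tau> i<..\<tau> (Suc i)} t * \<xi> i \<omega>)"
proof -
  note si = simple_integrandD[OF s i]
  from si(4) obtain c where c: "\<And>\<omega>. \<omega> \<in> space M \<Longrightarrow> \<bar>\<xi> i \<omega>\<bar> \<le> c" by auto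
  show "square_integrable M (\<lambda>\<omega>. \<xi> i \<omega> * (W (min T (\<tau> (Suc i))) \<omega> - W (min T (\<tau> i)) \<omega>))"
  \<comment> \<open>Stopping at \<open>T\<close> either leaves the left endpoint alone, so that
    \<open>\<xi> i\<close> is measurable there, or collapses the interval.\<close>
  proof (cases "\<tau> i \<le> T")
    case True
    then have "min T (\<tau> i) = \<tau> i" by simp
    then show ?thesis
      using si True by (auto intro!: square_integrable_increment[where c=c] c)
  next
    case False
    then have "min T (\<tau> i) = T" "min T (\<tau> (Suc i)) = T" using si by auto
    then show ?thesis by (simp add: square_integrable_0)
  qed
  have m: "\<xi> i \<in> borel_measurable M" using measurable_M si by blast
  show "square_integrable (time_space T) (\<lambda>(t, \<omega>). indicator {\<tau> i<..\<tau> (Suc i)} t * \<xi> i \<omega>)"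
  proof (rule square_integrable_bounded[OF finite_pair_time])
    have "indicator {\<tau> i<..\<tau> (Suc i)} \<in> borel_measurable (time_measure T)"
      by (rule measurable_restrict_space1) simp
    then show "(\<lambda>(t, \<omega>). indicator {\<tau> i<..\<tau> (Suc i)} t * \<xi> i \<omega>) \<in> borel_measurable (time_space T)"
      using m unfolding case_prod_beta by (intro borel_measurable_times
          measurable_compose[OF measurable_fst] measurable_compose[OF measurable_snd])
    fix x assume "x \<in> space (time_space T)"
    then have "snd x \<in> space M" by (auto simp: space_pair_measure)
    then show "\<bar>case x of (t, \<omega>) \<Rightarrow> indicator {\<tau> i<..\<tau> (Suc i)} t * \<xi> i \<omega>\<bar> \<le> c"
      using c[of "snd x"] by (auto simp: case_prod_beta indicator_def abs_mult)
  qed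
qed

lemma simple_integral_real:
  fixes \<xi> :: "nat \<Rightarrow> 'w \<Rightarrow> real"
  shows "simple_integral W N \<tau> \<xi> T = (\<lambda>\<omega>. \<Sum>i<N. \<xi> i \<omega> * (W (min T (\<tau> (Suc i))) \<omega> - W (min T (\<tau> i)) \<omega>))"
  by (simp add: simple_integral_def fun_eq_iff mult.commute)

lemma simple_process_real:
  fixes \<xi> :: "nat \<Rightarrow> 'w \<Rightarrow> real"
  shows "(\<lambda>(t, \<omega>). simple_process N \<tau> \<xi> t \<omega>) = (\<lambda>x. \<Sum>i<N. case x of (t, \<omega>) \<Rightarrow> indicator {\<tau> i<..\<tau> (Suc i)} t * \<xi> i \<omega>)"
  by (simp add: simple_process_def fun_eq_iff)

lemma square_integrable_simple:
  fixes \<xi> :: "nat \<Rightarrow> 'w \<Rightarrow> real"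
  assumes s: "simple_integrand F N \<tau> \<xi>" and T: "0 \<le> T"
  shows "square_integrable M (simple_integral W N \<tau> \<xi> T)"
    and "square_integrable (time_space T) (\<lambda>(t, \<omega>). simple_process N \<tau> \<xi> t \<omega>)"
  unfolding simple_integral_real simple_process_real
  by (intro square_integrable_sum simple_term[OF s _ T]; simp)+

text \<open>Polarized, with two unrelated grids, because two approximating sequences have to be
  compared later. No common refinement is formed: both sides expand into pairs of intervals,
  weighted by the length of their overlap.\<close>

lemma simple_isometry:
  fixes \<xi> \<eta> :: "nat \<Rightarrow> 'w \<Rightarrow> real"
  assumes s: "simple_integrand F N \<tau> \<xi>" and s': "simple_integrand F N' \<sigma> \<eta>" and T: "0 \<le> T"
  shows "expectation (\<lambda>\<omega>. simple_integral W N \<tau> \<xi> T \<omega> * simple_integral W N' \<sigma> \<eta> T \<omega>)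
    = (\<integral>x. (case x of (t, \<omega>) \<Rightarrow> simple_process N \<tau> \<xi> t \<omega>) * (case x of (t, \<omega>) \<Rightarrow> simple_process N' \<sigma> \<eta> t \<omega>)
        \<partial>(time_space T))"
proof -
  interpret P: pair_sigma_finite "time_measure T" M by (rule pair_time)
  define p :: "nat \<Rightarrow> real \<times> 'w \<Rightarrow> real"
    where "p = (\<lambda>i x. case x of (t, \<omega>) \<Rightarrow> indicator {\<tau> i<..\<tau> (Suc i)} t * \<xi> i \<omega>)"
  define q :: "nat \<Rightarrow> real \<times> 'w \<Rightarrow> real"
    where "q = (\<lambda>i x. case x of (t, \<omega>) \<Rightarrow> indicator {\<sigma> i<..\<sigma> (Suc i)} t * \<eta> i \<omega>)"
  define u where "u = (\<lambda>i \<omega>. \<xi> i \<omega> * (W (min T (\<tau> (Suc i))) \<omega> - W (min T (\<tau> i)) \<omega>))"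
  define v where "v = (\<lambda>i \<omega>. \<eta> i \<omega> * (W (min T (\<sigma> (Suc i))) \<omega> - W (min T (\<sigma> i)) \<omega>))"
  have sq: "square_integrable M (u i)" "square_integrable (time_space T) (p i)" if "i < N" for i
    using simple_term[OF s that T] by (simp_all add: u_def p_def)
  have sq': "square_integrable M (v i)" "square_integrable (time_space T) (q i)" if "i < N'" for i
    using simple_term[OF s' that T] by (simp_all add: v_def q_def)
  have term_eq: "expectation (\<lambda>\<omega>. u i \<omega> * v j \<omega>) = (\<integral>x. p i x * q j x \<partial>(time_space T))"
    if i: "i < N" and j: "j < N'" for i j
  proof -
    note si = simple_integrandD[OF s i] and sj = simple_integrandD[OF s' j]
    from si(4) obtain k where k: "\<And>\<omega>. \<omega> \<in> space M \<Longrightarrow> \<bar>\<xi> i \<omega>\<bar> \<le> k" by auto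
    from sj(4) obtain l where l: "\<And>\<omega>. \<omega> \<in> space M \<Longrightarrow> \<bar>\<eta> j \<omega>\<bar> \<le> l" by auto
    let ?A = "{min T (\<tau> i)<..min T (\<tau> (Suc i))}" and ?B = "{min T (\<sigma> j)<..min T (\<sigma> (Suc j))}"
    have "expectation (\<lambda>\<omega>. u i \<omega> * v j \<omega>) = measure lborel (?A \<inter> ?B) * expectation (\<lambda>\<omega>. \<xi> i \<omega> * \<eta> j \<omega>)"
    proof (cases "\<tau> i \<le> T \<and> \<sigma> j \<le> T")
      case True
      then have "min T (\<tau> i) = \<tau> i" "min T (\<sigma> j) = \<sigma> j" by auto
      then show ?thesis
        unfolding u_def v_def using si sj True
        by (intro increment_isometry[where k=k and l=l] k l) auto
    next
      case False
      then have "u i = (\<lambda>_. 0) \<or> v j = (\<lambda>_. 0)" "?A \<inter> ?B = {}"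
        using si(2) sj(2) by (auto simp: u_def v_def min_def)
      then show ?thesis by auto
    qed
    moreover have "(\<integral>x. p i x * q j x \<partial>(time_space T)) = measure lborel (?A \<inter> ?B) * expectation (\<lambda>\<omega>. \<xi> i \<omega> * \<eta> j \<omega>)"
    proof -
      have "(\<integral>x. p i x * q j x \<partial>(time_space T)) = (\<integral>t. (\<integral>\<omega>. p i (t, \<omega>) * q j (t, \<omega>) \<partial>M) \<partial>time_measure T)"
        by (rule P.integral_fst'[symmetric]) (intro integrable_mult_square sq sq' i j)
      also have "(\<lambda>t. \<integral>\<omega>. p i (t, \<omega>) * q j (t, \<omega>) \<partial>M)
          = (\<lambda>t. indicator ({\<tau> i<..\<tau> (Suc i)} \<inter> {\<sigma> j<..\<sigma> (Suc j)}) t * expectation (\<lambda>\<omega>. \<xi> i \<omega> * \<eta> j \<omega>))"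
        by (auto simp: p_def q_def fun_eq_iff indicator_def)
      also have "(\<integral>t. indicator ({\<tau> i<..\<tau> (Suc i)} \<inter> {\<sigma> j<..\<sigma> (Suc j)}) t * expectation (\<lambda>\<omega>. \<xi> i \<omega> * \<eta> j \<omega>) \<partial>time_measure T)
          = (\<integral>t. indicator (?A \<inter> ?B) t * expectation (\<lambda>\<omega>. \<xi> i \<omega> * \<eta> j \<omega>) \<partial>lborel)"
        unfolding integral_restrict_space[of "{0..T}" lborel, simplified]
        using si(1) sj(1) by (intro Bochner_Integration.integral_cong) (auto simp: indicator_def)
      also have "\<dots> = measure lborel (?A \<inter> ?B) * expectation (\<lambda>\<omega>. \<xi> i \<omega> * \<eta> j \<omega>)"
        by (subst integral_mult_left_zero) (simp del: Int_greaterThanAtMost)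
      finally show ?thesis .
    qed
    ultimately show ?thesis by simp
  qed
  have "expectation (\<lambda>\<omega>. (\<Sum>i<N. u i \<omega>) * (\<Sum>j<N'. v j \<omega>)) = (\<Sum>i<N. \<Sum>j<N'. expectation (\<lambda>\<omega>. u i \<omega> * v j \<omega>))"
    by (rule integral_sum_product) (auto intro: sq sq')
  also have "\<dots> = (\<Sum>i<N. \<Sum>j<N'. \<integral>x. p i x * q j x \<partial>(time_space T))"
    by (intro sum.cong refl term_eq) auto
  also have "\<dots> = (\<integral>x. (\<Sum>i<N. p i x) * (\<Sum>j<N'. q j x) \<partial>(time_space T))"
    by (rule integral_sum_product[symmetric]) (auto intro: sq sq')
  finally show ?thesis
    unfolding simple_integral_real simple_process_def u_def v_def p_def q_def
    by (simp add: case_prod_beta)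
qed

text \<open>Testing against every \<open>g\<close> known at time \<open>r\<close> takes the place of
  a conditional expectation. Termwise, the integrals up to \<open>T\<close> and up to
  \<open>r\<close> differ at most by \<open>\<xi> i\<close> times an increment that starts no
  earlier than \<open>r\<close> and \<open>\<tau> i\<close>.\<close>

lemma simple_martingale:
  fixes \<xi> :: "nat \<Rightarrow> 'w \<Rightarrow> real"
  assumes s: "simple_integrand F N \<tau> \<xi>" and r: "0 \<le> r" "r \<le> T"
    and g: "g \<in> borel_measurable (F r)" "square_integrable M g"
  shows "expectation (\<lambda>\<omega>. g \<omega> * simple_integral W N \<tau> \<xi> T \<omega>)
    = expectation (\<lambda>\<omega>. g \<omega> * simple_integral W N \<tau> \<xi> r \<omega>)"
proof -
  have T: "0 \<le> T" using r by simp
  define u where "u = (\<lambda>T i \<omega>. \<xi> i \<omega> * (W (min T (\<tau> (Suc i))) \<omega> - W (min T (\<tau> i)) \<omega>))"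
  have sq: "square_integrable M (u T i)" "square_integrable M (u r i)" if "i < N" for i
    using simple_term(1)[OF s that] r by (simp_all add: u_def)
  have late: "expectation (\<lambda>\<omega>. g \<omega> * \<xi> i \<omega> * (W z \<omega> - W y \<omega>)) = 0"
    if i: "i < N" and yz: "\<tau> i \<le> y" "r \<le> y" "y \<le> z" for i y z
  proof -
    note si = simple_integrandD[OF s i]
    from si(4) obtain k where k: "\<And>\<omega>. \<omega> \<in> space M \<Longrightarrow> \<bar>\<xi> i \<omega>\<bar> \<le> k" by auto
    have "square_integrable M (\<xi> i)"
      by (rule square_integrable_bounded[OF finite_measure_axioms _ k]) (use measurable_M si in blast)
    then have "integrable M (\<lambda>\<omega>. g \<omega> * \<xi> i \<omega>)" using g(2) integrable_mult_square by blast
    moreover have "(\<lambda>\<omega>. g \<omega> * \<xi> i \<omega>) \<in> borel_measurable (F y)"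
      using measurable_F_mono[OF yz(1) si(3)] measurable_F_mono[OF yz(2) g(1)] by simp
    ultimately show ?thesis using increment_expectation(2)[of y z] yz r by simp
  qed
  have term_eq: "expectation (\<lambda>\<omega>. g \<omega> * u T i \<omega>) = expectation (\<lambda>\<omega>. g \<omega> * u r i \<omega>)" if i: "i < N" for i
  proof -
    note si = simple_integrandD[OF s i]
    have "expectation (\<lambda>\<omega>. g \<omega> * u T i \<omega>) - expectation (\<lambda>\<omega>. g \<omega> * u r i \<omega>)
        = expectation (\<lambda>\<omega>. g \<omega> * u T i \<omega> - g \<omega> * u r i \<omega>)"
      by (intro Bochner_Integration.integral_diff[symmetric] integrable_mult_square g sq i)
    also have "\<dots> = 0"
    proof -
      consider "T \<le> \<tau> i" | "r \<le> \<tau> i" "\<tau> i \<le> T" | "\<tau> i \<le> r" "r \<le> \<tau> (Suc i)" | "\<tau> (Suc i) \<le> r"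
        by linarith
      then show ?thesis
      proof cases
        case 1 then show ?thesis using si r by (simp add: u_def min_def)
      next
        case 2
        then have "min r (\<tau> i) = r" "min r (\<tau> (Suc i)) = r" "min T (\<tau> i) = \<tau> i" using si by auto
        then have "g \<omega> * u T i \<omega> - g \<omega> * u r i \<omega> = g \<omega> * \<xi> i \<omega> * (W (min T (\<tau> (Suc i))) \<omega> - W (\<tau> i) \<omega>)" for \<omega>
          by (simp add: u_def)
        then show ?thesis using late[OF i, of "\<tau> i" "min T (\<tau> (Suc i))"] 2 si by simp
      next
        case 3
        then have "min r (\<tau> i) = \<tau> i" "min r (\<tau> (Suc i)) = r" "min T (\<tau> i) = \<tau> i" using si r by auto
        then have "g \<omega> * u T i \<omega> - g \<omega> * u r i \<omega> = g \<omega> * \<xi> i \<omega> * (W (min T (\<tau> (Suc i))) \<omega> - W r \<omega>)" for \<omega>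
          by (simp add: u_def algebra_simps)
        then show ?thesis using late[OF i, of r "min T (\<tau> (Suc i))"] 3 r by simp
      next
        case 4
        then have "u T i = u r i" using si r by (simp add: u_def min.absorb2)
        then show ?thesis by simp
      qed
    qed
    finally show ?thesis by simp
  qed
  have "expectation (\<lambda>\<omega>. g \<omega> * (\<Sum>i<N. u T i \<omega>)) = (\<Sum>i<N. expectation (\<lambda>\<omega>. g \<omega> * u T i \<omega>))"
    unfolding sum_distrib_left
    by (intro Bochner_Integration.integral_sum integrable_mult_square g sq) simp
  also have "\<dots> = (\<Sum>i<N. expectation (\<lambda>\<omega>. g \<omega> * u r i \<omega>))"
    by (intro sum.cong refl term_eq) simp
  also have "\<dots> = expectation (\<lambda>\<omega>. g \<omega> * (\<Sum>i<N. u r i \<omega>))"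
    unfolding sum_distrib_left
    by (intro Bochner_Integration.integral_sum[symmetric] integrable_mult_square g sq) simp
  finally show ?thesis by (simp add: simple_integral_real u_def)
qed

section \<open>Passage to the Ito integral\<close>

lemma nn_integral_time:
  assumes "f \<in> borel_measurable (time_space T)"
  shows "(\<integral>\<^sup>+\<omega>. (\<integral>\<^sup>+t\<in>{0..T}. f (t, \<omega>) \<partial>lborel) \<partial>M) = (\<integral>\<^sup>+x. f x \<partial>(time_space T))"
proof -
  interpret P: pair_sigma_finite "time_measure T" M by (rule pair_time)
  show ?thesis
    using P.nn_integral_snd[OF assms] by (simp add: nn_integral_restrict_space)
qed

text \<open>The error integrand is nonnegative, so a sequence approximating \<open>H\<close> on the
  whole interval does so on every shorter one. The martingale property uses this at an intermediate
  time \<open>r\<close>.\<close>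

lemma ito_approx:
  fixes H :: "real \<Rightarrow> 'w \<Rightarrow> real"
  assumes ito: "has_ito_integral M F W H T I" and T: "0 \<le> T"
    and H: "\<And>r. 0 \<le> r \<Longrightarrow> (\<lambda>(t, \<omega>). H t \<omega>) \<in> borel_measurable (time_space r)"
  obtains N \<tau> \<xi> where "\<And>k. simple_integrand F (N k) (\<tau> k) (\<xi> k)"
    "\<And>r. 0 \<le> r \<Longrightarrow> r \<le> T \<Longrightarrow>
      L2_lim (time_space r) (\<lambda>k (t, \<omega>). simple_process (N k) (\<tau> k) (\<xi> k) t \<omega>) (\<lambda>(t, \<omega>). H t \<omega>)"
    "L2_lim M (\<lambda>k. simple_integral W (N k) (\<tau> k) (\<xi> k) T) I"
proof -
  from ito obtain N \<tau> \<xi> where I: "I \<in> borel_measurable M"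
    and s: "\<And>k. simple_integrand F (N k) (\<tau> k) (\<xi> k)"
    and l1: "(\<lambda>k. \<integral>\<^sup>+\<omega>. (\<integral>\<^sup>+t\<in>{0..T}. ennreal ((norm (H t \<omega> - simple_process (N k) (\<tau> k) (\<xi> k) t \<omega>))\<^sup>2) \<partial>lborel) \<partial>M) \<longlonglongrightarrow> 0"
    and l2: "(\<lambda>k. \<integral>\<^sup>+\<omega>. ennreal ((norm (I \<omega> - simple_integral W (N k) (\<tau> k) (\<xi> k) T \<omega>))\<^sup>2) \<partial>M) \<longlonglongrightarrow> 0"
    unfolding has_ito_integral_def by blast
  show ?thesis
  proof (rule that[OF s])
    show "L2_lim M (\<lambda>k. simple_integral W (N k) (\<tau> k) (\<xi> k) T) I"
      by (rule L2_lim_nn[OF square_integrable_simple(1)[OF s T] I])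
        (use l2 in \<open>simp add: power2_commute[of "I _"]\<close>)
  next
    fix r assume r: "0 \<le> r" "r \<le> T"
    let ?f = "\<lambda>k (t, \<omega>). simple_process (N k) (\<tau> k) (\<xi> k) t \<omega>" and ?H = "\<lambda>(t, \<omega>). H t \<omega>"
    show "L2_lim (time_space r) ?f ?H"
    proof (rule L2_lim_nn[OF square_integrable_simple(2)[OF s r(1)] H[OF r(1)]])
      have eq: "(\<integral>\<^sup>+x. ennreal ((?f k x - ?H x)\<^sup>2) \<partial>(time_space r))
          = (\<integral>\<^sup>+\<omega>. (\<integral>\<^sup>+t\<in>{0..r}. ennreal ((H t \<omega> - simple_process (N k) (\<tau> k) (\<xi> k) t \<omega>)\<^sup>2) \<partial>lborel) \<partial>M)" for k
      proof -
        have "(\<lambda>x. ennreal ((?f k x - ?H x)\<^sup>2)) \<in> borel_measurable (time_space r)"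
          using square_integrable_measurable[OF square_integrable_simple(2)[OF s r(1)], of k] H[OF r(1)]
          by measurable
        from nn_integral_time[OF this] show ?thesis
          by (simp add: power2_commute[of "H _ _"])
      qed
      have le: "(\<integral>\<^sup>+x. ennreal ((?f k x - ?H x)\<^sup>2) \<partial>(time_space r))
          \<le> (\<integral>\<^sup>+\<omega>. (\<integral>\<^sup>+t\<in>{0..T}. ennreal ((norm (H t \<omega> - simple_process (N k) (\<tau> k) (\<xi> k) t \<omega>))\<^sup>2) \<partial>lborel) \<partial>M)" for k
        unfolding eq using r by (intro nn_integral_mono) (auto simp: indicator_def)
      show "(\<lambda>k. \<integral>\<^sup>+x. ennreal ((?f k x - ?H x)\<^sup>2) \<partial>(time_space r)) \<longlonglongrightarrow> 0"
        by (rule tendsto_sandwich[OF always_eventually always_eventually tendsto_const l1]) (use le in auto)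
    qed
  qed
qed

lemma ito_isometry:
  fixes H :: "real \<Rightarrow> 'w \<Rightarrow> real"
  assumes ito: "has_ito_integral M F W H T I" and T: "0 \<le> T"
    and H: "\<And>r. 0 \<le> r \<Longrightarrow> (\<lambda>(t, \<omega>). H t \<omega>) \<in> borel_measurable (time_space r)"
  shows "square_integrable M I" "square_integrable (time_space T) (\<lambda>x. H (fst x) (snd x))"
    and "expectation (\<lambda>\<omega>. (I \<omega>)\<^sup>2) = (\<integral>x. (H (fst x) (snd x))\<^sup>2 \<partial>(time_space T))"
proof -
  obtain N \<tau> \<xi> where s: "\<And>k. simple_integrand F (N k) (\<tau> k) (\<xi> k)"
    and p': "\<And>r. 0 \<le> r \<Longrightarrow> r \<le> T \<Longrightarrow>
      L2_lim (time_space r) (\<lambda>k (t, \<omega>). simple_process (N k) (\<tau> k) (\<xi> k) t \<omega>) (\<lambda>(t, \<omega>). H t \<omega>)"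
    and i: "L2_lim M (\<lambda>k. simple_integral W (N k) (\<tau> k) (\<xi> k) T) I"
    by (rule ito_approx[OF ito T H], assumption, rule that)
  note p = p'[OF T order_refl]
  show "square_integrable M I" using i by (simp add: L2_lim_def)
  show "square_integrable (time_space T) (\<lambda>x. H (fst x) (snd x))"
    using p unfolding L2_lim_def case_prod_beta' by blast
  have "expectation (\<lambda>\<omega>. I \<omega> * I \<omega>)
      = (\<integral>x. (case x of (t, \<omega>) \<Rightarrow> H t \<omega>) * (case x of (t, \<omega>) \<Rightarrow> H t \<omega>) \<partial>(time_space T))"
    using L2_lim_inner[OF i i] L2_lim_inner[OF p p] unfolding simple_isometry[OF s s T]
    by (rule LIMSEQ_unique)
  then show "expectation (\<lambda>\<omega>. (I \<omega>)\<^sup>2) = (\<integral>x. (H (fst x) (snd x))\<^sup>2 \<partial>(time_space T))"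
    by (simp add: power2_eq_square case_prod_beta)
qed

text \<open>The integrals over \<open>[0,T]\<close> and \<open>[0,r]\<close> come with unrelated approximating sequences
  \<open>p\<close> and \<open>q\<close>; the isometry for the difference of simple processes shows that \<open>p\<close> also
  computes the integral over \<open>[0,r]\<close>.\<close>

lemma ito_martingale:
  fixes H :: "real \<Rightarrow> 'w \<Rightarrow> real"
  assumes ito: "has_ito_integral M F W H T I" "has_ito_integral M F W H r J"
    and r: "0 \<le> r" "r \<le> T"
    and H: "\<And>r. 0 \<le> r \<Longrightarrow> (\<lambda>(t, \<omega>). H t \<omega>) \<in> borel_measurable (time_space r)"
    and g: "g \<in> borel_measurable (F r)" "square_integrable M g"
  shows "expectation (\<lambda>\<omega>. g \<omega> * I \<omega>) = expectation (\<lambda>\<omega>. g \<omega> * J \<omega>)"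
proof -
  have T: "0 \<le> T" using r by simp
  let ?H = "\<lambda>(t, \<omega>). H t \<omega>"
  let ?\<nu> = "time_space r"
  obtain N \<tau> \<xi> where s: "\<And>k. simple_integrand F (N k) (\<tau> k) (\<xi> k)"
    and p': "\<And>r. 0 \<le> r \<Longrightarrow> r \<le> T \<Longrightarrow>
      L2_lim (time_space r) (\<lambda>k (t, \<omega>). simple_process (N k) (\<tau> k) (\<xi> k) t \<omega>) (\<lambda>(t, \<omega>). H t \<omega>)"
    and i: "L2_lim M (\<lambda>k. simple_integral W (N k) (\<tau> k) (\<xi> k) T) I"
    by (rule ito_approx[OF ito(1) T H], assumption, rule that)
  obtain N' \<tau>' \<xi>' where s': "\<And>k. simple_integrand F (N' k) (\<tau>' k) (\<xi>' k)"
    and q': "\<And>s. 0 \<le> s \<Longrightarrow> s \<le> r \<Longrightarrow>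
      L2_lim (time_space s) (\<lambda>k (t, \<omega>). simple_process (N' k) (\<tau>' k) (\<xi>' k) t \<omega>) (\<lambda>(t, \<omega>). H t \<omega>)"
    and j: "L2_lim M (\<lambda>k. simple_integral W (N' k) (\<tau>' k) (\<xi>' k) r) J"
    by (rule ito_approx[OF ito(2) r(1) H], assumption, rule that)
  note p = p'[OF r] and q = q'[OF r(1) order_refl]
  let ?S = "\<lambda>k. simple_integral W (N k) (\<tau> k) (\<xi> k) r"
  let ?S' = "\<lambda>k. simple_integral W (N' k) (\<tau>' k) (\<xi>' k) r"
  let ?p = "\<lambda>k (t, \<omega>). simple_process (N k) (\<tau> k) (\<xi> k) t \<omega>"
  let ?q = "\<lambda>k (t, \<omega>). simple_process (N' k) (\<tau>' k) (\<xi>' k) t \<omega>"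
  \<comment> \<open>All three inner products tend to that of \<open>H\<close> with itself, and
    \<open>1 - 2 + 1 = 0\<close>.\<close>
  have "(\<lambda>k. (\<integral>x. ?p k x * ?p k x \<partial>?\<nu>) - 2 * (\<integral>x. ?p k x * ?q k x \<partial>?\<nu>) + (\<integral>x. ?q k x * ?q k x \<partial>?\<nu>))
      \<longlonglongrightarrow> (\<integral>x. ?H x * ?H x \<partial>?\<nu>)
        - 2 * (\<integral>x. ?H x * ?H x \<partial>?\<nu>)
        + (\<integral>x. ?H x * ?H x \<partial>?\<nu>)"
    by (intro tendsto_add tendsto_diff tendsto_mult[OF tendsto_const] L2_lim_inner p q)
  moreover have "(\<integral>\<omega>. (?S k \<omega> - ?S' k \<omega>)\<^sup>2 \<partial>M)
      = (\<integral>x. ?p k x * ?p k x \<partial>?\<nu>) - 2 * (\<integral>x. ?p k x * ?q k x \<partial>?\<nu>) + (\<integral>x. ?q k x * ?q k x \<partial>?\<nu>)" for k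
    unfolding simple_isometry[OF s s r(1), symmetric] simple_isometry[OF s' s' r(1), symmetric]
      simple_isometry[OF s s' r(1), symmetric]
    by (subst integral_diff_square) (simp_all add: square_integrable_simple s s' r power2_eq_square)
  ultimately have "(\<lambda>k. \<integral>\<omega>. (?S k \<omega> - ?S' k \<omega>)\<^sup>2 \<partial>M) \<longlonglongrightarrow> 0" by simp
  with square_integrable_simple(1)[OF s r(1)] j have S: "L2_lim M ?S J" by (rule L2_lim_trans)
  show ?thesis
    using L2_lim_inner[OF L2_lim_const[OF g(2)] i] L2_lim_inner[OF L2_lim_const[OF g(2)] S]
    unfolding simple_martingale[OF s r g] by (rule LIMSEQ_unique)
qed

section \<open>The energy identity\<close>

lemma square_integrable_snd:
  assumes B: "square_integrable M B"
  shows "square_integrable (time_space T) (\<lambda>x. B (snd x))"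
proof -
  interpret D: finite_measure "time_measure T" by (rule finite_time_measure)
  interpret P: pair_sigma_finite "time_measure T" M by (rule pair_time)
  have mB[measurable]: "B \<in> borel_measurable M" using B by (simp add: square_integrable_def)
  have "integrable (time_space T) (\<lambda>x. (B (snd x))\<^sup>2)"
    by (rule P.Fubini_integrable) (use B in \<open>auto simp: square_integrable_def\<close>)
  then show ?thesis by (simp add: square_integrable_def)
qed

text \<open>The expected Ito formula for a square. Write \<open>Y T = Y 0 + A T + I T\<close> with
  drift part \<open>A\<close> and Ito part \<open>I\<close>. The martingale property kills
  \<open>Y 0 * I T\<close> and turns \<open>I T * A T\<close> into the time integral of
  \<open>g r * I r\<close>, where \<open>I r = Y r - Y 0 - A r\<close>. The triangle lemma gives
  twice the integral of \<open>g * A\<close> for the square of \<open>A T\<close>. In the sum the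
  products of \<open>g\<close> with \<open>A\<close> and with \<open>Y 0\<close> cancel, and
  \<open>2 * g * Y\<close> survives beside the isometry term.\<close>

lemma energy_identity:
  fixes Y g h :: "real \<Rightarrow> 'w \<Rightarrow> real"
  assumes T: "0 \<le> T"
    and Ym: "(\<lambda>(t, \<omega>). Y t \<omega>) \<in> borel_measurable (time_space T)"
    and hm: "\<And>r. 0 \<le> r \<Longrightarrow> (\<lambda>(t, \<omega>). h t \<omega>) \<in> borel_measurable (time_space r)"
    and Y0: "Y 0 \<in> borel_measurable (F 0)" "square_integrable M (Y 0)"
    and gF: "\<And>r. 0 \<le> r \<Longrightarrow> g r \<in> borel_measurable (F r)"
    and Ysq: "square_integrable (time_space T) (\<lambda>x. Y (fst x) (snd x))"
    and gsq: "square_integrable (time_space T) (\<lambda>x. g (fst x) (snd x))"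
    and ito: "\<And>r. 0 \<le> r \<Longrightarrow> r \<le> T \<Longrightarrow>
      has_ito_integral M F W h r (\<lambda>\<omega>. Y r \<omega> - Y 0 \<omega> - (LINT t:{0..r}|lborel. g t \<omega>))"
  shows "square_integrable M (Y T)"
    and "expectation (\<lambda>\<omega>. (Y T \<omega>)\<^sup>2) = expectation (\<lambda>\<omega>. (Y 0 \<omega>)\<^sup>2)
      + (2 * (\<integral>x. Y (fst x) (snd x) * g (fst x) (snd x) \<partial>(time_space T))
         + (\<integral>x. (h (fst x) (snd x))\<^sup>2 \<partial>(time_space T)))"
proof -
  let ?D = "time_measure T" and ?\<nu> = "time_space T"
  interpret D: finite_measure ?D by (rule finite_time_measure)
  interpret P: pair_sigma_finite ?D M by (rule pair_time)
  have mid[measurable]: "(\<lambda>x. x) \<in> borel_measurable ?D" by (rule measurable_restrict_space1) simp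
  have gm[measurable]: "(\<lambda>x. g (fst x) (snd x)) \<in> borel_measurable ?\<nu>"
    using gsq by (simp add: square_integrable_def)
  \<comment> \<open>Integrating an indicator over the fixed interval makes \<open>A\<close> a
    parameter integral, hence jointly measurable.\<close>
  define A where "A r \<omega> = (\<integral>s. g s \<omega> * indicator {..r} s \<partial>?D)" for r \<omega>
  define I where "I r \<omega> = Y r \<omega> - Y 0 \<omega> - (LINT t:{0..r}|lborel. g t \<omega>)" for r \<omega>
  have A: "(LINT t:{0..r}|lborel. g t \<omega>) = A r \<omega>" if "0 \<le> r" "r \<le> T" for r \<omega>
    unfolding A_def set_lebesgue_integral_def
    by (subst integral_restrict_space) (use that in \<open>auto intro!: Bochner_Integration.integral_cong simp: indicator_def\<close>)
  have AT: "A T \<omega> = (\<integral>s. g s \<omega> \<partial>?D)" for \<omega>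
    unfolding A_def by (rule Bochner_Integration.integral_cong) (auto simp: indicator_def)
  have Am: "(\<lambda>x. A (fst x) (snd x)) \<in> borel_measurable ?\<nu>"
  proof -
    have 1: "(\<lambda>p. g (snd p) (snd (fst p))) \<in> borel_measurable (?\<nu> \<Otimes>\<^sub>M ?D)"
    proof -
      have "(\<lambda>p. (snd p, snd (fst p))) \<in> (?\<nu> \<Otimes>\<^sub>M ?D) \<rightarrow>\<^sub>M ?\<nu>" by measurable
      from measurable_compose[OF this gm] show ?thesis by simp
    qed
    have 2: "(\<lambda>p. indicator {..fst (fst p)} (snd p) :: real) \<in> borel_measurable (?\<nu> \<Otimes>\<^sub>M ?D)"
      unfolding indicator_def atMost_iff by measurable
    show ?thesis
      unfolding A_def
      by (rule D.borel_measurable_lebesgue_integral)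
        (use borel_measurable_times[OF 1 2] in \<open>unfold case_prod_beta'\<close>)
  qed
  define G where "G \<omega> = (\<integral>s. (g s \<omega>)\<^sup>2 \<partial>?D)" for \<omega>
  have g2: "integrable ?\<nu> (\<lambda>(s, \<omega>). (g s \<omega>)\<^sup>2)"
    using gsq unfolding square_integrable_def case_prod_beta' by blast
  have G0: "0 \<le> G \<omega>" for \<omega> by (simp add: G_def)
  have Gi: "integrable M G"
    using P.integrable_snd[OF g2] by (simp add: G_def[abs_def])
  have gslice: "AE \<omega> in M. square_integrable ?D (\<lambda>s. g s \<omega>)"
    using P.AE_integrable_snd[OF g2] AE_space
  proof eventually_elim
    case (elim \<omega>)
    have "(\<lambda>s. g s \<omega>) \<in> borel_measurable ?D"
      using measurable_compose[OF measurable_Pair2'[OF elim(2)] gm] by simp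
    then show ?case using elim by (simp add: square_integrable_def)
  qed
  \<comment> \<open>Cauchy-Schwarz against an indicator bounds all \<open>r\<close> at once; this
    gives square integrability of \<open>A\<close> on the product space and at time
    \<open>T\<close>.\<close>
  have Abound: "AE \<omega> in M. \<forall>r. (A r \<omega>)\<^sup>2 \<le> T * G \<omega>"
    using gslice
  proof eventually_elim
    case (elim \<omega>)
    show ?case
    proof
      fix r
      have ind: "square_integrable ?D (indicator {..r})"
        by (rule square_integrable_bounded[OF finite_time_measure, where c=1])
          (auto simp: indicator_def intro: measurable_restrict_space1)
      have "(\<integral>s. (indicator {..r} s)\<^sup>2 \<partial>?D) \<le> (\<integral>s. (1::real) \<partial>?D)"
        using ind by (intro integral_mono) (auto simp: square_integrable_def indicator_def)
      also have "(\<integral>s. (1::real) \<partial>?D) = T" using T by (simp add: measure_restrict_space)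
      finally have "G \<omega> * (\<integral>s. (indicator {..r} s)\<^sup>2 \<partial>?D) \<le> G \<omega> * T"
        by (rule mult_left_mono[OF _ G0])
      moreover have "(A r \<omega>)\<^sup>2 \<le> G \<omega> * (\<integral>s. (indicator {..r} s)\<^sup>2 \<partial>?D)"
        unfolding A_def G_def by (rule integral_Cauchy_Schwarz[OF elim ind])
      ultimately show "(A r \<omega>)\<^sup>2 \<le> T * G \<omega>" by (simp add: mult.commute[of T])
    qed
  qed
  have Asq: "square_integrable ?\<nu> (\<lambda>x. A (fst x) (snd x))"
    unfolding square_integrable_def
  proof (intro conjI Am integrableI_bounded)
    show "(\<lambda>x. (A (fst x) (snd x))\<^sup>2) \<in> borel_measurable ?\<nu>" using Am by simp
    have "(\<integral>\<^sup>+x. ennreal (norm ((A (fst x) (snd x))\<^sup>2)) \<partial>?\<nu>) = (\<integral>\<^sup>+\<omega>. (\<integral>\<^sup>+r. ennreal ((A r \<omega>)\<^sup>2) \<partial>?D) \<partial>M)"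
      using Am by (subst P.nn_integral_snd[symmetric]) auto
    also have "\<dots> \<le> (\<integral>\<^sup>+\<omega>. (\<integral>\<^sup>+r. ennreal (T * G \<omega>) \<partial>?D) \<partial>M)"
    proof (rule nn_integral_mono_AE)
      show "AE \<omega> in M. (\<integral>\<^sup>+r. ennreal ((A r \<omega>)\<^sup>2) \<partial>?D) \<le> (\<integral>\<^sup>+r. ennreal (T * G \<omega>) \<partial>?D)"
        using Abound by eventually_elim (intro nn_integral_mono ennreal_leI, blast)
    qed
    also have "\<dots> = (\<integral>\<^sup>+\<omega>. ennreal (T * T * G \<omega>) \<partial>M)"
      using T G0 by (intro nn_integral_cong)
        (simp add: emeasure_restrict_space ennreal_mult[symmetric] mult_ac)
    also have "\<dots> = ennreal (\<integral>\<omega>. T * T * G \<omega> \<partial>M)"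
      using T G0 Gi by (intro nn_integral_eq_integral) auto
    also have "\<dots> < \<infinity>" by simp
    finally show "(\<integral>\<^sup>+x. ennreal (norm ((A (fst x) (snd x))\<^sup>2)) \<partial>?\<nu>) < \<infinity>" .
  qed
  have ATm: "A T \<in> borel_measurable M"
    using measurable_compose[OF measurable_Pair1'[of T ?D M] Am] T by simp
  have ATsq: "square_integrable M (A T)"
    unfolding square_integrable_def
  proof
    show "integrable M (\<lambda>\<omega>. (A T \<omega>)\<^sup>2)"
      using ATm Abound by (intro Bochner_Integration.integrable_bound[OF integrable_mult_right[OF Gi, of T]])
        (auto elim!: eventually_mono simp: abs_mult abs_of_nonneg[OF T] abs_of_nonneg[OF G0])
  qed (rule ATm)
  have itoI: "has_ito_integral M F W h r (I r)" if "0 \<le> r" "r \<le> T" for r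
    using ito[OF that] by (simp add: I_def[abs_def])
  note iso = ito_isometry[OF itoI[OF T order_refl] T hm]
  have ITsq: "square_integrable M (I T)" by (rule iso(1))
  have ITnorm: "expectation (\<lambda>\<omega>. (I T \<omega>)\<^sup>2) = (\<integral>x. (h (fst x) (snd x))\<^sup>2 \<partial>?\<nu>)" by (rule iso(3))
  have YT: "Y T = (\<lambda>\<omega>. Y 0 \<omega> + (A T \<omega> + I T \<omega>))"
    using A[OF T order_refl] by (simp add: I_def fun_eq_iff)
  show "square_integrable M (Y T)"
    unfolding YT by (intro square_integrable_add Y0 ATsq ITsq)
  have Isq: "square_integrable ?\<nu> (\<lambda>x. Y (fst x) (snd x) - Y 0 (snd x) - A (fst x) (snd x))"
    by (intro square_integrable_diff Ysq Asq square_integrable_snd Y0)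
  have F1: "expectation (\<lambda>\<omega>. B \<omega> * A T \<omega>) = (\<integral>x. g (fst x) (snd x) * B (snd x) \<partial>?\<nu>)"
    if B: "square_integrable M B" for B
  proof -
    have i: "integrable ?\<nu> (\<lambda>(s, \<omega>). g s \<omega> * B \<omega>)"
      using integrable_mult_square[OF gsq square_integrable_snd[OF B]] unfolding case_prod_beta' .
    have "expectation (\<lambda>\<omega>. B \<omega> * A T \<omega>) = (\<integral>\<omega>. (\<integral>s. g s \<omega> * B \<omega> \<partial>?D) \<partial>M)"
      by (simp add: AT mult.commute)
    also have "\<dots> = (\<integral>x. g (fst x) (snd x) * B (snd x) \<partial>?\<nu>)"
      using P.integral_snd[OF i] unfolding case_prod_beta' .
    finally show ?thesis .
  qed
  have F2: "expectation (\<lambda>\<omega>. (A T \<omega>)\<^sup>2) = 2 * (\<integral>x. g (fst x) (snd x) * A (fst x) (snd x) \<partial>?\<nu>)"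
  proof -
    have i: "integrable ?\<nu> (\<lambda>(s, \<omega>). g s \<omega> * A s \<omega>)"
      using integrable_mult_square[OF gsq Asq] unfolding case_prod_beta' .
    have "expectation (\<lambda>\<omega>. (A T \<omega>)\<^sup>2) = (\<integral>\<omega>. 2 * (\<integral>s. g s \<omega> * A s \<omega> \<partial>?D) \<partial>M)"
    proof (rule integral_cong_AE)
      show "AE \<omega> in M. (A T \<omega>)\<^sup>2 = 2 * (\<integral>s. g s \<omega> * A s \<omega> \<partial>?D)"
        using gslice
      proof eventually_elim
        case (elim \<omega>)
        have "square_integrable ?D (\<lambda>s. 1)"
          by (rule square_integrable_bounded[OF finite_time_measure, where c=1]) auto
        from integrable_mult_square[OF elim this] have "integrable ?D (\<lambda>s. g s \<omega>)" by simp
        from integral_square_triangle[OF this] show ?case unfolding AT by (simp add: A_def)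
      qed
    qed (use ATm P.integrable_snd[OF i] in auto)
    also have "\<dots> = 2 * (\<integral>x. g (fst x) (snd x) * A (fst x) (snd x) \<partial>?\<nu>)"
      using P.integral_snd[OF i] unfolding case_prod_beta' by simp
    finally show ?thesis .
  qed
  have F3: "expectation (\<lambda>\<omega>. I T \<omega> * A T \<omega>)
      = (\<integral>x. g (fst x) (snd x) * (Y (fst x) (snd x) - Y 0 (snd x) - A (fst x) (snd x)) \<partial>?\<nu>)"
  proof -
    have i: "integrable ?\<nu> (\<lambda>x. g (fst x) (snd x) * I T (snd x))"
      by (rule integrable_mult_square[OF gsq square_integrable_snd[OF ITsq]])
    have j: "integrable ?\<nu> (\<lambda>x. g (fst x) (snd x) * (Y (fst x) (snd x) - Y 0 (snd x) - A (fst x) (snd x)))"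
      by (rule integrable_mult_square[OF gsq Isq])
    have "expectation (\<lambda>\<omega>. I T \<omega> * A T \<omega>) = (\<integral>x. g (fst x) (snd x) * I T (snd x) \<partial>?\<nu>)"
      by (rule F1[OF ITsq])
    also have "\<dots> = (\<integral>r. expectation (\<lambda>\<omega>. g r \<omega> * I T \<omega>) \<partial>?D)"
      using P.integral_fst'[OF i] by simp
    \<comment> \<open>The Ito integral up to \<open>T\<close> is replaced by the one up to
      \<open>r\<close> wherever \<open>g r\<close> is square integrable, hence for almost every
      \<open>r\<close>.\<close>
    also have "\<dots> = (\<integral>r. expectation (\<lambda>\<omega>. g r \<omega> * (Y r \<omega> - Y 0 \<omega> - A r \<omega>)) \<partial>?D)"
    proof (rule integral_cong_AE)
      have "integrable ?\<nu> (\<lambda>x. (g (fst x) (snd x))\<^sup>2)" using gsq by (simp add: square_integrable_def)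
      from P.AE_integrable_fst'[OF this] AE_space
      show "AE r in ?D. expectation (\<lambda>\<omega>. g r \<omega> * I T \<omega>) = expectation (\<lambda>\<omega>. g r \<omega> * (Y r \<omega> - Y 0 \<omega> - A r \<omega>))"
      proof eventually_elim
        case (elim r)
        then have r: "0 \<le> r" "r \<le> T" by (auto simp: space_restrict_space)
        have gr: "square_integrable M (g r)"
          using elim measurable_M[OF r(1) gF[OF r(1)]] by (simp add: square_integrable_def)
        have "expectation (\<lambda>\<omega>. g r \<omega> * I T \<omega>) = expectation (\<lambda>\<omega>. g r \<omega> * I r \<omega>)"
          by (rule ito_martingale[OF itoI[OF T order_refl] itoI[OF r] r hm gF[OF r(1)] gr])
        then show ?case using A[OF r] by (simp add: I_def)
      qed
      show "(\<lambda>r. expectation (\<lambda>\<omega>. g r \<omega> * I T \<omega>)) \<in> borel_measurable ?D"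
        using P.integrable_fst'[OF i] by simp
      show "(\<lambda>r. expectation (\<lambda>\<omega>. g r \<omega> * (Y r \<omega> - Y 0 \<omega> - A r \<omega>))) \<in> borel_measurable ?D"
        using P.integrable_fst'[OF j] by simp
    qed
    also have "\<dots> = (\<integral>x. g (fst x) (snd x) * (Y (fst x) (snd x) - Y 0 (snd x) - A (fst x) (snd x)) \<partial>?\<nu>)"
      using P.integral_fst'[OF j] by simp
    finally show ?thesis .
  qed
  have I0: "I 0 \<omega> = 0" for \<omega>
  proof -
    have "AE t in lborel. indicator {0..0} t *\<^sub>R g t \<omega> = 0"
      using AE_lborel_singleton[of 0] by eventually_elim (simp add: indicator_def)
    then have "(LINT t:{0..0}|lborel. g t \<omega>) = 0"
      unfolding set_lebesgue_integral_def by (rule integral_eq_zero_AE)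
    then show ?thesis by (simp add: I_def)
  qed
  \<comment> \<open>\<open>Y 0\<close> is known at time 0, and the integral up to time 0
    vanishes.\<close>
  have F4: "expectation (\<lambda>\<omega>. Y 0 \<omega> * I T \<omega>) = 0"
    using ito_martingale[OF itoI[OF T order_refl] itoI[OF order_refl T] order_refl T hm Y0] by (simp add: I0)
  let ?gY = "\<integral>x. g (fst x) (snd x) * Y (fst x) (snd x) \<partial>?\<nu>"
  have split: "(\<integral>x. g (fst x) (snd x) * (Y (fst x) (snd x) - Y 0 (snd x) - A (fst x) (snd x)) \<partial>?\<nu>)
      = ?gY - (\<integral>x. g (fst x) (snd x) * Y 0 (snd x) \<partial>?\<nu>) - (\<integral>x. g (fst x) (snd x) * A (fst x) (snd x) \<partial>?\<nu>)"
    using integrable_mult_square[OF gsq Ysq] integrable_mult_square[OF gsq square_integrable_snd[OF Y0(2)]]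
      integrable_mult_square[OF gsq Asq]
    by (simp add: right_diff_distrib)
  have sum_sq: "expectation (\<lambda>\<omega>. (u \<omega> + v \<omega>)\<^sup>2)
      = expectation (\<lambda>\<omega>. (u \<omega>)\<^sup>2) + 2 * expectation (\<lambda>\<omega>. u \<omega> * v \<omega>) + expectation (\<lambda>\<omega>. (v \<omega>)\<^sup>2)"
    if u: "square_integrable M u" and v: "square_integrable M v" for u v
    using integral_diff_square[OF u square_integrable_cmult[OF v, of "-1"]] by simp
  have mixed: "expectation (\<lambda>\<omega>. Y 0 \<omega> * (A T \<omega> + I T \<omega>))
      = expectation (\<lambda>\<omega>. Y 0 \<omega> * A T \<omega>) + expectation (\<lambda>\<omega>. Y 0 \<omega> * I T \<omega>)"
    using integrable_mult_square[OF Y0(2) ATsq] integrable_mult_square[OF Y0(2) ITsq]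
    by (simp add: distrib_left)
  have "expectation (\<lambda>\<omega>. (Y T \<omega>)\<^sup>2) = expectation (\<lambda>\<omega>. (Y 0 \<omega>)\<^sup>2)
      + 2 * expectation (\<lambda>\<omega>. Y 0 \<omega> * A T \<omega>)
      + expectation (\<lambda>\<omega>. (A T \<omega>)\<^sup>2) + 2 * expectation (\<lambda>\<omega>. I T \<omega> * A T \<omega>)
      + expectation (\<lambda>\<omega>. (I T \<omega>)\<^sup>2)"
    unfolding YT sum_sq[OF Y0(2) square_integrable_add[OF ATsq ITsq]] sum_sq[OF ATsq ITsq] mixed F4
    by (simp add: mult.commute)
  also have "\<dots> = expectation (\<lambda>\<omega>. (Y 0 \<omega>)\<^sup>2) + (2 * ?gY + (\<integral>x. (h (fst x) (snd x))\<^sup>2 \<partial>?\<nu>))"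
    unfolding F1[OF Y0(2)] F2 F3 split ITnorm by simp
  finally show "expectation (\<lambda>\<omega>. (Y T \<omega>)\<^sup>2) = expectation (\<lambda>\<omega>. (Y 0 \<omega>)\<^sup>2)
      + (2 * (\<integral>x. Y (fst x) (snd x) * g (fst x) (snd x) \<partial>?\<nu>) + (\<integral>x. (h (fst x) (snd x))\<^sup>2 \<partial>?\<nu>))"
    by (simp add: mult.commute)
qed

end

section \<open>Second moments of linear stochastic differential equations\<close>

lemma norm_outer: "norm (outer w) = (norm w)\<^sup>2"
proof -
  have "outer w \<bullet> outer w = (w \<bullet> w) * (w \<bullet> w)" by (simp add: inner_outer outer_mult_vec)
  then show ?thesis by (simp add: norm_eq_sqrt_inner)
qed

lemma continuous_outer: "continuous_on UNIV (outer :: real^'n \<Rightarrow> real^'n^'n)"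
  unfolding outer_def by (intro continuous_intros)

lemma borel_measurable_outer: "f \<in> borel_measurable N \<Longrightarrow> (\<lambda>x. outer (f x :: real^'n)) \<in> borel_measurable N"
  by (rule measurable_compose[OF _ borel_measurable_continuous_onI[OF continuous_outer]])

lemma integrable_outer:
  fixes f :: "'a \<Rightarrow> real^'n"
  assumes "f \<in> borel_measurable N" "integrable N (\<lambda>x. (norm (f x))\<^sup>2)"
  shows "integrable N (\<lambda>x. outer (f x))"
  by (rule Bochner_Integration.integrable_bound[OF assms(2)])
    (simp_all add: borel_measurable_outer assms(1) norm_outer)

text \<open>\<open>second_moment\<close> is defined entrywise; as a Bochner integral of rank-one
  matrices it can be paired with a matrix under the integral sign.\<close>

lemma second_moment_outer:
  assumes "integrable N (\<lambda>x. outer (f x))"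
  shows "second_moment N f = (\<integral>x. outer (f x) \<partial>N)"
proof -
  have "(\<integral>x. outer (f x) \<partial>N) $ i $ j = (\<integral>x. outer (f x) $ i $ j \<partial>N)" for i j
    using integral_bounded_linear[OF bounded_linear_vec_nth
        integrable_bounded_linear[OF bounded_linear_vec_nth assms], of i j]
      integral_bounded_linear[OF bounded_linear_vec_nth assms, of i] by simp
  then show ?thesis by (simp add: vec_eq_iff second_moment_def outer_def)
qed

lemma integral_outer_inner:
  assumes "integrable N (\<lambda>x. outer (f x))"
  shows "A \<bullet> (\<integral>x. outer (f x) \<partial>N) = (\<integral>x. f x \<bullet> (A *v f x) \<partial>N)"
    and "integrable N (\<lambda>x. f x \<bullet> (A *v f x))"
proof -
  have eq: "(\<lambda>x. f x \<bullet> (A *v f x)) = (\<lambda>x. A \<bullet> outer (f x))" by (simp add: inner_outer)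
  show "A \<bullet> (\<integral>x. outer (f x) \<partial>N) = (\<integral>x. f x \<bullet> (A *v f x) \<partial>N)"
    unfolding eq by (rule integral_inner_right[symmetric]) (use assms in simp)
  show "integrable N (\<lambda>x. f x \<bullet> (A *v f x))"
    unfolding eq using assms by (rule integrable_inner_right)
qed

lemma psd_second_moment:
  assumes i: "integrable N (\<lambda>x. outer (f x))"
  shows "psd (second_moment N f)"
  unfolding psd_def
proof (intro conjI allI)
  show "transpose (second_moment N f) = second_moment N f"
    by (simp add: second_moment_def transpose_def vec_eq_iff mult.commute)
  fix v
  have "v \<bullet> (second_moment N f *v v) = outer v \<bullet> second_moment N f"
    by (metis inner_outer inner_commute)
  also have "\<dots> = (\<integral>x. f x \<bullet> (outer v *v f x) \<partial>N)"
    unfolding second_moment_outer[OF i] by (rule integral_outer_inner(1)[OF i])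
  also have "\<dots> = (\<integral>x. (v \<bullet> f x)\<^sup>2 \<partial>N)" by (simp add: outer_mult_vec power2_eq_square inner_commute)
  finally show "0 \<le> v \<bullet> (second_moment N f *v v)" by simp
qed

text \<open>The difference has zero form, so it is positive semidefinite with every vector as a null
  vector. Homogeneity reduces the test to unit vectors, on which the state is projected
  below.\<close>

lemma symmetric_matrix_eqI:
  fixes S U :: "real^'n^'n"
  assumes "transpose S = S" "transpose U = U" and eq: "\<And>v. norm v = 1 \<Longrightarrow> v \<bullet> (S *v v) = v \<bullet> (U *v v)"
  shows "S = U"
proof -
  have q: "v \<bullet> ((S - U) *v v) = 0" for v
  proof (cases "v = 0")
    case False
    then have "(v /\<^sub>R norm v) \<bullet> ((S - U) *v (v /\<^sub>R norm v)) = 0"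
      using eq[of "v /\<^sub>R norm v"] by (simp add: mv.diff_left inner_diff_right)
    then show ?thesis using False by (simp add: mv.scaleR_right)
  qed simp
  have "psd (S - U)" using assms q by (simp add: psd_def transpose_diff)
  from psd_null[OF this q] have "S *v v = U *v v" for v by (simp add: mv.diff_left)
  then show ?thesis by (simp add: matrix_eq)
qed

context brownian_basis
begin

text \<open>Projection on a vector of norm at most 1 is a contraction, so the projected
  approximations converge on the same grids.\<close>

lemma has_ito_integral_inner:
  fixes H :: "real \<Rightarrow> 'w \<Rightarrow> 'b::euclidean_space"
  assumes ito: "has_ito_integral M F W H T I" and v: "norm v \<le> 1"
  shows "has_ito_integral M F W (\<lambda>t \<omega>. v \<bullet> H t \<omega>) T (\<lambda>\<omega>. v \<bullet> I \<omega>)"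
proof -
  from ito obtain N \<tau> \<xi> where I: "I \<in> borel_measurable M"
    and s: "\<And>k. simple_integrand F (N k) (\<tau> k) (\<xi> k)"
    and l1: "(\<lambda>k. \<integral>\<^sup>+\<omega>. (\<integral>\<^sup>+t\<in>{0..T}. ennreal ((norm (H t \<omega> - simple_process (N k) (\<tau> k) (\<xi> k) t \<omega>))\<^sup>2) \<partial>lborel) \<partial>M) \<longlonglongrightarrow> 0"
    and l2: "(\<lambda>k. \<integral>\<^sup>+\<omega>. ennreal ((norm (I \<omega> - simple_integral W (N k) (\<tau> k) (\<xi> k) T \<omega>))\<^sup>2) \<partial>M) \<longlonglongrightarrow> 0"
    unfolding has_ito_integral_def by blast
  let ?\<xi> = "\<lambda>k i \<omega>. v \<bullet> \<xi> k i \<omega>"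
  have cs: "\<bar>v \<bullet> x\<bar> \<le> norm x" for x :: 'b
    using Cauchy_Schwarz_ineq2[of v x] mult_right_mono[OF v norm_ge_zero[of x]] by simp
  have le: "ennreal ((norm (v \<bullet> x))\<^sup>2) \<le> ennreal ((norm x)\<^sup>2)" for x :: 'b
    using cs[of x] by (intro ennreal_leI power_mono) auto
  have "simple_integrand F (N k) (\<tau> k) (?\<xi> k)" for k
    using s[of k] unfolding simple_integrand_def
  proof (intro conjI allI impI; elim conjE)
    fix i assume i: "i < N k"
      and a: "\<forall>i<N k. \<xi> k i \<in> borel_measurable (F (\<tau> k i)) \<and> (\<exists>c. \<forall>\<omega>\<in>space (F (\<tau> k i)). norm (\<xi> k i \<omega>) \<le> c)"
    then show "?\<xi> k i \<in> borel_measurable (F (\<tau> k i))" by auto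
    from a i obtain c where "\<forall>\<omega>\<in>space (F (\<tau> k i)). norm (\<xi> k i \<omega>) \<le> c" by blast
    then have "\<forall>\<omega>\<in>space (F (\<tau> k i)). norm (?\<xi> k i \<omega>) \<le> c" using cs order_trans by fastforce
    then show "\<exists>c. \<forall>\<omega>\<in>space (F (\<tau> k i)). norm (?\<xi> k i \<omega>) \<le> c" by blast
  qed blast+
  moreover have "(\<lambda>k. \<integral>\<^sup>+\<omega>. (\<integral>\<^sup>+t\<in>{0..T}. ennreal ((norm (v \<bullet> H t \<omega> - simple_process (N k) (\<tau> k) (?\<xi> k) t \<omega>))\<^sup>2) \<partial>lborel) \<partial>M) \<longlonglongrightarrow> 0"
  proof (rule tendsto_sandwich[OF always_eventually always_eventually tendsto_const l1]; intro allI)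
    fix k
    have eq: "simple_process (N k) (\<tau> k) (?\<xi> k) t \<omega> = v \<bullet> simple_process (N k) (\<tau> k) (\<xi> k) t \<omega>" for t \<omega>
      by (simp add: simple_process_def inner_sum_right)
    show "(\<integral>\<^sup>+\<omega>. (\<integral>\<^sup>+t\<in>{0..T}. ennreal ((norm (v \<bullet> H t \<omega> - simple_process (N k) (\<tau> k) (?\<xi> k) t \<omega>))\<^sup>2) \<partial>lborel) \<partial>M)
      \<le> (\<integral>\<^sup>+\<omega>. (\<integral>\<^sup>+t\<in>{0..T}. ennreal ((norm (H t \<omega> - simple_process (N k) (\<tau> k) (\<xi> k) t \<omega>))\<^sup>2) \<partial>lborel) \<partial>M)"
      unfolding eq inner_diff_right[symmetric] by (intro nn_integral_mono mult_right_mono le) auto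
  qed auto
  moreover have "(\<lambda>k. \<integral>\<^sup>+\<omega>. ennreal ((norm (v \<bullet> I \<omega> - simple_integral W (N k) (\<tau> k) (?\<xi> k) T \<omega>))\<^sup>2) \<partial>M) \<longlonglongrightarrow> 0"
  proof (rule tendsto_sandwich[OF always_eventually always_eventually tendsto_const l2]; intro allI)
    fix k
    have eq: "simple_integral W (N k) (\<tau> k) (?\<xi> k) T \<omega> = v \<bullet> simple_integral W (N k) (\<tau> k) (\<xi> k) T \<omega>" for \<omega>
      by (simp add: Defs.simple_integral_def inner_sum_right)
    show "(\<integral>\<^sup>+\<omega>. ennreal ((norm (v \<bullet> I \<omega> - simple_integral W (N k) (\<tau> k) (?\<xi> k) T \<omega>))\<^sup>2) \<partial>M)
      \<le> (\<integral>\<^sup>+\<omega>. ennreal ((norm (I \<omega> - simple_integral W (N k) (\<tau> k) (\<xi> k) T \<omega>))\<^sup>2) \<partial>M)"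
      unfolding eq inner_diff_right[symmetric] by (intro nn_integral_mono le)
  qed auto
  ultimately show ?thesis
    using I unfolding has_ito_integral_def
    by (intro conjI exI[of _ N] exI[of _ \<tau>] exI[of _ ?\<xi>]) auto
qed

text \<open>Projection is pulled through the drift integral along continuous paths, that is almost
  surely; this carries the Ito integral across.\<close>

lemma has_ito_integral_cong_AE:
  assumes ito: "has_ito_integral M F W H T I" and J: "J \<in> borel_measurable M" "AE \<omega> in M. I \<omega> = J \<omega>"
  shows "has_ito_integral M F W H T J"
proof -
  have "(\<integral>\<^sup>+\<omega>. ennreal ((norm (I \<omega> - S \<omega>))\<^sup>2) \<partial>M) = (\<integral>\<^sup>+\<omega>. ennreal ((norm (J \<omega> - S \<omega>))\<^sup>2) \<partial>M)" for S
    using J(2) by (intro nn_integral_cong_AE) (auto elim!: eventually_mono)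
  then show ?thesis using ito J(1) unfolding has_ito_integral_def by simp
qed

lemma progressively_measurable_joint:
  assumes X: "progressively_measurable F X" and T: "0 \<le> T"
  shows "(\<lambda>(t, \<omega>). X t \<omega>) \<in> borel_measurable (time_space T)"
    and "X T \<in> borel_measurable (F T)"
proof -
  have X': "(\<lambda>(t, \<omega>). X t \<omega>) \<in> borel_measurable (restrict_space borel {0..T} \<Otimes>\<^sub>M F T)"
    using X T by (simp add: progressively_measurable_def)
  have id1: "(\<lambda>t. t) \<in> time_measure T \<rightarrow>\<^sub>M restrict_space borel {0..T}"
    by (rule measurable_ident_sets) (simp add: sets_restrict_space)
  have id2: "(\<lambda>\<omega>. \<omega>) \<in> M \<rightarrow>\<^sub>M F T"
    using subalgebra_M[OF T] by (intro measurable_from_subalg[OF subalgebra_M[OF T]] measurable_ident_sets) auto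
  have "(\<lambda>x. (fst x, snd x)) \<in> (time_space T) \<rightarrow>\<^sub>M (restrict_space borel {0..T} \<Otimes>\<^sub>M F T)"
    by (intro measurable_Pair measurable_compose[OF measurable_fst id1] measurable_compose[OF measurable_snd id2])
  from measurable_compose[OF this X'] show "(\<lambda>(t, \<omega>). X t \<omega>) \<in> borel_measurable (time_space T)"
    by (simp add: case_prod_beta')
  have "Pair T \<in> F T \<rightarrow>\<^sub>M (restrict_space borel {0..T} \<Otimes>\<^sub>M F T)"
    by (rule measurable_Pair1') (use T in simp)
  from measurable_compose[OF this X'] show "X T \<in> borel_measurable (F T)" by simp
qed

lemma measurable_time_integral:
  fixes f :: "real \<Rightarrow> 'w \<Rightarrow> real"
  assumes f: "(\<lambda>(t, \<omega>). f t \<omega>) \<in> borel_measurable (time_space T)"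
  shows "(\<lambda>\<omega>. LINT t:{0..T}|lborel. f t \<omega>) \<in> borel_measurable M"
proof -
  interpret D: finite_measure "time_measure T" by (rule finite_time_measure)
  have "(\<lambda>(\<omega>, t). f t \<omega>) \<in> borel_measurable (M \<Otimes>\<^sub>M time_measure T)"
    using measurable_compose[OF measurable_pair_swap' f] by (simp add: case_prod_beta')
  then have "(\<lambda>\<omega>. \<integral>t. f t \<omega> \<partial>time_measure T) \<in> borel_measurable M"
    by (rule D.borel_measurable_lebesgue_integral)
  also have "(\<lambda>\<omega>. \<integral>t. f t \<omega> \<partial>time_measure T) = (\<lambda>\<omega>. LINT t:{0..T}|lborel. f t \<omega>)"
    by (simp add: set_lebesgue_integral_def integral_restrict_space)
  finally show ?thesis .
qed

text \<open>The energy identity for the scalar process \<open>v \<bullet> X\<close>. Its integrand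
  is the quadratic form, at the state, of the adjoint operator applied to \<open>outer v\<close>,
  which \<open>sde_moment_flow\<close> exploits.\<close>

lemma sde_energy:
  fixes G H :: "real^'n^'n" and X :: "real \<Rightarrow> 'w \<Rightarrow> real^'n"
  assumes sde: "linear_sde_solution M F W G H X" and T: "0 \<le> T" and v: "norm v = 1"
  shows "square_integrable M (\<lambda>\<omega>. v \<bullet> X T \<omega>)"
    and "expectation (\<lambda>\<omega>. (v \<bullet> X T \<omega>)\<^sup>2) = expectation (\<lambda>\<omega>. (v \<bullet> X 0 \<omega>)\<^sup>2)
      + (\<integral>x. 2 * ((v \<bullet> X (fst x) (snd x)) * (v \<bullet> (G *v X (fst x) (snd x)))) + (v \<bullet> (H *v X (fst x) (snd x)))\<^sup>2
          \<partial>(time_space T))"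
proof -
  let ?\<nu> = "time_space T"
  have prog: "progressively_measurable F X"
    and cont: "AE \<omega> in M. continuous_on {0..} (\<lambda>t. X t \<omega>)"
    and X0: "(\<integral>\<^sup>+\<omega>. ennreal ((norm (X 0 \<omega>))\<^sup>2) \<partial>M) < \<infinity>"
    and XT: "(\<integral>\<^sup>+\<omega>. (\<integral>\<^sup>+t\<in>{0..T}. ennreal ((norm (X t \<omega>))\<^sup>2) \<partial>lborel) \<partial>M) < \<infinity>"
    and ito: "\<And>r. 0 \<le> r \<Longrightarrow> has_ito_integral M F W (\<lambda>t \<omega>. H *v X t \<omega>) r
        (\<lambda>\<omega>. X r \<omega> - X 0 \<omega> - (LINT t:{0..r}|lborel. G *v X t \<omega>))"
    using sde T by (auto simp: linear_sde_solution_def)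
  note Xm = progressively_measurable_joint(1)[OF prog] and XF = progressively_measurable_joint(2)[OF prog]
  have lin: "(\<lambda>x. w \<bullet> (B *v x)) \<in> borel_measurable borel" for w :: "real^'n" and B :: "real^'n^'n"
    by (intro borel_measurable_continuous_onI continuous_intros mv.continuous_on)
  have Xlin: "(\<lambda>(t, \<omega>). w \<bullet> (B *v X t \<omega>)) \<in> borel_measurable (time_space r)" if "0 \<le> r"
    for r w and B :: "real^'n^'n"
    using measurable_compose[OF Xm[OF that] lin] by (simp add: case_prod_beta')
  have XM: "X r \<in> borel_measurable M" if "0 \<le> r" for r using measurable_M[OF that XF[OF that]] .
  have "integrable M (\<lambda>\<omega>. (norm (X 0 \<omega>))\<^sup>2)"
    by (rule integrableI_bounded) (use XM[of 0] X0 in auto)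
  then have X0sq: "square_integrable M (\<lambda>\<omega>. norm (X 0 \<omega>))"
    using XM[of 0] by (simp add: square_integrable_def)
  have Xm': "(\<lambda>x. X (fst x) (snd x)) \<in> borel_measurable ?\<nu>" using Xm[OF T] unfolding case_prod_beta' .
  have "(\<integral>\<^sup>+x. ennreal ((norm (X (fst x) (snd x)))\<^sup>2) \<partial>?\<nu>) < \<infinity>"
    using XT Xm' by (subst nn_integral_time[symmetric]) auto
  then have Xsq: "square_integrable ?\<nu> (\<lambda>x. norm (X (fst x) (snd x)))"
    using Xm' by (auto simp: square_integrable_def intro!: integrableI_bounded)
  \<comment> \<open>A linear functional of the state is dominated by a multiple of its norm; stated
    for any measure, this serves both the initial state and the process on the product
    space.\<close>
  have dom: "square_integrable N (\<lambda>x. w \<bullet> (B *v f x))"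
    if f: "square_integrable N (\<lambda>x. norm (f x))" "f \<in> borel_measurable N"
    for N :: "'z measure" and f w and B :: "real^'n^'n"
  proof -
    have "\<bar>w \<bullet> (B *v x)\<bar> \<le> norm w * norm B * norm x" for x
    proof -
      have "\<bar>w \<bullet> (B *v x)\<bar> \<le> norm w * norm (B *v x)" by (rule Cauchy_Schwarz_ineq2)
      also have "\<dots> \<le> norm w * (norm B * norm x)" by (intro mult_left_mono norm_matrix_vector_le) simp
      finally show ?thesis by (simp add: mult.assoc)
    qed
    then have le: "(w \<bullet> (B *v x))\<^sup>2 \<le> (norm w * norm B)\<^sup>2 * (norm x)\<^sup>2" for x
      by (metis power_mult_distrib abs_le_square_iff abs_norm_cancel abs_mult)
    have "integrable N (\<lambda>x. (w \<bullet> (B *v f x))\<^sup>2)"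
      by (rule Bochner_Integration.integrable_bound[where f="\<lambda>x. (norm w * norm B)\<^sup>2 * (norm (f x))\<^sup>2"])
        (use f le measurable_compose[OF f(2) lin] in \<open>auto simp: square_integrable_def\<close>)
    then show ?thesis using measurable_compose[OF f(2) lin] by (simp add: square_integrable_def)
  qed
  have dom1: "square_integrable N (\<lambda>x. w \<bullet> f x)"
    if f: "square_integrable N (\<lambda>x. norm (f x))" "f \<in> borel_measurable N"
    for N :: "'z measure" and f and w :: "real^'n"
    using dom[OF f, of w "mat 1"] by simp
  have itov: "has_ito_integral M F W (\<lambda>t \<omega>. v \<bullet> (H *v X t \<omega>)) r
        (\<lambda>\<omega>. v \<bullet> X r \<omega> - v \<bullet> X 0 \<omega> - (LINT t:{0..r}|lborel. v \<bullet> (G *v X t \<omega>)))" if r: "0 \<le> r" for r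
  proof (rule has_ito_integral_cong_AE[OF has_ito_integral_inner[OF ito[OF r]]])
    show "norm v \<le> 1" using v by simp
    show "(\<lambda>\<omega>. v \<bullet> X r \<omega> - v \<bullet> X 0 \<omega> - (LINT t:{0..r}|lborel. v \<bullet> (G *v X t \<omega>))) \<in> borel_measurable M"
      using XM[OF r] XM[of 0] measurable_time_integral[OF Xlin[OF r]] by auto
    show "AE \<omega> in M. v \<bullet> (X r \<omega> - X 0 \<omega> - (LINT t:{0..r}|lborel. G *v X t \<omega>))
        = v \<bullet> X r \<omega> - v \<bullet> X 0 \<omega> - (LINT t:{0..r}|lborel. v \<bullet> (G *v X t \<omega>))"
      using cont
    proof eventually_elim
      case (elim \<omega>)
      have "continuous_on {0..r} (\<lambda>t. G *v X t \<omega>)"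
        by (intro mv.continuous_on continuous_on_const continuous_on_subset[OF elim]) auto
      from set_integral_inner(1)[OF borel_integrable_atLeastAtMost'[OF this], of v]
      show ?case by (simp add: inner_diff_right)
    qed
  qed
  have XFv: "(\<lambda>\<omega>. v \<bullet> X 0 \<omega>) \<in> borel_measurable (F 0)" using XF[of 0] by simp
  have GFv: "(\<lambda>\<omega>. v \<bullet> (G *v X r \<omega>)) \<in> borel_measurable (F r)" if "0 \<le> r" for r
    using measurable_compose[OF XF[OF that] lin] .
  have Yv: "(\<lambda>(t, \<omega>). v \<bullet> X t \<omega>) \<in> borel_measurable ?\<nu>" using Xlin[OF T, of v "mat 1"] by simp
  note sq0 = dom1[OF X0sq XM[OF order_refl], of v] and sqY = dom1[OF Xsq Xm', of v]
    and sqG = dom[OF Xsq Xm', of v G] and sqH = dom[OF Xsq Xm', of v H]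
  note en = energy_identity[where Y="\<lambda>t \<omega>. v \<bullet> X t \<omega>" and g="\<lambda>t \<omega>. v \<bullet> (G *v X t \<omega>)"
      and h="\<lambda>t \<omega>. v \<bullet> (H *v X t \<omega>)", OF T Yv Xlin XFv sq0 GFv sqY sqG itov]
  show "square_integrable M (\<lambda>\<omega>. v \<bullet> X T \<omega>)" by (rule en(1))
  have "expectation (\<lambda>\<omega>. (v \<bullet> X T \<omega>)\<^sup>2) = expectation (\<lambda>\<omega>. (v \<bullet> X 0 \<omega>)\<^sup>2)
      + (2 * (\<integral>x. (v \<bullet> X (fst x) (snd x)) * (v \<bullet> (G *v X (fst x) (snd x))) \<partial>?\<nu>)
         + (\<integral>x. (v \<bullet> (H *v X (fst x) (snd x)))\<^sup>2 \<partial>?\<nu>))"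
    by (rule en(2))
  also have "2 * (\<integral>x. (v \<bullet> X (fst x) (snd x)) * (v \<bullet> (G *v X (fst x) (snd x))) \<partial>?\<nu>)
         + (\<integral>x. (v \<bullet> (H *v X (fst x) (snd x)))\<^sup>2 \<partial>?\<nu>)
       = (\<integral>x. 2 * ((v \<bullet> X (fst x) (snd x)) * (v \<bullet> (G *v X (fst x) (snd x)))) + (v \<bullet> (H *v X (fst x) (snd x)))\<^sup>2 \<partial>?\<nu>)"
    using integrable_mult_square[OF sqY sqG] sqH by (simp add: square_integrable_def)
  finally show "expectation (\<lambda>\<omega>. (v \<bullet> X T \<omega>)\<^sup>2) = expectation (\<lambda>\<omega>. (v \<bullet> X 0 \<omega>)\<^sup>2)
      + (\<integral>x. 2 * ((v \<bullet> X (fst x) (snd x)) * (v \<bullet> (G *v X (fst x) (snd x)))) + (v \<bullet> (H *v X (fst x) (snd x)))\<^sup>2 \<partial>?\<nu>)" .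
qed

text \<open>A solution is only required to have a square-integrable initial state and a finite time
  integral of second moments. At a fixed time, integrability comes from the energy identity in the
  coordinate directions.\<close>

lemma sde_integrable:
  fixes G H :: "real^'n^'n" and X :: "real \<Rightarrow> 'w \<Rightarrow> real^'n"
  assumes sde: "linear_sde_solution M F W G H X" and T: "0 \<le> T"
  shows "integrable M (\<lambda>\<omega>. outer (X T \<omega>))"
    and "integrable (time_space T) (\<lambda>x. outer (X (fst x) (snd x)))"
proof -
  have prog: "progressively_measurable F X"
    and XT: "(\<integral>\<^sup>+\<omega>. (\<integral>\<^sup>+t\<in>{0..T}. ennreal ((norm (X t \<omega>))\<^sup>2) \<partial>lborel) \<partial>M) < \<infinity>"
    using sde T by (auto simp: linear_sde_solution_def)
  have m: "X T \<in> borel_measurable M"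
    by (rule measurable_M[OF T progressively_measurable_joint(2)[OF prog T]])
  show "integrable M (\<lambda>\<omega>. outer (X T \<omega>))"
  proof (rule integrable_outer[OF m])
    have "integrable M (\<lambda>\<omega>. (X T \<omega> $ i)\<^sup>2)" for i
      using sde_energy(1)[OF sde T, of "axis i 1"] by (simp add: square_integrable_def inner_axis')
    then have "integrable M (\<lambda>\<omega>. \<Sum>i\<in>UNIV. (X T \<omega> $ i)\<^sup>2)" by simp
    moreover have "(norm x)\<^sup>2 = (\<Sum>i\<in>UNIV. (x $ i)\<^sup>2)" for x :: "real^'n"
      by (simp only: power2_norm_eq_inner) (simp add: inner_vec_def power2_eq_square)
    ultimately show "integrable M (\<lambda>\<omega>. (norm (X T \<omega>))\<^sup>2)" by simp
  qed
  have Xm': "(\<lambda>x. X (fst x) (snd x)) \<in> borel_measurable (time_space T)"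
    using progressively_measurable_joint(1)[OF prog T] unfolding case_prod_beta' .
  have "(\<integral>\<^sup>+x. ennreal ((norm (X (fst x) (snd x)))\<^sup>2) \<partial>(time_space T)) < \<infinity>"
    using XT Xm' by (subst nn_integral_time[symmetric]) auto
  then show "integrable (time_space T) (\<lambda>x. outer (X (fst x) (snd x)))"
    using Xm' by (intro integrable_outer) (auto intro!: integrableI_bounded)
qed

lemma sde_second_moment:
  fixes G H :: "real^'n^'n" and X :: "real \<Rightarrow> 'w \<Rightarrow> real^'n"
  assumes sde: "linear_sde_solution M F W G H X" and t: "0 \<le> t"
  shows "A \<bullet> second_moment M (X t) = expectation (\<lambda>\<omega>. X t \<omega> \<bullet> (A *v X t \<omega>))"
    and "integrable M (\<lambda>\<omega>. X t \<omega> \<bullet> (A *v X t \<omega>))"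
  using sde_integrable(1)[OF sde t] by (simp_all add: second_moment_outer integral_outer_inner)

lemma sde_moment_integral:
  fixes G H :: "real^'n^'n" and X :: "real \<Rightarrow> 'w \<Rightarrow> real^'n"
  assumes sde: "linear_sde_solution M F W G H X" and T: "0 \<le> T"
  shows "set_integrable lborel {0..T} (\<lambda>t. second_moment M (X t))"
    and "(LINT t:{0..T}|lborel. second_moment M (X t)) = (\<integral>x. outer (X (fst x) (snd x)) \<partial>(time_space T))"
proof -
  interpret P: pair_sigma_finite "time_measure T" M by (rule pair_time)
  note i = sde_integrable(2)[OF sde T]
  have eq: "(\<integral>\<omega>. outer (X t \<omega>) \<partial>M) = second_moment M (X t)" if "t \<in> space (time_measure T)" for t
    using that by (intro second_moment_outer[symmetric] sde_integrable(1)[OF sde]) simp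
  have "integrable (time_measure T) (\<lambda>t. \<integral>\<omega>. outer (X t \<omega>) \<partial>M)"
    using P.integrable_fst'[OF i] by simp
  moreover have "integrable (time_measure T) (\<lambda>t. \<integral>\<omega>. outer (X t \<omega>) \<partial>M)
      \<longleftrightarrow> integrable (time_measure T) (\<lambda>t. second_moment M (X t))"
    by (intro Bochner_Integration.integrable_cong refl eq)
  ultimately have "integrable (time_measure T) (\<lambda>t. second_moment M (X t))" by simp
  then show "set_integrable lborel {0..T} (\<lambda>t. second_moment M (X t))"
    by (simp add: set_integrable_def integrable_restrict_space)
  have "(LINT t:{0..T}|lborel. second_moment M (X t)) = (\<integral>t. second_moment M (X t) \<partial>time_measure T)"
    by (simp add: set_lebesgue_integral_def integral_restrict_space)
  also have "\<dots> = (\<integral>t. (\<integral>\<omega>. outer (X t \<omega>) \<partial>M) \<partial>time_measure T)"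
    by (rule Bochner_Integration.integral_cong) (simp_all add: eq)
  also have "\<dots> = (\<integral>x. outer (X (fst x) (snd x)) \<partial>(time_space T))"
    using P.integral_fst'[OF i] by simp
  finally show "(LINT t:{0..T}|lborel. second_moment M (X t))
      = (\<integral>x. outer (X (fst x) (snd x)) \<partial>(time_space T))" .
qed

text \<open>Both sides are symmetric and are compared on unit vectors \<open>v\<close>: duality
  moves \<open>lyap\<close> onto \<open>outer v\<close>, which turns the form of
  \<open>lyap G H Y\<close> into the integral in \<open>sde_energy\<close>.\<close>

lemma sde_moment_flow:
  fixes G H :: "real^'n^'n" and X :: "real \<Rightarrow> 'w \<Rightarrow> real^'n"
  assumes sde: "linear_sde_solution M F W G H X"
  shows "moment_flow G H (\<lambda>t. second_moment M (X t))"
  unfolding moment_flow_def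
proof (intro conjI allI impI)
  show psd: "psd (second_moment M (X t))" if "0 \<le> t" for t
    by (rule psd_second_moment[OF sde_integrable(1)[OF sde that]])
  show "(\<lambda>t. indicator {0..} t *\<^sub>R second_moment M (X t)) \<in> borel_measurable lborel"
  proof (rule borel_measurable_LIMSEQ_metric)
    show "(\<lambda>t. indicator {0..real n} t *\<^sub>R second_moment M (X t)) \<in> borel_measurable lborel" for n
      using sde_moment_integral(1)[OF sde, of "real n"] by (auto simp: set_integrable_def)
    fix t :: real
    obtain N where N: "t \<le> real N" using real_arch_simple by blast
    have "indicator {0..real n} t *\<^sub>R second_moment M (X t) = indicator {0..} t *\<^sub>R second_moment M (X t)"
      if "N \<le> n" for n
      using N that by (auto simp: indicator_def)
    then show "(\<lambda>n. indicator {0..real n} t *\<^sub>R second_moment M (X t)) \<longlonglongrightarrow> indicator {0..} t *\<^sub>R second_moment M (X t)"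
      by (intro tendsto_eventually) (auto simp: eventually_sequentially)
  qed
  fix T :: real assume T: "0 \<le> T"
  show "set_integrable lborel {0..T} (\<lambda>t. second_moment M (X t))" by (rule sde_moment_integral(1)[OF sde T])
  define Y where "Y = (LINT t:{0..T}|lborel. second_moment M (X t))"
  have Y: "psd Y"
    unfolding Y_def by (rule psd_set_integral[OF sde_moment_integral(1)[OF sde T]]) (simp add: psd)
  have "lyap G H Y = second_moment M (X T) - second_moment M (X 0)"
  proof (rule symmetric_matrix_eqI)
    show "transpose (lyap G H Y) = lyap G H Y" by (rule lyap_sym[OF psd_sym[OF Y]])
    show "transpose (second_moment M (X T) - second_moment M (X 0)) = second_moment M (X T) - second_moment M (X 0)"
      by (simp add: transpose_diff psd_sym[OF psd] T)
    fix v :: "real^'n" assume v: "norm v = 1"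
    define N where "N = lyap (transpose G) (transpose H) (outer v)"
    have N: "x \<bullet> (N *v x) = 2 * ((v \<bullet> x) * (v \<bullet> (G *v x))) + (v \<bullet> (H *v x))\<^sup>2" for x
      unfolding N_def lyap_quad[OF transpose_outer]
      by (simp add: outer_mult_vec transpose_transpose power2_eq_square inner_commute)
    have q: "v \<bullet> (second_moment M (X t) *v v) = expectation (\<lambda>\<omega>. (v \<bullet> X t \<omega>)\<^sup>2)" if "0 \<le> t" for t
      by (simp add: inner_outer[symmetric] inner_commute[of "second_moment M (X t)"]
          sde_second_moment(1)[OF sde that] outer_mult_vec power2_eq_square inner_commute[of v])
    have "v \<bullet> (lyap G H Y *v v) = Y \<bullet> N"
      by (simp add: inner_outer[symmetric] lyap_adjoint N_def)
    also have "\<dots> = (\<integral>x. X (fst x) (snd x) \<bullet> (N *v X (fst x) (snd x)) \<partial>(time_space T))"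
      by (simp add: Y_def sde_moment_integral(2)[OF sde T] inner_commute[of _ N]
          integral_outer_inner(1)[OF sde_integrable(2)[OF sde T]])
    also have "\<dots> = v \<bullet> ((second_moment M (X T) - second_moment M (X 0)) *v v)"
      using sde_energy(2)[OF sde T v] by (simp add: N mv.diff_left inner_diff_right q T)
    finally show "v \<bullet> (lyap G H Y *v v) = v \<bullet> ((second_moment M (X T) - second_moment M (X 0)) *v v)" .
  qed
  then show "lyap G H (LINT t:{0..T}|lborel. second_moment M (X t)) = second_moment M (X T) - second_moment M (X 0)"
    by (simp add: Y_def)
qed

lemma sde_cost:
  fixes G H :: "real^'n^'n" and X :: "real \<Rightarrow> 'w \<Rightarrow> real^'n"
  assumes sde: "linear_sde_solution M F W G H X" and N: "\<And>x. 0 \<le> x \<bullet> (N *v x)"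
  shows "(\<integral>\<^sup>+\<omega>. (\<integral>\<^sup>+t\<in>{0..}. ennreal (X t \<omega> \<bullet> (N *v X t \<omega>)) \<partial>lborel) \<partial>M)
    = (\<integral>\<^sup>+t\<in>{0..}. ennreal (N \<bullet> second_moment M (X t)) \<partial>lborel)"
proof -
  interpret P: pair_sigma_finite lborel M by unfold_locales
  have prog: "progressively_measurable F X" using sde by (simp add: linear_sde_solution_def)
  let ?X = "\<lambda>x. indicator {0..} (fst x) *\<^sub>R X (fst x) (snd x)"
  have m: "?X \<in> borel_measurable (lborel \<Otimes>\<^sub>M M)"
  proof (rule borel_measurable_LIMSEQ_metric)
    fix n
    \<comment> \<open>Progressive measurability concerns bounded intervals; clamping time to
      \<open>[0,n]\<close> extends it to the line, and the indicator removes the clamped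
      part.\<close>
    let ?c = "\<lambda>t. max 0 (min (real n) t)"
    have "?c \<in> lborel \<rightarrow>\<^sub>M time_measure n"
      by (rule measurable_restrict_space2) auto
    then have "(\<lambda>x. (?c (fst x), snd x)) \<in> (lborel \<Otimes>\<^sub>M M) \<rightarrow>\<^sub>M (time_space n)"
      by (intro measurable_Pair measurable_compose[OF measurable_fst] measurable_snd)
    from measurable_compose[OF this progressively_measurable_joint(1)[OF prog]]
    have "(\<lambda>x. X (?c (fst x)) (snd x)) \<in> borel_measurable (lborel \<Otimes>\<^sub>M M)" by simp
    moreover have "(\<lambda>x. indicator {0..real n} (fst x) :: real) \<in> borel_measurable (lborel \<Otimes>\<^sub>M M)"
      by (rule measurable_compose[OF measurable_fst]) simp
    ultimately have "(\<lambda>x. indicator {0..real n} (fst x) *\<^sub>R X (?c (fst x)) (snd x)) \<in> borel_measurable (lborel \<Otimes>\<^sub>M M)"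
      by simp
    also have "(\<lambda>x. indicator {0..real n} (fst x) *\<^sub>R X (?c (fst x)) (snd x))
        = (\<lambda>x. indicator {0..real n} (fst x) *\<^sub>R X (fst x) (snd x))"
      by (auto simp: indicator_def fun_eq_iff)
    finally show "(\<lambda>x. indicator {0..real n} (fst x) *\<^sub>R X (fst x) (snd x)) \<in> borel_measurable (lborel \<Otimes>\<^sub>M M)" .
  next
    fix x :: "real \<times> 'w"
    obtain k where k: "fst x \<le> real k" using real_arch_simple by blast
    have "indicator {0..real n} (fst x) *\<^sub>R X (fst x) (snd x) = ?X x" if "k \<le> n" for n
      using k that by (auto simp: indicator_def)
    then show "(\<lambda>n. indicator {0..real n} (fst x) *\<^sub>R X (fst x) (snd x)) \<longlonglongrightarrow> ?X x"
      by (intro tendsto_eventually) (auto simp: eventually_sequentially)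
  qed
  have "(\<lambda>x. x \<bullet> (N *v x)) \<in> borel_measurable borel"
    by (intro borel_measurable_continuous_onI continuous_intros mv.continuous_on)
  from measurable_compose[OF m this]
  have mq: "(\<lambda>x. ennreal (?X x \<bullet> (N *v ?X x))) \<in> borel_measurable (lborel \<Otimes>\<^sub>M M)" by simp
  have "(\<integral>\<^sup>+\<omega>. (\<integral>\<^sup>+t\<in>{0..}. ennreal (X t \<omega> \<bullet> (N *v X t \<omega>)) \<partial>lborel) \<partial>M)
      = (\<integral>\<^sup>+\<omega>. (\<integral>\<^sup>+t. ennreal (?X (t, \<omega>) \<bullet> (N *v ?X (t, \<omega>))) \<partial>lborel) \<partial>M)"
    by (intro nn_integral_cong) (auto simp: indicator_def)
  also have "\<dots> = (\<integral>\<^sup>+t. (\<integral>\<^sup>+\<omega>. ennreal (?X (t, \<omega>) \<bullet> (N *v ?X (t, \<omega>))) \<partial>M) \<partial>lborel)"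
    using P.nn_integral_snd[OF mq] nn_integral_fst[OF mq] by simp
  also have "\<dots> = (\<integral>\<^sup>+t\<in>{0..}. ennreal (N \<bullet> second_moment M (X t)) \<partial>lborel)"
  proof (rule nn_integral_cong)
    fix t :: real
    show "(\<integral>\<^sup>+\<omega>. ennreal (?X (t, \<omega>) \<bullet> (N *v ?X (t, \<omega>))) \<partial>M) = ennreal (N \<bullet> second_moment M (X t)) * indicator {0..} t"
    proof (cases "0 \<le> t")
      case True
      then show ?thesis
        using sde_second_moment[OF sde True, of N] N by (simp add: nn_integral_eq_integral)
    qed simp
  qed
  finally show ?thesis .
qed

end

section \<open>The linear-quadratic problem\<close>

text \<open>Permits exchanging a symmetric matrix for a nonsymmetric one with the same form, as in
  \<open>cost_difference\<close>.\<close>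

lemma psd_inner_cong:
  assumes "psd Y" "\<And>x. x \<bullet> (N *v x) = x \<bullet> (N' *v x)"
  shows "N \<bullet> Y = N' \<bullet> Y"
  using psd_inner_mono[OF assms(1), of N N'] psd_inner_mono[OF assms(1), of N' N] assms(2)
  by (simp add: order_antisym)

lemma GDERIV_factor:
  fixes f :: "'a::real_inner \<Rightarrow> real"
  assumes eq: "\<forall>\<^sub>F y in at x. f y - f x = (y - x) \<bullet> \<Phi> y" and lim: "(\<Phi> \<longlongrightarrow> G) (at x)"
  shows "GDERIV f x :> G"
  unfolding gderiv_def has_derivative_iff_norm
proof
  show "bounded_linear (\<lambda>h. h \<bullet> G)" by (rule bounded_linear_inner_left)
  have "((\<lambda>y. norm (\<Phi> y - G)) \<longlongrightarrow> 0) (at x)"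
    using lim by (simp add: tendsto_norm_zero LIM_zero)
  then show "((\<lambda>y. norm (f y - f x - (y - x) \<bullet> G) / norm (y - x)) \<longlongrightarrow> 0) (at x)"
  proof (rule Lim_null_comparison[rotated])
    show "\<forall>\<^sub>F y in at x. norm (norm (f y - f x - (y - x) \<bullet> G) / norm (y - x)) \<le> norm (\<Phi> y - G)"
      using eq eventually_neq_at_within[of x x UNIV]
    proof eventually_elim
      case (elim y)
      have "norm (f y - f x - (y - x) \<bullet> G) = \<bar>(y - x) \<bullet> (\<Phi> y - G)\<bar>"
        using elim(1) by (simp add: inner_diff_right)
      also have "\<dots> \<le> norm (y - x) * norm (\<Phi> y - G)" by (rule Cauchy_Schwarz_ineq2)
      finally show ?case using elim(2) by (simp add: field_simps)
    qed
  qed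
qed

lemma spectral_norm_le: "norm (A *v x) \<le> spectral_norm A * norm x"
  unfolding spectral_norm_def by (rule onorm) (rule mv.bounded_linear_right)

lemma spectral_norm_nonneg: "0 \<le> spectral_norm A"
  unfolding spectral_norm_def by (rule onorm_pos_le) (rule mv.bounded_linear_right)

text \<open>The deterministic core. Every feedback \<open>L\<close>, stabilizing or not, has a
  moment flow starting at \<open>\<Sigma>0\<close>, so finiteness of the cost is always derived and
  never built in.\<close>

locale lq_problem =
  fixes A C Q :: "real^'n^'n" and B D :: "real^'m^'n" and R :: "real^'m^'m"
    and \<Sigma>0 :: "real^'n^'n" and S :: "real^'n^'m \<Rightarrow> real \<Rightarrow> real^'n^'n"
  assumes Q: "positive_definite Q" and R: "positive_definite R" and \<Sigma>0: "positive_definite \<Sigma>0"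
    and flow: "moment_flow (A + B ** L) (C + D ** L) (S L)"
    and init: "S L 0 = \<Sigma>0"
begin

definition drift :: "real^'n^'m \<Rightarrow> real^'n^'n" where "drift L = A + B ** L"
definition diffusion :: "real^'n^'m \<Rightarrow> real^'n^'n" where "diffusion L = C + D ** L"
definition weight :: "real^'n^'m \<Rightarrow> real^'n^'n" where "weight L = Q + transpose L ** R ** L"
abbreviation dual :: "real^'n^'m \<Rightarrow> real^'n^'n \<Rightarrow> real^'n^'n" where
  "dual L P \<equiv> lyap (transpose (drift L)) (transpose (diffusion L)) P"

lemma flow_drift: "moment_flow (drift L) (diffusion L) (S L)"
  unfolding drift_def diffusion_def by (rule flow)

definition cost :: "real^'n^'m \<Rightarrow> ennreal" where
  "cost L = (\<integral>\<^sup>+t\<in>{0..}. ennreal (weight L \<bullet> S L t) \<partial>lborel)"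

text \<open>A relation, since such a \<open>Y\<close> exists only when the cost of \<open>L\<close>
  is finite. It is the integral of the second moments over all time.\<close>

definition total_moment :: "real^'n^'m \<Rightarrow> real^'n^'n \<Rightarrow> bool" where
  "total_moment L Y \<longleftrightarrow> psd Y \<and> lyap (drift L) (diffusion L) Y = - \<Sigma>0 \<and>
     cost L = ennreal (weight L \<bullet> Y) \<and>
     total_trace (S L) = ennreal (trace Y)"

lemma weight_quad: "x \<bullet> (weight L *v x) = x \<bullet> (Q *v x) + (L *v x) \<bullet> (R *v (L *v x))"
  by (simp add: weight_def mv.add_left inner_add_right matrix_vector_mul_assoc[symmetric] inner_mv_transpose)

lemma Q_ge: "min_eigenvalue Q * (x \<bullet> x) \<le> x \<bullet> (Q *v x)"
  using Q min_eigenvalue_le(1) by (auto simp: positive_definite_def)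

lemma R_ge: "min_eigenvalue R * (x \<bullet> x) \<le> x \<bullet> (R *v x)"
  using R min_eigenvalue_le(1) by (auto simp: positive_definite_def)

lemma weight_ge: "min_eigenvalue Q * (x \<bullet> x) \<le> x \<bullet> (weight L *v x)"
  unfolding weight_quad using Q_ge[of x] psd_nonneg[OF positive_definite_psd[OF R], of "L *v x"] by linarith

lemma weight_nonneg: "0 \<le> x \<bullet> (weight L *v x)"
  unfolding weight_quad
  using psd_nonneg[OF positive_definite_psd[OF R]] psd_nonneg[OF positive_definite_psd[OF Q]] by simp

lemma weight_sym: "transpose (weight L) = weight L"
  using Q R by (simp add: weight_def positive_definite_def transpose_add matrix_transpose_mul transpose_transpose
      matrix_mul_assoc)

lemma psd_flow: "0 \<le> t \<Longrightarrow> psd (S L t)"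
  using flow_drift by (simp add: moment_flow_def)

lemma total_momentI:
  assumes "total_trace (S L) < \<infinity>"
  shows "\<exists>Y. total_moment L Y"
proof -
  obtain Y where Y: "psd Y" "lyap (drift L) (diffusion L) Y = - S L 0"
    "\<forall>N. (\<forall>x. 0 \<le> x \<bullet> (N *v x)) \<longrightarrow> (\<integral>\<^sup>+t\<in>{0..}. ennreal (N \<bullet> S L t) \<partial>lborel) = ennreal (N \<bullet> Y)"
    by (rule flow_total[OF flow_drift assms], rule that)
  have "total_moment L Y"
    unfolding total_moment_def cost_def
    using Y(1,2) Y(3)[rule_format, of "weight L"] Y(3)[rule_format, of "mat 1"] weight_nonneg
    by (simp add: init inner_mat1)
  then show ?thesis ..
qed

text \<open>The weight dominates \<open>min_eigenvalue Q\<close> times the identity, so finite cost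
  bounds the total trace; stability is then a consequence.\<close>

lemma total_moment_finite:
  assumes fin: "cost L < \<infinity>"
  shows "\<exists>Y. total_moment L Y"
proof (rule total_momentI)
  let ?q = "min_eigenvalue Q"
  have q: "?q > 0" by (rule min_eigenvalue_pos[OF Q])
  have "(\<lambda>t. indicator {0..} t *\<^sub>R S L t) \<in> borel_measurable lborel"
    using flow_drift by (simp add: moment_flow_def)
  then have "(\<lambda>t. ennreal (weight L \<bullet> (indicator {0..} t *\<^sub>R S L t))) \<in> borel_measurable lborel" by measurable
  also have "(\<lambda>t. ennreal (weight L \<bullet> (indicator {0..} t *\<^sub>R S L t)))
      = (\<lambda>t. ennreal (weight L \<bullet> S L t) * indicator {0..} t)"
    by (auto simp: indicator_def)
  finally have m: "(\<lambda>t. ennreal (weight L \<bullet> S L t) * indicator {0..} t) \<in> borel_measurable lborel" .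
  have "total_trace (S L)
      \<le> (\<integral>\<^sup>+t. ennreal (1 / ?q) * (ennreal (weight L \<bullet> S L t) * indicator {0..} t) \<partial>lborel)"
  proof (rule nn_integral_mono)
    fix t :: real
    show "ennreal (trace (S L t)) * indicator {0..} t \<le> ennreal (1 / ?q) * (ennreal (weight L \<bullet> S L t) * indicator {0..} t)"
    proof (cases "0 \<le> t")
      case True
      have "?q * trace (S L t) \<le> weight L \<bullet> S L t"
        by (rule psd_inner_ge_trace[OF psd_flow[OF True] weight_ge])
      then have "trace (S L t) \<le> 1 / ?q * (weight L \<bullet> S L t)" using q by (simp add: field_simps)
      moreover have "0 \<le> weight L \<bullet> S L t"
        by (rule psd_inner_nonneg[OF psd_flow[OF True] weight_nonneg])
      ultimately show ?thesis using True q by (simp add: ennreal_mult[symmetric] ennreal_leI)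
    qed simp
  qed
  also have "\<dots> = ennreal (1 / ?q) * cost L"
    unfolding cost_def by (rule nn_integral_cmult[OF m])
  also have "\<dots> < \<infinity>" using fin by (simp add: ennreal_mult_less_top)
  finally show "total_trace (S L) < \<infinity>" .
qed

text \<open>Since \<open>\<Sigma>0\<close> is positive definite, \<open>lyap Y = - \<Sigma>0\<close>
  makes \<open>Y\<close> a strict certificate.\<close>

lemma total_moment_stable: "total_moment L Y \<Longrightarrow> stable_pair (drift L) (diffusion L)"
  using \<Sigma>0 unfolding stable_pair_def total_moment_def positive_definite_def
  by (intro exI[of _ Y]) (simp add: mv.minus_left)

lemma cost_decay_finite:
  assumes "((\<lambda>t. trace (S L t)) \<longlongrightarrow> 0) at_top"
  shows "cost L < \<infinity>"
proof -
  have "stable_pair (drift L) (diffusion L)"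
    by (rule flow_decay_stable[OF flow_drift _ assms]) (simp add: init \<Sigma>0)
  then obtain Y where "total_moment L Y"
    using total_momentI stable_flow_finite[OF flow_drift] by blast
  then show ?thesis by (simp add: total_moment_def)
qed

lemma cost_total: 
  assumes "total_moment L Y" shows "enn2real (cost L) = weight L \<bullet> Y"
  using assms psd_inner_nonneg[OF _ weight_nonneg, of Y L] by (simp add: total_moment_def)

definition grad_factor :: "real^'n^'m \<Rightarrow> real^'n^'n \<Rightarrow> real^'n^'m" where
  "grad_factor K P = R ** K + transpose B ** P + transpose D ** P ** diffusion K"

definition curvature :: "real^'n^'n \<Rightarrow> real^'m^'m" where
  "curvature P = R + transpose D ** P ** D"

text \<open>For fixed \<open>P\<close> the left side is a quadratic function of the control
  \<open>L *v x\<close>. It vanishes at the control \<open>K *v x\<close> by the equation for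
  \<open>P\<close>; what remains are the linear and quadratic parts in the deviation
  \<open>(L - K) *v x\<close>.\<close>

lemma dual_difference:
  assumes P: "transpose P = P" "dual K P = - weight K"
  shows "x \<bullet> ((weight L + dual L P) *v x)
    = 2 * (((L - K) *v x) \<bullet> (grad_factor K P *v x)) + ((L - K) *v x) \<bullet> (curvature P *v ((L - K) *v x))"
proof -
  define d where "d = (L - K) *v x"
  have L: "L *v x = K *v x + d" by (simp add: d_def mv.diff_left)
  have quad: "x \<bullet> (dual L P *v x) = 2 * ((A *v x + B *v (L *v x)) \<bullet> (P *v x))
      + (C *v x + D *v (L *v x)) \<bullet> (P *v (C *v x + D *v (L *v x)))" for L
    by (simp add: lyap_quad[OF P(1)] transpose_transpose drift_def diffusion_def mv.add_left matrix_vector_mul_assoc)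
  have "x \<bullet> (dual K P *v x) = - (x \<bullet> (weight K *v x))" by (simp add: P(2) mv.minus_left)
  then have K: "x \<bullet> (Q *v x) + (K *v x) \<bullet> (R *v (K *v x))
      + (2 * ((A *v x + B *v (K *v x)) \<bullet> (P *v x))
      + (C *v x + D *v (K *v x)) \<bullet> (P *v (C *v x + D *v (K *v x)))) = 0"
    unfolding quad weight_quad by linarith
  have E: "d \<bullet> (grad_factor K P *v x)
      = d \<bullet> (R *v (K *v x)) + (B *v d) \<bullet> (P *v x) + (D *v d) \<bullet> (P *v (C *v x + D *v (K *v x)))"
    by (simp add: grad_factor_def diffusion_def mv.add_left inner_add_right inner_mv_transpose
        matrix_vector_mul_assoc[symmetric] mv.add_right)
  have Rp: "d \<bullet> (curvature P *v d) = d \<bullet> (R *v d) + (D *v d) \<bullet> (P *v (D *v d))"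
    by (simp add: curvature_def mv.add_left inner_add_right inner_mv_transpose matrix_vector_mul_assoc[symmetric])
  define y where "y = C *v x + D *v (K *v x)"
  \<comment> \<open>After the expansion the claim is linear in nine real numbers; the premise is the
    equation for \<open>P\<close> at \<open>x\<close>.\<close>
  have aux: "s + k + (2 * u + p) = 0 \<Longrightarrow>
      s + (k + 2 * m + n) + (2 * (u + w) + (p + 2 * m' + n')) = 2 * (m + w + m') + (n + n')"
    for s k u p m n w m' n' :: real by simp
  have "x \<bullet> ((weight L + dual L P) *v x) = x \<bullet> (weight L *v x) + x \<bullet> (dual L P *v x)"
    by (simp add: mv.add_left inner_add_right)
  also have "\<dots> = x \<bullet> (Q *v x) + (K *v x + d) \<bullet> (R *v (K *v x + d))
      + (2 * ((A *v x + B *v (K *v x) + B *v d) \<bullet> (P *v x)) + (y + D *v d) \<bullet> (P *v (y + D *v d)))"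
    unfolding quad weight_quad L by (simp add: mv.add_right y_def add.assoc)
  also have "(K *v x + d) \<bullet> (R *v (K *v x + d))
      = (K *v x) \<bullet> (R *v (K *v x)) + 2 * (d \<bullet> (R *v (K *v x))) + d \<bullet> (R *v d)"
    using symmetric_inner_swap[of R "K *v x" d] R
    by (simp add: positive_definite_def mv.add_right inner_add_left inner_add_right)
  also have "(A *v x + B *v (K *v x) + B *v d) \<bullet> (P *v x) = (A *v x + B *v (K *v x)) \<bullet> (P *v x) + (B *v d) \<bullet> (P *v x)"
    by (rule inner_add_left)
  also have "(y + D *v d) \<bullet> (P *v (y + D *v d)) = y \<bullet> (P *v y) + 2 * ((D *v d) \<bullet> (P *v y)) + (D *v d) \<bullet> (P *v (D *v d))"
    using symmetric_inner_swap[OF P(1), of y "D *v d"] by (simp add: mv.add_right inner_add_left inner_add_right)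
  also have "x \<bullet> (Q *v x) + ((K *v x) \<bullet> (R *v (K *v x)) + 2 * (d \<bullet> (R *v (K *v x))) + d \<bullet> (R *v d))
      + (2 * ((A *v x + B *v (K *v x)) \<bullet> (P *v x) + (B *v d) \<bullet> (P *v x))
        + (y \<bullet> (P *v y) + 2 * ((D *v d) \<bullet> (P *v y)) + (D *v d) \<bullet> (P *v (D *v d))))
      = 2 * (d \<bullet> (grad_factor K P *v x)) + d \<bullet> (curvature P *v d)"
    unfolding E Rp y_def[symmetric] by (rule aux) (use K in \<open>unfold y_def\<close>)
  finally show ?thesis by (simp add: d_def)
qed

text \<open>Duality with \<open>lyap Y = - \<Sigma>0\<close> rewrites
  \<open>P \<bullet> \<Sigma>0\<close>, and \<open>dual_difference\<close> factors the result. Here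
  \<open>P \<bullet> \<Sigma>0\<close> stands in for the cost of \<open>K\<close>;
  \<open>dual_solution\<close> identifies the two by taking \<open>L = K\<close>.\<close>

lemma cost_difference:
  assumes P: "transpose P = P" "dual K P = - weight K" and Y: "total_moment L Y"
  shows "enn2real (cost L) - P \<bullet> \<Sigma>0 = (weight L + dual L P) \<bullet> Y"
    and "enn2real (cost L) - P \<bullet> \<Sigma>0
      = (L - K) \<bullet> (2 *\<^sub>R (grad_factor K P ** Y) + curvature P ** (L - K) ** Y)"
proof -
  have psd: "psd Y" and eq: "lyap (drift L) (diffusion L) Y = - \<Sigma>0" using Y by (auto simp: total_moment_def)
  have "P \<bullet> \<Sigma>0 = - (dual L P \<bullet> Y)"
    using lyap_adjoint[of "drift L" "diffusion L" Y P] by (simp add: eq inner_commute)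
  then show 1: "enn2real (cost L) - P \<bullet> \<Sigma>0 = (weight L + dual L P) \<bullet> Y"
    by (simp add: cost_total[OF Y] inner_add_left)
  let ?d = "L - K" and ?E = "grad_factor K P"
  have "(weight L + dual L P) \<bullet> Y = (2 *\<^sub>R (transpose ?d ** ?E) + transpose ?d ** (curvature P ** ?d)) \<bullet> Y"
  proof (rule psd_inner_cong[OF psd])
    fix x
    have "x \<bullet> ((2 *\<^sub>R (transpose ?d ** ?E) + transpose ?d ** (curvature P ** ?d)) *v x)
        = 2 * ((?d *v x) \<bullet> (?E *v x)) + (?d *v x) \<bullet> (curvature P *v (?d *v x))"
      by (simp add: mv.add_left mv.scaleR_left inner_add_right matrix_vector_mul_assoc[symmetric]
          inner_mv_transpose[symmetric])
    then show "x \<bullet> ((weight L + dual L P) *v x)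
        = x \<bullet> ((2 *\<^sub>R (transpose ?d ** ?E) + transpose ?d ** (curvature P ** ?d)) *v x)"
      by (simp only: dual_difference[OF P])
  qed
  also have "\<dots> = 2 * (?E \<bullet> (?d ** Y)) + (curvature P ** ?d) \<bullet> (?d ** Y)"
    by (simp add: inner_add_left inner_matrix_mult_left[of "transpose ?d"] transpose_transpose)
  also have "\<dots> = 2 * (?d \<bullet> (?E ** Y)) + ?d \<bullet> (curvature P ** ?d ** Y)"
    using inner_matrix_mult_right[of ?d Y] by (simp add: psd_sym[OF psd] inner_commute[of _ "?d ** Y"])
  finally show "enn2real (cost L) - P \<bullet> \<Sigma>0 = ?d \<bullet> (2 *\<^sub>R (?E ** Y) + curvature P ** ?d ** Y)"
    by (simp add: 1 inner_add_right)
qed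

lemma dual_solution:
  assumes Y: "total_moment K Y"
  obtains P where "psd P" "dual K P = - weight K" "enn2real (cost K) = P \<bullet> \<Sigma>0"
proof -
  have st: "stable_pair (drift K) (diffusion K)" by (rule total_moment_stable[OF Y])
  obtain P where P: "transpose P = P" "dual K P = - weight K"
    by (rule stable_dual_solve[OF st weight_sym], rule that)
  have "psd P" by (rule stable_dual_psd[OF st weight_nonneg P])
  moreover have "enn2real (cost K) = P \<bullet> \<Sigma>0" using cost_difference(1)[OF P Y] by (simp add: P(2))
  ultimately show ?thesis using that P(2) by blast
qed

section \<open>Dependence on the feedback and the gradient\<close>

lemma tendsto_dual: "((\<lambda>L. dual L P) \<longlongrightarrow> dual K P) (at K)"
  unfolding lyap_def transpose_transpose drift_def diffusion_def
  by (intro tendsto_add mm.tendsto tendsto_const tendsto_ident_at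
      bounded_linear.tendsto[OF linear_conv_bounded_linear[THEN iffD1, OF linear_transpose]])

text \<open>Weak continuity of \<open>Y\<close>: a test matrix \<open>N = - dual K P\<close> pairs with \<open>Y L\<close> to
  \<open>P \<bullet> \<Sigma>0\<close> up to the error \<open>(dual L P - dual K P) \<bullet> Y L\<close>.\<close>

lemma tendsto_total_moment:
  assumes YK: "total_moment K YK" and Y: "\<forall>\<^sub>F L in at K. total_moment L (Y L) \<and> trace (Y L) \<le> b"
  shows "(Y \<longlongrightarrow> YK) (at K)"
proof -
  have st: "stable_pair (drift K) (diffusion K)" by (rule total_moment_stable[OF YK])
  have psdK: "psd YK" using YK by (simp add: total_moment_def)
  have weak: "((\<lambda>L. Y L \<bullet> N) \<longlongrightarrow> YK \<bullet> N) (at K)" for N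
  proof -
    obtain P where P: "transpose P = P" "dual K P = - sym_part N"
      by (rule stable_dual_solve[OF st transpose_sym_part], rule that)
    have pair: "Z \<bullet> N = P \<bullet> \<Sigma>0 + (dual L P - dual K P) \<bullet> Z" if Z: "total_moment L Z" for L Z
    proof -
      have psd: "psd Z" and eq: "lyap (drift L) (diffusion L) Z = - \<Sigma>0" using Z by (auto simp: total_moment_def)
      have "Z \<bullet> N = Z \<bullet> sym_part N" using inner_sym_part[OF psd_sym[OF psd]] by simp
      also have "\<dots> = - (Z \<bullet> dual K P)" by (simp add: P(2))
      also have "\<dots> = (dual L P - dual K P) \<bullet> Z - Z \<bullet> dual L P"
        by (simp add: inner_commute[of _ Z] inner_diff_right)
      also have "Z \<bullet> dual L P = - (P \<bullet> \<Sigma>0)"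
        by (simp add: lyap_adjoint[symmetric] eq inner_commute)
      finally show ?thesis by simp
    qed
    have "((\<lambda>L. norm (dual L P - dual K P) * b) \<longlongrightarrow> norm (dual K P - dual K P) * b) (at K)"
      by (intro tendsto_intros tendsto_dual)
    then have "((\<lambda>L. norm (dual L P - dual K P) * b) \<longlongrightarrow> 0) (at K)" by simp
    then have "((\<lambda>L. Y L \<bullet> N - YK \<bullet> N) \<longlongrightarrow> 0) (at K)"
    proof (rule Lim_null_comparison[rotated])
      show "\<forall>\<^sub>F L in at K. norm (Y L \<bullet> N - YK \<bullet> N) \<le> norm (dual L P - dual K P) * b"
        using Y
      proof eventually_elim
        case (elim L)
        have "norm (Y L) \<le> b" using elim psd_norm_le_trace[of "Y L"] by (simp add: total_moment_def)
        have "Y L \<bullet> N - YK \<bullet> N = (dual L P - dual K P) \<bullet> Y L"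
          using pair[of L "Y L"] pair[OF YK] elim by simp
        then have "norm (Y L \<bullet> N - YK \<bullet> N) \<le> norm (dual L P - dual K P) * norm (Y L)"
          using Cauchy_Schwarz_ineq2 by simp
        also have "\<dots> \<le> norm (dual L P - dual K P) * b"
          using \<open>norm (Y L) \<le> b\<close> by (intro mult_left_mono) auto
        finally show ?case .
      qed
    qed
    then show ?thesis by (rule LIM_zero_cancel)
  qed
  \<comment> \<open>In finite dimension, convergence of all pairings with basis elements is
    convergence.\<close>
  have "((\<lambda>L. \<Sum>i\<in>Basis. (Y L \<bullet> i) *\<^sub>R i) \<longlongrightarrow> (\<Sum>i\<in>Basis. (YK \<bullet> i) *\<^sub>R i)) (at K)"
    by (intro tendsto_sum tendsto_scaleR weak tendsto_const)
  then show ?thesis by (simp add: euclidean_representation)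
qed

text \<open>The solution \<open>P\<close> for \<open>K\<close> remains a strict Lyapunov function
  for every nearby \<open>L\<close>, so finiteness of the cost is an open condition and the traces
  share one bound.\<close>

lemma eventually_total_moment:
  assumes YK: "total_moment K YK"
  obtains b where "\<forall>\<^sub>F L in at K. \<exists>Y. total_moment L Y \<and> trace Y \<le> b"
proof -
  obtain P where P: "psd P" "dual K P = - weight K" by (rule dual_solution[OF YK])
  \<comment> \<open>Half of the decay rate that \<open>Q\<close> guarantees at \<open>K\<close>: the
    perturbation of the dual operator may use up one half and leaves the other.\<close>
  define \<epsilon> where "\<epsilon> = min_eigenvalue Q / 2"
  have \<epsilon>: "\<epsilon> > 0" using min_eigenvalue_pos[OF Q] by (simp add: \<epsilon>_def)
  have "\<forall>\<^sub>F L in at K. dist (dual L P) (dual K P) < \<epsilon>"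
    by (rule tendstoD[OF tendsto_dual \<epsilon>])
  then have "\<forall>\<^sub>F L in at K. \<exists>Y. total_moment L Y \<and> trace Y \<le> P \<bullet> \<Sigma>0 / \<epsilon>"
  proof eventually_elim
    case (elim L)
    have neg: "x \<bullet> (dual L P *v x) \<le> - \<epsilon> * (x \<bullet> x)" for x
    proof -
      have "x \<bullet> ((dual L P - dual K P) *v x) \<le> norm (dual L P - dual K P) * (x \<bullet> x)" by (rule quad_le_norm)
      also have "\<dots> \<le> \<epsilon> * (x \<bullet> x)" using elim by (intro mult_right_mono) (auto simp: dist_norm)
      finally have "x \<bullet> (dual L P *v x) \<le> \<epsilon> * (x \<bullet> x) - x \<bullet> (weight K *v x)"
        by (simp add: P(2) mv.add_left mv.minus_left inner_add_right)
      also have "\<dots> \<le> \<epsilon> * (x \<bullet> x) - 2 * \<epsilon> * (x \<bullet> x)" using weight_ge[of x K] by (simp add: \<epsilon>_def)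
      finally show ?thesis by simp
    qed
    have le: "total_trace (S L) \<le> ennreal (P \<bullet> \<Sigma>0 / \<epsilon>)"
      using flow_bound[OF flow_drift P(1) \<epsilon> neg] by (simp add: init)
    then have "total_trace (S L) < \<infinity>" by (rule le_less_trans) simp
    then obtain Y where Y: "total_moment L Y" using total_momentI by blast
    then have "ennreal (trace Y) \<le> ennreal (P \<bullet> \<Sigma>0 / \<epsilon>)" using le by (simp add: total_moment_def)
    moreover have "0 \<le> P \<bullet> \<Sigma>0 / \<epsilon>"
      using psd_inner_nonneg[OF positive_definite_psd[OF \<Sigma>0] psd_nonneg[OF P(1)]] \<epsilon> by simp
    ultimately show ?case using Y by (auto simp: ennreal_le_iff)
  qed
  then show ?thesis by (rule that)
qed

text \<open>\<open>enn2real\<close> sends an infinite cost to 0, but all costs near \<open>K\<close>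
  are finite by \<open>eventually_total_moment\<close>, so this default value does not affect the
  derivative.\<close>

theorem cost_gradient:
  assumes YK: "total_moment K YK" and P: "psd P" "dual K P = - weight K" "enn2real (cost K) = P \<bullet> \<Sigma>0"
  shows "GDERIV (\<lambda>L. enn2real (cost L)) K :> 2 *\<^sub>R (grad_factor K P ** YK)"
proof -
  obtain b where b: "\<forall>\<^sub>F L in at K. \<exists>Y. total_moment L Y \<and> trace Y \<le> b"
    by (rule eventually_total_moment[OF YK])
  define Y where "Y L = (SOME Y. total_moment L Y \<and> trace Y \<le> b)" for L
  have Y: "\<forall>\<^sub>F L in at K. total_moment L (Y L) \<and> trace (Y L) \<le> b"
    using b unfolding Y_def by (rule eventually_mono) (rule someI_ex)
  have lim: "(Y \<longlongrightarrow> YK) (at K)" by (rule tendsto_total_moment[OF YK Y])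
  show ?thesis
  proof (rule GDERIV_factor)
    show "\<forall>\<^sub>F L in at K. enn2real (cost L) - enn2real (cost K)
        = (L - K) \<bullet> (2 *\<^sub>R (grad_factor K P ** Y L) + curvature P ** (L - K) ** Y L)"
      using Y by eventually_elim (simp add: P(3) cost_difference(2)[OF psd_sym[OF P(1)] P(2)])
    have "((\<lambda>L. 2 *\<^sub>R (grad_factor K P ** Y L) + curvature P ** (L - K) ** Y L)
        \<longlongrightarrow> 2 *\<^sub>R (grad_factor K P ** YK) + curvature P ** (K - K) ** YK) (at K)"
      by (intro tendsto_add tendsto_scaleR tendsto_const tendsto_diff mm.tendsto lim tendsto_ident_at)
    then show "((\<lambda>L. 2 *\<^sub>R (grad_factor K P ** Y L) + curvature P ** (L - K) ** Y L)
        \<longlongrightarrow> 2 *\<^sub>R (grad_factor K P ** YK)) (at K)" by simp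
  qed
qed

section \<open>Gradient domination\<close>

text \<open>Dropping the contribution of \<open>D\<close> to the curvature leaves
  \<open>r * (z \<bullet> z) + 2 * (z \<bullet> e)\<close> with \<open>z = (L - K) *v x\<close> and
  \<open>e = grad_factor K P *v x\<close>, whose minimum over \<open>z\<close> is
  \<open>- (e \<bullet> e) / r\<close>. The pairing is with the moments of \<open>L\<close>, so the
  trace belongs to \<open>L\<close> and not to \<open>K\<close>.\<close>

lemma cost_gap:
  assumes P: "psd P" "dual K P = - weight K" "enn2real (cost K) = P \<bullet> \<Sigma>0" and Y: "total_moment L Y"
  shows "enn2real (cost K) - enn2real (cost L) \<le> (norm (grad_factor K P))\<^sup>2 * trace Y / min_eigenvalue R"
proof -
  let ?r = "min_eigenvalue R" and ?E = "grad_factor K P" and ?d = "L - K"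
  have r: "?r > 0" by (rule min_eigenvalue_pos[OF R])
  have psd: "psd Y" using Y by (simp add: total_moment_def)
  have "- (1 / ?r) * (norm ?E)\<^sup>2 * (x \<bullet> x) \<le> x \<bullet> ((weight L + dual L P) *v x)" for x
  proof -
    define z where "z = ?d *v x"
    define e where "e = ?E *v x"
    have "z \<bullet> (curvature P *v z) = z \<bullet> (R *v z) + (D *v z) \<bullet> (P *v (D *v z))"
      by (simp add: curvature_def mv.add_left inner_add_right inner_mv_transpose matrix_vector_mul_assoc[symmetric])
    then have 1: "?r * (z \<bullet> z) \<le> z \<bullet> (curvature P *v z)"
      using R_ge[of z] psd_nonneg[OF P(1), of "D *v z"] by linarith
    have "(?r *\<^sub>R z + e) \<bullet> (?r *\<^sub>R z + e) = (?r * (z \<bullet> z) + 2 * (z \<bullet> e)) * ?r + e \<bullet> e"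
      by (simp add: inner_add_left inner_add_right inner_commute[of e z] algebra_simps)
    then have "- (e \<bullet> e) \<le> (?r * (z \<bullet> z) + 2 * (z \<bullet> e)) * ?r"
      using inner_ge_zero[of "?r *\<^sub>R z + e"] by linarith
    then have "- (e \<bullet> e) / ?r \<le> ?r * (z \<bullet> z) + 2 * (z \<bullet> e)"
      by (simp only: pos_divide_le_eq[OF r])
    then have "- (e \<bullet> e) / ?r \<le> x \<bullet> ((weight L + dual L P) *v x)"
      using 1 unfolding dual_difference[OF psd_sym[OF P(1)] P(2)] z_def[symmetric] e_def[symmetric] by linarith
    moreover have "e \<bullet> e \<le> (norm ?E)\<^sup>2 * (x \<bullet> x)"
      using power_mono[OF norm_matrix_vector_le[of ?E x], of 2]
      by (simp add: e_def power_mult_distrib power2_norm_eq_inner)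
    then have "e \<bullet> e / ?r \<le> (norm ?E)\<^sup>2 * (x \<bullet> x) / ?r"
      using r by (intro divide_right_mono) auto
    ultimately show ?thesis by simp
  qed
  then have "- (1 / ?r) * (norm ?E)\<^sup>2 * trace Y \<le> (weight L + dual L P) \<bullet> Y"
    by (rule psd_inner_ge_trace[OF psd])
  also have "\<dots> = enn2real (cost L) - enn2real (cost K)"
    using cost_difference(1)[OF psd_sym[OF P(1)] P(2) Y] P(3) by simp
  finally show ?thesis by simp
qed

lemma total_moment_trace_le:
  assumes Y: "total_moment L Y"
  shows "min_eigenvalue Q * trace Y \<le> enn2real (cost L)"
  unfolding cost_total[OF Y]
  by (rule psd_inner_ge_trace[OF _ weight_ge]) (use Y in \<open>simp add: total_moment_def\<close>)

text \<open>A vanishing total moment would contradict \<open>lyap Y = - \<Sigma>0\<close>. Positive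
  cost is what makes \<mu> positive.\<close>

lemma cost_pos:
  assumes Y: "total_moment L Y"
  shows "0 < enn2real (cost L)"
proof -
  have psd: "psd Y" and eq: "lyap (drift L) (diffusion L) Y = - \<Sigma>0" using Y by (auto simp: total_moment_def)
  have "Y \<noteq> 0"
  proof
    assume "Y = 0"
    then have "\<Sigma>0 = 0" using eq by (simp add: linear_0[OF linear_lyap])
    then show False using min_eigenvalue_pos[OF \<Sigma>0] \<Sigma>0
      by (auto simp: positive_definite_def intro: spec[of _ "axis undefined 1"])
  qed
  then have "0 < trace Y" using psd_norm_le_trace[OF psd] by (meson less_le_trans zero_less_norm_iff)
  then show ?thesis
    using total_moment_trace_le[OF Y] mult_pos_pos[OF min_eigenvalue_pos[OF Q]] by fastforce
qed

text \<open>The test vector is an eigenvector for the minimal eigenvalue \<open>l\<close> of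
  \<open>Y\<close>. Its diffusion term is nonnegative and is dropped; its drift term is at most
  \<open>2 * l\<close> times a bound on the drift. That bound is kept as a sum of norms, because the
  self-referential estimate below needs \<open>norm K\<close> explicitly.\<close>

lemma total_moment_ge:
  assumes Y: "total_moment K Y"
  obtains l where "\<And>x. l * (x \<bullet> x) \<le> x \<bullet> (Y *v x)"
    "min_eigenvalue \<Sigma>0 \<le> 2 * l * (spectral_norm A + spectral_norm B * norm K)" "0 < l"
    "0 < spectral_norm A + spectral_norm B * norm K"
proof -
  have psd: "psd Y" and eq: "lyap (drift K) (diffusion K) Y = - \<Sigma>0" using Y by (auto simp: total_moment_def)
  let ?\<alpha> = "spectral_norm A + spectral_norm B * norm K" and ?\<sigma> = "min_eigenvalue \<Sigma>0"
  obtain v l where v: "v \<noteq> 0" "Y *v v = l *\<^sub>R v" "\<And>x. l * (x \<bullet> x) \<le> x \<bullet> (Y *v x)"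
    using sym_min_eigen[OF psd_sym[OF psd]] by blast
  have vv: "0 < v \<bullet> v" using v(1) by simp
  have "0 \<le> l * (v \<bullet> v)" using psd_nonneg[OF psd, of v] v(2) by simp
  then have l: "0 \<le> l" using vv by (simp add: zero_le_mult_iff)
  let ?w = "drift K *v v"
  have "norm ?w \<le> norm (A *v v) + norm (B *v (K *v v))"
    by (simp add: drift_def mv.add_left matrix_vector_mul_assoc[symmetric] norm_triangle_ineq)
  also have "\<dots> \<le> spectral_norm A * norm v + spectral_norm B * (norm K * norm v)"
    by (intro add_mono spectral_norm_le order_trans[OF spectral_norm_le] mult_left_mono
        norm_matrix_vector_le spectral_norm_nonneg)
  also have "\<dots> = ?\<alpha> * norm v" by (simp add: algebra_simps)
  finally have "norm v * norm ?w \<le> norm v * (?\<alpha> * norm v)" by (intro mult_left_mono) auto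
  also have "\<dots> = ?\<alpha> * (v \<bullet> v)" by (simp add: power2_norm_eq_inner[symmetric] power2_eq_square)
  finally have "\<bar>v \<bullet> ?w\<bar> \<le> ?\<alpha> * (v \<bullet> v)" using Cauchy_Schwarz_ineq2 order_trans by blast
  then have "- (v \<bullet> ?w) \<le> ?\<alpha> * (v \<bullet> v)" by linarith
  then have a: "2 * l * (- (v \<bullet> ?w)) \<le> 2 * l * (?\<alpha> * (v \<bullet> v))" using l by (intro mult_left_mono) auto
  have "- (v \<bullet> (\<Sigma>0 *v v)) = v \<bullet> (lyap (drift K) (diffusion K) Y *v v)" by (simp add: eq mv.minus_left)
  also have "\<dots> \<ge> 2 * (l * (v \<bullet> ?w))"
    using psd_nonneg[OF psd, of "transpose (diffusion K) *v v"]
    by (simp add: lyap_quad[OF psd_sym[OF psd]] v(2) inner_mv_transpose transpose_transpose)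
  finally have "v \<bullet> (\<Sigma>0 *v v) \<le> 2 * l * (- (v \<bullet> ?w))" by simp
  moreover have "?\<sigma> * (v \<bullet> v) \<le> v \<bullet> (\<Sigma>0 *v v)"
    using \<Sigma>0 min_eigenvalue_le(1) by (auto simp: positive_definite_def)
  ultimately have "?\<sigma> * (v \<bullet> v) \<le> 2 * l * (?\<alpha> * (v \<bullet> v))" using a by (meson order_trans)
  then have "?\<sigma> * (v \<bullet> v) \<le> (2 * l * ?\<alpha>) * (v \<bullet> v)" by (simp only: mult.assoc)
  then have main: "?\<sigma> \<le> 2 * l * ?\<alpha>" using vv by (rule mult_right_le_imp_le)
  then have "0 < l * ?\<alpha>" using min_eigenvalue_pos[OF \<Sigma>0] by simp
  then have "0 < l" "0 < ?\<alpha>" using l by (auto simp: zero_less_mult_iff)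
  then show ?thesis using that v(3) main by blast
qed

text \<open>The cost gives \<open>r * (l * (norm K)\<^sup>2) \<le> J0\<close>, and \<open>l\<close>
  is at least \<open>\<sigma> / (2 * \<alpha>)\<close>. Hence
  \<open>(norm K)\<^sup>2 \<le> 2 * \<alpha> * \<kappa>\<close>, so that \<open>\<alpha>\<close> is
  bounded in terms of its own square root.\<close>

lemma closed_loop_norm_bound:
  assumes Y: "total_moment K Y" and J0: "enn2real (cost K) \<le> J0"
  shows "spectral_norm A + spectral_norm B * norm K
    \<le> 2 * (spectral_norm A + (spectral_norm B)\<^sup>2 * J0 / (min_eigenvalue R * min_eigenvalue \<Sigma>0))"
proof -
  obtain l where l: "\<And>x. l * (x \<bullet> x) \<le> x \<bullet> (Y *v x)"
    "min_eigenvalue \<Sigma>0 \<le> 2 * l * (spectral_norm A + spectral_norm B * norm K)" "0 < l"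
    "0 < spectral_norm A + spectral_norm B * norm K"
    by (rule total_moment_ge[OF Y], rule that)
  define \<alpha> where "\<alpha> = spectral_norm A + spectral_norm B * norm K"
  define b where "b = spectral_norm B"
  define \<sigma> where "\<sigma> = min_eigenvalue \<Sigma>0"
  define r where "r = min_eigenvalue R"
  have \<sigma>: "0 < \<sigma>" and r: "0 < r" using min_eigenvalue_pos \<Sigma>0 R by (auto simp: \<sigma>_def r_def)
  have \<alpha>: "0 < \<alpha>" "\<sigma> \<le> 2 * l * \<alpha>" using l by (auto simp: \<alpha>_def \<sigma>_def)
  have b: "0 \<le> b" by (simp add: b_def spectral_norm_nonneg)
  have psd: "psd Y" using Y by (simp add: total_moment_def)
  have psd': "psd (Y - l *\<^sub>R mat 1)"
    using l(1) by (simp add: psd_def transpose_diff transpose_scaleR psd_sym[OF psd] transpose_mat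
        mv.diff_left mv.scaleR_left inner_diff_right)
  have "0 \<le> (transpose K ** K) \<bullet> (Y - l *\<^sub>R mat 1)"
    by (rule psd_inner_nonneg[OF psd'])
      (simp add: matrix_vector_mul_assoc[symmetric] inner_mv_transpose[symmetric])
  also have "\<dots> = (transpose K ** K) \<bullet> Y - l * (norm K)\<^sup>2"
    by (simp add: inner_diff_right inner_matrix_mult_left[of _ _ "mat 1"] transpose_transpose power2_norm_eq_inner)
  finally have "l * (norm K)\<^sup>2 \<le> (transpose K ** K) \<bullet> Y" by simp
  then have "r * (l * (norm K)\<^sup>2) \<le> r * ((transpose K ** K) \<bullet> Y)" using r by simp
  also have "\<dots> = (r *\<^sub>R (transpose K ** K)) \<bullet> Y" by simp
  also have "\<dots> \<le> weight K \<bullet> Y"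
  proof (rule psd_inner_mono[OF psd])
    fix x
    have "x \<bullet> ((r *\<^sub>R (transpose K ** K)) *v x) = r * ((K *v x) \<bullet> (K *v x))"
      by (simp add: mv.scaleR_left matrix_vector_mul_assoc[symmetric] inner_mv_transpose)
    also have "\<dots> \<le> x \<bullet> (weight K *v x)"
      unfolding weight_quad r_def using R_ge[of "K *v x"] psd_nonneg[OF positive_definite_psd[OF Q], of x] by linarith
    finally show "x \<bullet> ((r *\<^sub>R (transpose K ** K)) *v x) \<le> x \<bullet> (weight K *v x)" .
  qed
  also have "\<dots> \<le> J0" using J0 by (simp add: cost_total[OF Y])
  finally have 1: "r * (l * (norm K)\<^sup>2) \<le> J0" .
  have "r * \<sigma> * (norm K)\<^sup>2 \<le> r * (2 * l * \<alpha>) * (norm K)\<^sup>2"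
    using \<alpha> r by (intro mult_right_mono mult_left_mono) auto
  also have "\<dots> = 2 * \<alpha> * (r * (l * (norm K)\<^sup>2))" by (simp add: mult_ac)
  also have "\<dots> \<le> 2 * \<alpha> * J0" using 1 \<alpha> by (intro mult_left_mono) auto
  finally have "r * \<sigma> * (norm K)\<^sup>2 \<le> 2 * \<alpha> * J0" .
  then have "(norm K)\<^sup>2 \<le> 2 * \<alpha> * J0 / (r * \<sigma>)"
    using mult_pos_pos[OF r \<sigma>] by (simp add: pos_le_divide_eq mult.commute)
  moreover define \<kappa> where "\<kappa> = J0 / (r * \<sigma>)"
  ultimately have K2: "(norm K)\<^sup>2 \<le> 2 * \<alpha> * \<kappa>" by simp
  define x where "x = b\<^sup>2 * \<kappa>"
  have J0': "0 \<le> J0" using J0 cost_pos[OF Y] by linarith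
  have x: "0 \<le> x" using J0' r \<sigma> by (simp add: x_def \<kappa>_def)
  have "(b * norm K)\<^sup>2 = b\<^sup>2 * (norm K)\<^sup>2" by (simp add: power_mult_distrib)
  also have "\<dots> \<le> b\<^sup>2 * (2 * \<alpha> * \<kappa>)" using K2 by (intro mult_left_mono) auto
  \<comment> \<open>Pairing \<open>x\<close> with \<open>\<alpha> / 2\<close> in the AM-GM
    inequality lets the resulting \<open>\<alpha> / 2\<close> be absorbed on the left, at the price
    of a factor 2.\<close>
  also have "\<dots> = 4 * x * (\<alpha> / 2)" by (simp add: x_def algebra_simps)
  also have "\<dots> \<le> (x + \<alpha> / 2)\<^sup>2" using sum_squares_bound[of x "\<alpha> / 2"] by (simp add: power2_sum mult.commute)
  finally have "b * norm K \<le> x + \<alpha> / 2" by (rule power2_le_imp_le) (use x \<alpha> in simp)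
  then have "\<alpha> \<le> 2 * (spectral_norm A + x)" unfolding \<alpha>_def b_def by argo
  then show ?thesis by (simp add: \<alpha>_def x_def \<kappa>_def b_def r_def \<sigma>_def)
qed

text \<open>The gap is at most \<open>e * J0 / (q * r)\<close>, where \<open>e\<close> is the
  squared norm of the gradient factor. Eliminating \<open>l\<close> from
  \<open>4 * l\<^sup>2 * e \<le> (norm G)\<^sup>2\<close> and
  \<open>\<sigma> \<le> 4 * l * \<beta>\<close> bounds \<open>e\<close> and produces \<mu> with its
  factor 4.\<close>

theorem gradient_domination:
  assumes K0: "cost K0 < \<infinity>" and K: "cost K \<le> cost K0" and Kopt: "cost Kopt \<le> cost K0"
  defines "\<mu> \<equiv> gradient_domination_const A B Q R \<Sigma>0 (enn2real (cost K0))"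
  shows "0 < \<mu>"
    and "\<exists>G. (GDERIV (\<lambda>L. enn2real (cost L)) K :> G) \<and>
      enn2real (cost K) - enn2real (cost Kopt) \<le> \<mu> * (norm G)\<^sup>2"
proof -
  obtain Y where Y: "total_moment K Y" using total_moment_finite K K0 le_less_trans by blast
  obtain Y' where Y': "total_moment Kopt Y'" using total_moment_finite Kopt K0 le_less_trans by blast
  have psd: "psd Y" using Y by (simp add: total_moment_def)
  define J0 where "J0 = enn2real (cost K0)"
  define \<beta> where "\<beta> = spectral_norm A + (spectral_norm B)\<^sup>2 * J0 / (min_eigenvalue R * min_eigenvalue \<Sigma>0)"
  define \<alpha> where "\<alpha> = spectral_norm A + spectral_norm B * norm K"
  define r where "r = min_eigenvalue R"
  define q where "q = min_eigenvalue Q"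
  define \<sigma> where "\<sigma> = min_eigenvalue \<Sigma>0"
  have pos: "0 < r" "0 < q" "0 < \<sigma>" using min_eigenvalue_pos Q R \<Sigma>0 by (auto simp: r_def q_def \<sigma>_def)
  have leJ: "enn2real (cost K) \<le> J0" "enn2real (cost Kopt) \<le> J0"
    using K Kopt K0 by (auto simp: J0_def intro: enn2real_mono)
  have J0: "0 < J0" using cost_pos[OF Y] leJ by linarith
  have \<mu>: "\<mu> = 4 * J0 / (r * q * \<sigma>\<^sup>2) * \<beta>\<^sup>2"
    by (simp add: \<mu>_def gradient_domination_const_def J0_def \<beta>_def r_def q_def \<sigma>_def)
  obtain l where l': "\<And>x. l * (x \<bullet> x) \<le> x \<bullet> (Y *v x)"
    "min_eigenvalue \<Sigma>0 \<le> 2 * l * (spectral_norm A + spectral_norm B * norm K)" "0 < l"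
    "0 < spectral_norm A + spectral_norm B * norm K"
    by (rule total_moment_ge[OF Y], rule that)
  then have l: "\<And>x. l * (x \<bullet> x) \<le> x \<bullet> (Y *v x)" "\<sigma> \<le> 2 * l * \<alpha>" "0 < l" "0 < \<alpha>"
    by (auto simp: \<alpha>_def \<sigma>_def)
  have \<alpha>\<beta>: "\<alpha> \<le> 2 * \<beta>"
    using closed_loop_norm_bound[OF Y leJ(1)] by (simp add: \<alpha>_def \<beta>_def)
  have \<beta>: "0 < \<beta>" using \<alpha>\<beta> l(4) by linarith
  show "0 < \<mu>" unfolding \<mu> using pos J0 \<beta> by simp
  obtain P where P: "psd P" "dual K P = - weight K" "enn2real (cost K) = P \<bullet> \<Sigma>0"
    by (rule dual_solution[OF Y])
  define E where "E = grad_factor K P"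
  define e where "e = (norm E)\<^sup>2"
  define G where "G = 2 *\<^sub>R (E ** Y)"
  have "GDERIV (\<lambda>L. enn2real (cost L)) K :> G"
    unfolding G_def E_def by (rule cost_gradient[OF Y P])
  moreover have "enn2real (cost K) - enn2real (cost Kopt) \<le> \<mu> * (norm G)\<^sup>2"
  proof -
    \<comment> \<open>\<open>Y\<close> stretches every vector by at least \<open>l\<close>, so the
      Frobenius norm of \<open>E ** Y\<close> is at least \<open>l\<close> times that of
      \<open>E\<close>.\<close>
    have Yx: "l\<^sup>2 * (x \<bullet> x) \<le> x \<bullet> ((Y ** Y) *v x)" for x
    proof -
      have "l * (norm x * norm x) \<le> norm x * norm (Y *v x)"
        using l(1)[of x] norm_cauchy_schwarz[of x "Y *v x"]
        by (simp add: power2_norm_eq_inner[symmetric] power2_eq_square)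
      then have "l * norm x \<le> norm (Y *v x)" by (cases "x = 0") (auto simp: mult.left_commute)
      then have "(l * norm x)\<^sup>2 \<le> (norm (Y *v x))\<^sup>2" using l(3) by (intro power_mono) auto
      also have "\<dots> = x \<bullet> ((Y ** Y) *v x)"
        by (simp add: power2_norm_eq_inner matrix_vector_mul_assoc[symmetric] inner_mv_transpose psd_sym[OF psd])
      finally show ?thesis by (simp add: power_mult_distrib power2_norm_eq_inner)
    qed
    have psdE: "psd (transpose E ** E)"
      by (simp add: psd_def matrix_transpose_mul transpose_transpose matrix_vector_mul_assoc[symmetric]
          inner_mv_transpose[symmetric])
    have "l\<^sup>2 * trace (transpose E ** E) \<le> (Y ** Y) \<bullet> (transpose E ** E)"
      by (rule psd_inner_ge_trace[OF psdE Yx])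
    also have "\<dots> = (norm (E ** Y))\<^sup>2"
      using inner_matrix_mult_right[of Y Y "transpose E ** E"] inner_matrix_mult_left[of E Y "E ** Y"]
      by (simp add: power2_norm_eq_inner psd_sym[OF psd] matrix_mul_assoc)
    also have "trace (transpose E ** E) = e"
      by (simp add: e_def inner_matrix_eq_trace[symmetric] power2_norm_eq_inner)
    finally have G: "4 * l\<^sup>2 * e \<le> (norm G)\<^sup>2" by (simp add: G_def power_mult_distrib)
    have "\<sigma>\<^sup>2 \<le> (2 * l * (2 * \<beta>))\<^sup>2"
    proof (rule power_mono)
      have "2 * l * \<alpha> \<le> 2 * l * (2 * \<beta>)" using \<alpha>\<beta> l(3) by (intro mult_left_mono) auto
      then show "\<sigma> \<le> 2 * l * (2 * \<beta>)" using l(2) by linarith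
    qed (use pos in simp)
    then have "\<sigma>\<^sup>2 * e \<le> (2 * l * (2 * \<beta>))\<^sup>2 * e" by (rule mult_right_mono) (simp add: e_def)
    also have "\<dots> = 4 * \<beta>\<^sup>2 * (4 * l\<^sup>2 * e)" by (simp add: power_mult_distrib)
    also have "\<dots> \<le> 4 * \<beta>\<^sup>2 * (norm G)\<^sup>2" using G by (intro mult_left_mono) auto
    finally have e: "e \<le> 4 * \<beta>\<^sup>2 * (norm G)\<^sup>2 / \<sigma>\<^sup>2" using pos by (simp add: field_simps)
    \<comment> \<open>The optimal policy costs at most \<open>J0\<close>, and the cost dominates
      \<open>q\<close> times the trace of the total moment.\<close>
    have tr: "trace Y' \<le> J0 / q"
      using total_moment_trace_le[OF Y'] leJ(2) pos by (simp add: q_def field_simps)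
    have "enn2real (cost K) - enn2real (cost Kopt) \<le> e * trace Y' / r"
      using cost_gap[OF P Y'] by (simp add: e_def E_def r_def)
    also have "\<dots> \<le> (4 * \<beta>\<^sup>2 * (norm G)\<^sup>2 / \<sigma>\<^sup>2) * (J0 / q) / r"
      using e tr pos Y' by (intro divide_right_mono mult_mono) (auto simp: e_def total_moment_def psd_trace_nonneg)
    also have "\<dots> = \<mu> * (norm G)\<^sup>2" unfolding \<mu> by (simp add: field_simps)
    finally show ?thesis .
  qed
  ultimately show "\<exists>G. (GDERIV (\<lambda>L. enn2real (cost L)) K :> G) \<and>
      enn2real (cost K) - enn2real (cost Kopt) \<le> \<mu> * (norm G)\<^sup>2" by blast
qed

end

section \<open>From the state process to the matrix problem\<close>

theorem theorem3p2:
  fixes M :: "'w measure" and F :: "real \<Rightarrow> 'w measure" and W :: "real \<Rightarrow> 'w \<Rightarrow> real"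
    and A C Q :: "real^'n^'n" and B D :: "real^'m^'n" and R :: "real^'m^'m"
    and X0 :: "'w \<Rightarrow> real^'n" and X :: "real^'n^'m \<Rightarrow> real \<Rightarrow> 'w \<Rightarrow> real^'n"
    and K0 Kopt K :: "real^'n^'m" and \<mu> :: real
  assumes basis: "brownian_basis M F W"
    and Q: "positive_definite Q" and R: "positive_definite R"
    and X0: "X0 \<in> borel_measurable (F 0)" "integrable M (\<lambda>\<omega>. (norm (X0 \<omega>))\<^sup>2)"
    and \<Sigma>0: "positive_definite (second_moment M X0)"
    and state: "\<And>L. closed_loop_state M F W A B C D L (X L)"
    and initial: "\<And>L. AE \<omega> in M. X L 0 \<omega> = X0 \<omega>"
    and K0: "K0 \<in> ms_stabilizers M F W A B C D"
    and Kopt: "is_arg_min (lq_cost M Q R X) (\<lambda>L. L \<in> ms_stabilizers M F W A B C D) Kopt"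
    and K: "lq_cost M Q R X K \<le> lq_cost M Q R X K0"
    and \<mu>: "\<mu> = gradient_domination_const A B Q R (second_moment M X0)
                  (enn2real (lq_cost M Q R X K0))"
  shows "\<mu> > 0 \<and>
    (\<exists>G. (GDERIV (\<lambda>L. enn2real (lq_cost M Q R X L)) K :> G) \<and>
       enn2real (lq_cost M Q R X K) - enn2real (lq_cost M Q R X Kopt) \<le> \<mu> * (norm G)\<^sup>2)"
proof -
  interpret brownian_basis M F W by (rule basis)
  have sde: "linear_sde_solution M F W (A + B ** L) (C + D ** L) (X L)" for L
    using state[of L] by (simp add: closed_loop_state_def)
  \<comment> \<open>The initial state equals \<open>X0\<close> almost surely, which is enough for
    second moments.\<close>
  have init: "second_moment M (X L 0) = second_moment M X0" for L
  proof -
    have "progressively_measurable F (X L)" using sde[of L] by (simp add: linear_sde_solution_def)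
    then have m: "X L 0 \<in> borel_measurable M" "X0 \<in> borel_measurable M"
      using progressively_measurable_joint(2)[of "X L" 0] measurable_M[of 0] X0(1) by auto
    have nth: "(\<lambda>x. x $ i) \<in> borel_measurable borel" for i :: 'n
      by (intro borel_measurable_continuous_onI continuous_intros)
    have "(\<integral>\<omega>. X L 0 \<omega> $ i * X L 0 \<omega> $ j \<partial>M) = (\<integral>\<omega>. X0 \<omega> $ i * X0 \<omega> $ j \<partial>M)" for i j
      using initial[of L]
      by (intro integral_cong_AE borel_measurable_times measurable_compose[OF m(1) nth]
          measurable_compose[OF m(2) nth]) auto
    then show ?thesis by (simp add: second_moment_def)
  qed
  interpret lq: lq_problem A C Q B D R "second_moment M X0" "\<lambda>L t. second_moment M (X L t)"
    by unfold_locales (rule Q R \<Sigma>0 init sde_moment_flow[OF sde])+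
  have cost: "lq.cost = lq_cost M Q R X"
  proof
    fix L
    show "lq.cost L = lq_cost M Q R X L"
      unfolding lq.cost_def lq_cost_def
      using sde_cost[OF sde[of L] lq.weight_nonneg] by (simp add: lq.weight_def)
  qed
  \<comment> \<open>The mean square of the state is the trace of its second moment, so a stabilizer
    has a decaying flow and therefore finite cost.\<close>
  have "lq.cost K0 < \<infinity>"
  proof (rule lq.cost_decay_finite)
    have "((\<lambda>t. \<integral>\<^sup>+\<omega>. ennreal (X K0 t \<omega> \<bullet> X K0 t \<omega>) \<partial>M) \<longlongrightarrow> 0) at_top"
      using K0 state[of K0] by (auto simp: ms_stabilizers_def)
    moreover have "\<forall>\<^sub>F t in at_top. (\<integral>\<^sup>+\<omega>. ennreal (X K0 t \<omega> \<bullet> X K0 t \<omega>) \<partial>M) = ennreal (trace (second_moment M (X K0 t)))"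
      using eventually_ge_at_top[of 0]
    proof eventually_elim
      case (elim t)
      show ?case
        using sde_second_moment[OF sde[of K0] elim, of "mat 1"]
        by (simp add: inner_mat1 nn_integral_eq_integral)
    qed
    ultimately have "((\<lambda>t. ennreal (trace (second_moment M (X K0 t)))) \<longlongrightarrow> ennreal 0) at_top"
      by (simp add: tendsto_cong)
    then show "((\<lambda>t. trace (second_moment M (X K0 t))) \<longlongrightarrow> 0) at_top"
      by (subst (asm) tendsto_ennreal_iff)
        (auto intro!: eventually_mono[OF eventually_ge_at_top[of 0]] psd_trace_nonneg lq.psd_flow)
  qed
  moreover have "lq.cost K \<le> lq.cost K0" using K by (simp add: cost)
  \<comment> \<open>Minimality is tested against the stabilizer \<open>K0\<close>; the costs of
    \<open>K\<close> and \<open>Kopt\<close> then both lie below a finite one.\<close>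
  moreover have "lq.cost Kopt \<le> lq.cost K0"
    using Kopt K0 by (auto simp: cost is_arg_min_def not_less)
  ultimately show ?thesis
    using lq.gradient_domination[of K0 K Kopt] unfolding \<mu> cost by blast
qed

end
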